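(* Let $\phi_0=1,\phi_1,\phi_2,\ldots$ be orthonormal functions that are dense in $L^2_w(\Omega)$. Let $g:\Omega\to\mathbb{R}$ be measurable with $\int_\Omega|g(x)\phi_i(x)|^2w(x)\,dx<\infty$ for all $i$, so that $M[g]$ has the infinite matrix representation $M_\infty[g]$, and let $M_n[g]$ be the $(n+1)\times(n+1)$ matrix with elements $[M_n[g]]_{i,j}=\langle\phi_i,g\,\phi_j\rangle$, $0\le i,j\le n$. Let $c\in\mathbb{R}$ be $\operatorname{ess\,sup}g$ or $\operatorname{ess\,inf}g$ and such that it is not an eigenvalue of $M_n[g]$ for any $n$, that is, $c$ is not an eigenvalue of $M[g]$, or if it is, then no corresponding eigenfunction is a finite linear combination of the basis functions $\phi_i$. Let $f$ be a real function that is Riemann--Stieltjes integrable with respect to the spectral family of $M[g]$ on any finite interval not containing $c$, and bounded so that $|f(x)|\le a+\frac{b}{|x-c|^p}$ for some $a,b\ge0$ and $0\le p\le1$ that satisfy $$\int_\Omega\left(a+\frac{b}{|g(x)-c|^p}\right)w(x)\,dx<\infty.$$ Then $$\lim_{n\to\infty}[f(M_n[g])]_{0,0}=\int_\Omega f(g(x))\,w(x)\,dx.$$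
   Context: $\Omega\subset\mathbb{R}^d$, $w:\Omega\to[0,\infty)$ with $\int_\Omega w(x)\,dx=1$. $L^2_w(\Omega)$ is the Hilbert space with inner product $\langle\phi,\psi\rangle=\int_\Omega\overline{\phi(x)}\,\psi(x)\,w(x)\,dx$. Orthonormal functions being dense means that their linear span is dense, i.e. they form an orthonormal basis. For measurable real $g$, $M[g]$ is the maximal (self-adjoint) multiplication operator $\phi\mapsto g\phi$ with domain $\{\phi:\|g\phi\|<\infty\}$. $\operatorname{ess\,inf}g$ and $\operatorname{ess\,sup}g$ are the endpoints of the convex hull of the essential range $\{y\in\mathbb{R}:\text{for all }\epsilon>0,\ \int_{\{x\in\Omega:|g(x)-y|<\epsilon\}}w(x)\,dx>0\}$. Matrix indices start from $0$. $M_\infty[g]$ is the infinite matrix $[\langle\phi_i,g\phi_j\rangle]_{i,j\ge0}$. By standing convention, it is regarded as an operator on $\ell^2$ with domain $\{v\in\ell^2:\|M_\infty[g]v\|<\infty\}$, this operator is self-adjoint, and it is identified with $M[g]$ under the isomorphism $v\mapsto\sum_iv_i\phi_i$ (the domains correspond). Let $E(t)$ be the (right-continuous) spectral family of $M[g]$. A function $f$ is Riemann--Stieltjes integrable on $[\alpha,\beta]$ with respect to a non-decreasing $\rho$ if the sums $\sum_kf(\xi_k)(\rho(t_k)-\rho(t_{k-1}))$ converge for all partitions $\alpha=t_0<\dots<t_n=\beta$ with mesh tending to $0$ and any $\xi_k\in[t_{k-1},t_k]$; with respect to the spectral family means with respect to $\|E(t)\phi\|^2$ for all $\phi$ in the Hilbert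 space, on intervals with endpoints that are not eigenvalues.
   Formalization: If c is an eigenvalue of M[g], f is additionally assumed continuous at c relative to the convex hull of the essential range of g; without this the claim fails, e.g. Legendre basis on [0,1], g=max(0,x-1/2), c=0, f the indicator of {0}. *)

theory Defs
  imports "HOL-Analysis.Analysis" "Jordan_Normal_Form.Schur_Decomposition"
begin

hide_const (open) Finite_Cartesian_Product.vec Finite_Cartesian_Product.mat

section \<open>The weighted space\<close>

text \<open>Elements of the weighted space are represented by functions; two functions denote the same
  element when they agree almost everywhere for the measure with density \<open>w\<close>.\<close>

definition L2w :: "(real^'d) set \<Rightarrow> (real^'d \<Rightarrow> real) \<Rightarrow> (real^'d \<Rightarrow> complex) set" where
  "L2w \<Omega> w = {\<phi> \<in> borel_measurable (lebesgue_on \<Omega>).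
     integrable (lebesgue_on \<Omega>) (\<lambda>x. (cmod (\<phi> x))\<^sup>2 * w x)}"

definition inner_w ::
  "(real^'d) set \<Rightarrow> (real^'d \<Rightarrow> real) \<Rightarrow> (real^'d \<Rightarrow> complex) \<Rightarrow> (real^'d \<Rightarrow> complex) \<Rightarrow> complex" where
  "inner_w \<Omega> w \<phi> \<psi> = (LINT x|lebesgue_on \<Omega>. cnj (\<phi> x) * \<psi> x * complex_of_real (w x))"

definition norm_w :: "(real^'d) set \<Rightarrow> (real^'d \<Rightarrow> real) \<Rightarrow> (real^'d \<Rightarrow> complex) \<Rightarrow> real" where
  "norm_w \<Omega> w \<phi> = sqrt (LINT x|lebesgue_on \<Omega>. (cmod (\<phi> x))\<^sup>2 * w x)"

definition eq_w :: "(real^'d) set \<Rightarrow> (real^'d \<Rightarrow> real) \<Rightarrow>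
    (real^'d \<Rightarrow> complex) \<Rightarrow> (real^'d \<Rightarrow> complex) \<Rightarrow> bool" where
  "eq_w \<Omega> w \<phi> \<psi> \<longleftrightarrow> (AE x in lebesgue_on \<Omega>. w x > 0 \<longrightarrow> \<phi> x = \<psi> x)"

definition orthonormal_w ::
  "(real^'d) set \<Rightarrow> (real^'d \<Rightarrow> real) \<Rightarrow> (nat \<Rightarrow> real^'d \<Rightarrow> complex) \<Rightarrow> bool" where
  "orthonormal_w \<Omega> w \<phi> \<longleftrightarrow> (\<forall>i. \<phi> i \<in> L2w \<Omega> w) \<and>
     (\<forall>i j. inner_w \<Omega> w (\<phi> i) (\<phi> j) = (if i = j then 1 else 0))"

definition span_dense_w ::
  "(real^'d) set \<Rightarrow> (real^'d \<Rightarrow> real) \<Rightarrow> (nat \<Rightarrow> real^'d \<Rightarrow> complex) \<Rightarrow> bool" where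
  "span_dense_w \<Omega> w \<phi> \<longleftrightarrow> (\<forall>\<psi>\<in>L2w \<Omega> w. \<forall>\<epsilon>>0. \<exists>n a.
     norm_w \<Omega> w (\<lambda>x. \<psi> x - (\<Sum>i\<le>n. a i * \<phi> i x)) < \<epsilon>)"

section \<open>The multiplication operator and its spectral family\<close>

definition mult_by :: "(real^'d \<Rightarrow> real) \<Rightarrow> (real^'d \<Rightarrow> complex) \<Rightarrow> (real^'d \<Rightarrow> complex)" where
  "mult_by g \<phi> = (\<lambda>x. complex_of_real (g x) * \<phi> x)"

definition mult_dom ::
  "(real^'d) set \<Rightarrow> (real^'d \<Rightarrow> real) \<Rightarrow> (real^'d \<Rightarrow> real) \<Rightarrow> (real^'d \<Rightarrow> complex) set" where
  "mult_dom \<Omega> w g = {\<phi> \<in> L2w \<Omega> w. mult_by g \<phi> \<in> L2w \<Omega> w}"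

definition mult_eigenvalue ::
  "(real^'d) set \<Rightarrow> (real^'d \<Rightarrow> real) \<Rightarrow> (real^'d \<Rightarrow> real) \<Rightarrow> real \<Rightarrow> bool" where
  "mult_eigenvalue \<Omega> w g t \<longleftrightarrow> (\<exists>\<phi>\<in>mult_dom \<Omega> w g. \<not> eq_w \<Omega> w \<phi> (\<lambda>x. 0) \<and>
     eq_w \<Omega> w (mult_by g \<phi>) (\<lambda>x. complex_of_real t * \<phi> x))"

text \<open>The spectral projection of a multiplication operator that belongs to \<open>(-\<infinity>, t]\<close> is
  multiplication by the indicator function of \<open>{x. g x \<le> t}\<close>; including the endpoint makes the
  family continuous from the right.\<close>

definition spectral_family ::
  "(real^'d \<Rightarrow> real) \<Rightarrow> real \<Rightarrow> (real^'d \<Rightarrow> complex) \<Rightarrow> (real^'d \<Rightarrow> complex)" where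
  "spectral_family g t = mult_by (indicator {x. g x \<le> t})"

definition ess_range ::
  "(real^'d) set \<Rightarrow> (real^'d \<Rightarrow> real) \<Rightarrow> (real^'d \<Rightarrow> real) \<Rightarrow> real set" where
  "ess_range \<Omega> w g = {y. \<forall>\<epsilon>>0. (LINT x:{x\<in>\<Omega>. \<bar>g x - y\<bar> < \<epsilon>}|lebesgue. w x) > 0}"

definition ess_sup_w ::
  "(real^'d) set \<Rightarrow> (real^'d \<Rightarrow> real) \<Rightarrow> (real^'d \<Rightarrow> real) \<Rightarrow> ereal" where
  "ess_sup_w \<Omega> w g = (SUP y\<in>convex hull (ess_range \<Omega> w g). ereal y)"

definition ess_inf_w ::
  "(real^'d) set \<Rightarrow> (real^'d \<Rightarrow> real) \<Rightarrow> (real^'d \<Rightarrow> real) \<Rightarrow> ereal" where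
  "ess_inf_w \<Omega> w g = (INF y\<in>convex hull (ess_range \<Omega> w g). ereal y)"

section \<open>Riemann--Stieltjes integrability\<close>

definition RS_integrable :: "(real \<Rightarrow> real) \<Rightarrow> (real \<Rightarrow> real) \<Rightarrow> real \<Rightarrow> real \<Rightarrow> bool" where
  "RS_integrable f \<rho> \<alpha> \<beta> \<longleftrightarrow> (\<exists>I. \<forall>\<epsilon>>0. \<exists>\<delta>>0. \<forall>n t \<xi>.
     t 0 = \<alpha> \<and> t n = \<beta> \<and>
     (\<forall>k<n. t k < t (Suc k) \<and> t (Suc k) - t k < \<delta> \<and> \<xi> k \<in> {t k..t (Suc k)}) \<longrightarrow>
     \<bar>(\<Sum>k<n. f (\<xi> k) * (\<rho> (t (Suc k)) - \<rho> (t k))) - I\<bar> < \<epsilon>)"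

definition RS_integrable_spectral :: "(real^'d) set \<Rightarrow> (real^'d \<Rightarrow> real) \<Rightarrow> (real^'d \<Rightarrow> real) \<Rightarrow>
    (real \<Rightarrow> real) \<Rightarrow> real \<Rightarrow> real \<Rightarrow> bool" where
  "RS_integrable_spectral \<Omega> w g f \<alpha> \<beta> \<longleftrightarrow> (\<forall>\<phi>\<in>L2w \<Omega> w.
     RS_integrable f (\<lambda>t. (norm_w \<Omega> w (spectral_family g t \<phi>))\<^sup>2) \<alpha> \<beta>)"

section \<open>Matrix representations\<close>

definition mat_entry :: "(real^'d) set \<Rightarrow> (real^'d \<Rightarrow> real) \<Rightarrow> (nat \<Rightarrow> real^'d \<Rightarrow> complex) \<Rightarrow>
    (real^'d \<Rightarrow> real) \<Rightarrow> nat \<Rightarrow> nat \<Rightarrow> complex" where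
  "mat_entry \<Omega> w \<phi> g i j = inner_w \<Omega> w (\<phi> i) (mult_by g (\<phi> j))"

definition fin_mat :: "(real^'d) set \<Rightarrow> (real^'d \<Rightarrow> real) \<Rightarrow> (nat \<Rightarrow> real^'d \<Rightarrow> complex) \<Rightarrow>
    (real^'d \<Rightarrow> real) \<Rightarrow> nat \<Rightarrow> complex mat" where
  "fin_mat \<Omega> w \<phi> g n = mat (n + 1) (n + 1) (\<lambda>(i, j). mat_entry \<Omega> w \<phi> g i j)"

definition l2 :: "(nat \<Rightarrow> complex) set" where
  "l2 = {v. summable (\<lambda>i. (cmod (v i))\<^sup>2)}"

definition inf_mat_apply :: "(real^'d) set \<Rightarrow> (real^'d \<Rightarrow> real) \<Rightarrow> (nat \<Rightarrow> real^'d \<Rightarrow> complex) \<Rightarrow>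
    (real^'d \<Rightarrow> real) \<Rightarrow> (nat \<Rightarrow> complex) \<Rightarrow> (nat \<Rightarrow> complex)" where
  "inf_mat_apply \<Omega> w \<phi> g v = (\<lambda>i. \<Sum>j. mat_entry \<Omega> w \<phi> g i j * v j)"

definition inf_mat_dom :: "(real^'d) set \<Rightarrow> (real^'d \<Rightarrow> real) \<Rightarrow> (nat \<Rightarrow> real^'d \<Rightarrow> complex) \<Rightarrow>
    (real^'d \<Rightarrow> real) \<Rightarrow> (nat \<Rightarrow> complex) set" where
  "inf_mat_dom \<Omega> w \<phi> g = {v \<in> l2. inf_mat_apply \<Omega> w \<phi> g v \<in> l2}"

definition is_expansion :: "(real^'d) set \<Rightarrow> (real^'d \<Rightarrow> real) \<Rightarrow> (nat \<Rightarrow> real^'d \<Rightarrow> complex) \<Rightarrow>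
    (nat \<Rightarrow> complex) \<Rightarrow> (real^'d \<Rightarrow> complex) \<Rightarrow> bool" where
  "is_expansion \<Omega> w \<phi> v \<psi> \<longleftrightarrow> v \<in> l2 \<and> \<psi> \<in> L2w \<Omega> w \<and>
     (\<lambda>n. norm_w \<Omega> w (\<lambda>x. (\<Sum>i\<le>n. v i * \<phi> i x) - \<psi> x)) \<longlonglongrightarrow> 0"

text \<open>The infinite matrix with its maximal domain is unitarily equivalent to the maximal
  multiplication operator, via \<open>v \<mapsto> \<Sum>i. v i * \<phi> i\<close>. Since the latter operator is self-adjoint,
  this makes the former self-adjoint as well. It is a genuine condition: it can fail if the span
  of the \<open>\<phi> i\<close> is not a core.\<close>

definition mat_represents :: "(real^'d) set \<Rightarrow> (real^'d \<Rightarrow> real) \<Rightarrow> (nat \<Rightarrow> real^'d \<Rightarrow> complex) \<Rightarrow>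
    (real^'d \<Rightarrow> real) \<Rightarrow> bool" where
  "mat_represents \<Omega> w \<phi> g \<longleftrightarrow> (\<forall>v \<psi>. is_expansion \<Omega> w \<phi> v \<psi> \<longrightarrow>
     (v \<in> inf_mat_dom \<Omega> w \<phi> g \<longleftrightarrow> \<psi> \<in> mult_dom \<Omega> w g) \<and>
     (v \<in> inf_mat_dom \<Omega> w \<phi> g \<longrightarrow>
        is_expansion \<Omega> w \<phi> (inf_mat_apply \<Omega> w \<phi> g v) (mult_by g \<psi>)))"

section \<open>Functions of Hermitian matrices\<close>

text \<open>For a Hermitian matrix a unitary diagonalization exists, and the matrix obtained does not
  depend on the choice of the diagonalization.\<close>

definition hermitian_fun :: "(real \<Rightarrow> real) \<Rightarrow> complex mat \<Rightarrow> complex mat" where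
  "hermitian_fun f A = (let n = dim_row A in
     THE B. \<exists>U d. U \<in> carrier_mat n n \<and> U * mat_adjoint U = 1\<^sub>m n \<and>
       A = U * mat_diag n (\<lambda>i. complex_of_real (d i)) * mat_adjoint U \<and>
       B = U * mat_diag n (\<lambda>i. complex_of_real (f (d i))) * mat_adjoint U)"

section \<open>The bounding function\<close>

text \<open>The expression \<open>a + b / \<bar>x - c\<bar>\<^sup>p\<close> as an extended real. The case distinction is needed since
  \<open>0 powr 0 = 0\<close>. At \<open>x = c\<close> the value is \<open>\<infinity>\<close> if \<open>b > 0\<close> and \<open>p > 0\<close>; it is \<open>a + b\<close> if
  \<open>p = 0\<close>, and \<open>a\<close> if \<open>b = 0\<close>.\<close>

definition sing_bound :: "real \<Rightarrow> real \<Rightarrow> real \<Rightarrow> real \<Rightarrow> real \<Rightarrow> ennreal" where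
  "sing_bound a b p c x =
     ennreal a + ennreal b / ennreal (if p = 0 then 1 else \<bar>x - c\<bar> powr p)"

end

theory Submission
  imports Defs
begin

text \<open>Let \<open>\<mu>\<close> be the probability measure with density \<open>w\<close>. If the matrix \<open>M\<^sub>n[g]\<close> has the eigenvalues \<open>d\<^sub>k\<close> and its
  normalized eigenvectors have the zeroth components \<open>u\<^sub>0\<^sub>k\<close>, then \<open>[f(M\<^sub>n[g])]\<^sub>0\<^sub>0 = \<Sum>\<^sub>k \<bar>u\<^sub>0\<^sub>k\<bar>\<^sup>2 f(d\<^sub>k)\<close>
  (\<open>hermitian_spectral_entries\<close>). This is a quadrature rule for the distribution of \<open>g\<close> under \<open>\<mu>\<close>, whose weights
  add up to \<open>1\<close>, and the claim is that it converges for \<open>f\<close>.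

  The first step is convergence for resolvents. As \<open>c\<close> is an endpoint of the convex hull of the essential range,
  \<open>\<bar>g - c\<bar>\<close> is an affine function of \<open>g\<close>, and so is \<open>A = s + \<bar>g - c\<bar> \<ge> s > 0\<close>. The quadrature of \<open>1 / (s + \<bar>x - c\<bar>)\<close> is the
  energy of the Galerkin approximation to the solution of \<open>A u = 1\<close> in the span of \<open>\<phi>\<^sub>0, \<dots>, \<phi>\<^sub>n\<close>. The energies
  increase and are bounded, so the approximations converge; that the infinite matrix represents the self-adjoint
  multiplication operator makes their limit \<open>1 / A\<close> (\<open>galerkin_reciprocal\<close>). Hence the quadratures of
  \<open>1 / (s + \<bar>x - c\<bar>)\<close> converge to \<open>\<integral> 1 / A d\<mu>\<close>, and they do so from below.

  Convergence then extends to polynomials in \<open>1 / (1 + \<bar>x - c\<bar>)\<close>, by Weierstrass' theorem to continuous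
  functions of this variable, and by squeezing to indicator functions of intervals whose endpoints have probability
  zero (\<open>quad_conv_interval\<close>). Riemann--Stieltjes integrability implies that \<open>f\<close> can be squeezed
  between step functions on intervals that keep away from \<open>c\<close> (\<open>RS_integrable_inner\<close>). The mass
  far away from \<open>c\<close> is no problem, because there \<open>f\<close> is bounded and no mass escapes.

  It remains to control the mass near \<open>c\<close>. For \<open>0 < p < 1\<close> the function \<open>\<bar>x - c\<bar>\<^sup>-\<^sup>p\<close> is a superposition of
  resolvents with positive coefficients, and for \<open>p = 1\<close> it is their limit; so its quadratures, too, are at most its
  integral (\<open>quad_powr_le\<close>). As they converge for the bounded functions \<open>(s + \<bar>x - c\<bar>)\<^sup>-\<^sup>p\<close>, they cannot
  concentrate at the singularity (\<open>quad_conv_powr\<close>). If on the other hand \<open>g = c\<close> has positive probability,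
  integrability of the bound forces it to be constant, and \<open>f\<close> is continuous at \<open>c\<close>; the nodes, which never equal
  \<open>c\<close>, approach it and carry the mass of the atom in the limit (\<open>quad_tendsto_atom\<close>).\<close>

text \<open>The symbol \<open>$\<close> is reserved for vectors of variable dimension.\<close>

unbundle no vec_syntax

section \<open>Functions of Hermitian matrices\<close>

text \<open>Entries of products become explicit sums, not scalar products of rows and columns.\<close>

declare index_mult_mat(1) [simp del]

lemma index_mat_mult_sum:
  assumes "A \<in> carrier_mat n m" "B \<in> carrier_mat m l" "i < n" "j < l"
  shows "(A * B) $$ (i, j) = (\<Sum>k<m. A $$ (i, k) * B $$ (k, j))"
  using assms by (auto simp: index_mult_mat(1) scalar_prod_def lessThan_atLeast0 intro!: sum.cong)

lemma dim_mat_adjoint [simp]: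
  "dim_row (mat_adjoint A) = dim_col A" "dim_col (mat_adjoint A) = dim_row A"
  by (simp_all add: mat_adjoint_def)

lemma mat_adjoint_carrier:
  "A \<in> carrier_mat n m \<Longrightarrow> mat_adjoint (A :: complex mat) \<in> carrier_mat m n"
  by (auto intro!: carrier_matI)

lemma index_mat_adjoint:
  assumes "A \<in> carrier_mat n m" "i < m" "j < n"
  shows "mat_adjoint (A :: complex mat) $$ (i, j) = cnj (A $$ (j, i))"
  using assms unfolding mat_adjoint_def by (auto simp: mat_of_rows_def)

lemma mat_adjoint_mult:
  assumes A: "A \<in> carrier_mat n m" and B: "(B :: complex mat) \<in> carrier_mat m l"
  shows "mat_adjoint (A * B) = mat_adjoint B * mat_adjoint A"
proof (rule eq_matI)
  have AB: "A * B \<in> carrier_mat n l" using A B by simp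
  have C: "mat_adjoint B * mat_adjoint A \<in> carrier_mat l n"
    using mat_adjoint_carrier[OF A] mat_adjoint_carrier[OF B] by (rule mult_carrier_mat[rotated])
  show "dim_row (mat_adjoint (A * B)) = dim_row (mat_adjoint B * mat_adjoint A)"
    "dim_col (mat_adjoint (A * B)) = dim_col (mat_adjoint B * mat_adjoint A)"
    using mat_adjoint_carrier[OF AB] C by auto
  fix i j assume "i < dim_row (mat_adjoint B * mat_adjoint A)"
    "j < dim_col (mat_adjoint B * mat_adjoint A)"
  then have i: "i < l" and j: "j < n" using C by auto
  have "mat_adjoint (A * B) $$ (i, j) = (\<Sum>k<m. cnj (A $$ (j, k)) * cnj (B $$ (k, i)))"
    using i j by (simp add: index_mat_adjoint[OF AB] index_mat_mult_sum[OF A B] cnj_sum)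
  also have "\<dots> = (mat_adjoint B * mat_adjoint A) $$ (i, j)"
    using i j A B
    by (simp add: index_mat_mult_sum[OF mat_adjoint_carrier[OF B] mat_adjoint_carrier[OF A]]
        index_mat_adjoint mult.commute)
  finally show "mat_adjoint (A * B) $$ (i, j) = (mat_adjoint B * mat_adjoint A) $$ (i, j)" .
qed

lemma index_unitary_conj_diag:
  assumes U: "(U :: complex mat) \<in> carrier_mat n n" and i: "i < n" and j: "j < n"
  shows "(U * mat_diag n h * mat_adjoint U) $$ (i, j) = (\<Sum>k<n. U $$ (i, k) * h k * cnj (U $$ (j, k)))"
proof -
  have UD: "U * mat_diag n h \<in> carrier_mat n n" using U by (metis mat_diag_dim mult_carrier_mat)
  have "(U * mat_diag n h * mat_adjoint U) $$ (i, j)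
      = (\<Sum>k<n. (U * mat_diag n h) $$ (i, k) * mat_adjoint U $$ (k, j))"
    by (rule index_mat_mult_sum[OF UD mat_adjoint_carrier[OF U] i j])
  also have "\<dots> = (\<Sum>k<n. U $$ (i, k) * h k * cnj (U $$ (j, k)))"
    using i j by (intro sum.cong refl) (simp add: mat_diag_mult_right[OF U] index_mat_adjoint[OF U])
  finally show ?thesis .
qed

lemma scalar_prod_self_complex:
  assumes "(v :: complex vec) \<in> carrier_vec n"
  shows "v \<bullet>c v = complex_of_real (\<Sum>k<n. (cmod (v $ k))\<^sup>2)"
  using assms by (auto simp: scalar_prod_def lessThan_atLeast0 complex_norm_square intro!: sum.cong simp del: of_real_power)

text \<open>Gram--Schmidt yields an orthogonal basis that begins with the given vector; dividing its
  members by their lengths makes the matrix unitary.\<close>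

lemma unitary_with_first_column:
  fixes v :: "complex vec"
  assumes v: "v \<in> carrier_vec n" and v0: "v \<noteq> 0\<^sub>v n" and n: "0 < n"
  obtains W r where "W \<in> carrier_mat n n" "mat_adjoint W * W = 1\<^sub>m n" "col W 0 = r \<cdot>\<^sub>v v"
proof -
  interpret cof_vec_space n "TYPE(complex)" .
  define b where "b = basis_completion v"
  from basis_completion[OF v v0, folded b_def]
  have dist_b: "distinct b" and indep: "\<not> lin_dep (set b)" and b: "set b \<subseteq> carrier_vec n"
    and hdb: "hd b = v" and len_b: "length b = n" by auto
  from hdb len_b n obtain vs where bv: "b = v # vs" by (cases b, auto)
  define ws where "ws = gram_schmidt n b"
  from gram_schmidt_result[OF b dist_b indep refl, folded ws_def]
  have ws: "set ws \<subseteq> carrier_vec n" "corthogonal ws" "length ws = n" by (auto simp: len_b)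
  from gram_schmidt_hd[OF v, of vs, folded bv] have "hd ws = v" unfolding ws_def .
  with ws(3) n have ws0: "ws ! 0 = v" by (cases ws) auto
  have wsc: "ws ! i \<in> carrier_vec n" if "i < n" for i using ws that by (simp add: subset_code(1))
  define N where "N i = sqrt (\<Sum>k<n. (cmod (ws ! i $ k))\<^sup>2)" for i
  have NN: "ws ! i \<bullet>c ws ! i = complex_of_real (N i) * complex_of_real (N i)" if "i < n" for i
    by (simp add: scalar_prod_self_complex[OF wsc[OF that]] N_def sum_nonneg flip: of_real_mult)
  have N0: "N i \<noteq> 0" if "i < n" for i
    using corthogonalD[OF ws(2), of i i] NN[OF that] ws(3) that by auto
  define W where "W = mat n n (\<lambda>(i, j). ws ! j $ i / complex_of_real (N j))"
  have W: "W \<in> carrier_mat n n" by (simp add: W_def)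
  show ?thesis
  proof (rule that[OF W])
    show "mat_adjoint W * W = 1\<^sub>m n"
    proof (rule eq_matI)
      fix i j assume "i < dim_row (1\<^sub>m n :: complex mat)" "j < dim_col (1\<^sub>m n :: complex mat)"
      then have i: "i < n" and j: "j < n" by auto
      have "(mat_adjoint W * W) $$ (i, j) = (\<Sum>k<n. cnj (W $$ (k, i)) * W $$ (k, j))"
        using i j by (simp add: index_mat_mult_sum[OF mat_adjoint_carrier[OF W] W] index_mat_adjoint[OF W])
      also have "\<dots> = (\<Sum>k<n. ws ! j $ k * cnj (ws ! i $ k)) / (N i * N j)"
        using i j unfolding sum_divide_distrib by (intro sum.cong) (auto simp: W_def)
      also have "(\<Sum>k<n. ws ! j $ k * cnj (ws ! i $ k)) = ws ! j \<bullet>c ws ! i"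
        using wsc[OF i] wsc[OF j]
        by (auto simp: scalar_prod_def lessThan_atLeast0 intro!: sum.cong)
      also have "ws ! j \<bullet>c ws ! i / (N i * N j) = (if i = j then 1 else 0)"
        using corthogonalD[OF ws(2), of j i] i j ws(3) N0[OF i] NN[OF i] by auto
      finally show "(mat_adjoint W * W) $$ (i, j) = 1\<^sub>m n $$ (i, j)" using i j by simp
    qed (use W mat_adjoint_carrier[OF W] in auto)
    show "col W 0 = (1 / complex_of_real (N 0)) \<cdot>\<^sub>v v"
      using n v by (intro eq_vecI) (auto simp: W_def ws0)
  qed
qed

lemma hermitian_diagonal_real:
  fixes A :: "complex mat"
  assumes A: "A \<in> carrier_mat n n" and h: "mat_adjoint A = A" and i: "i < n"
  shows "A $$ (i, i) = complex_of_real (Re (A $$ (i, i)))"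
proof -
  have "cnj (A $$ (i, i)) = A $$ (i, i)" using index_mat_adjoint[OF A i i] h by simp
  then show ?thesis by (metis complex_cnj_cancel_iff Reals_cnj_iff complex_is_Real_iff of_real_Re)
qed

text \<open>Split off one eigenvector: in an orthonormal basis that starts with it, the matrix has zeros
  in the first column below the diagonal, hence by symmetry also in the first row. The induction hypothesis
  diagonalizes the remaining block.\<close>

theorem hermitian_unitary_diagonalization:
  fixes A :: "complex mat"
  assumes "A \<in> carrier_mat n n" and "mat_adjoint A = A"
  shows "\<exists>U d. U \<in> carrier_mat n n \<and> U * mat_adjoint U = 1\<^sub>m n \<and>
    A = U * mat_diag n (\<lambda>i. complex_of_real (d i)) * mat_adjoint U"
  using assms
proof (induction n arbitrary: A)
  case 0
  show ?case
    by (rule exI[of _ "1\<^sub>m 0"], rule exI[of _ "\<lambda>_. 0"]) (use 0 in \<open>auto simp: mat_adjoint_def\<close>)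
next
  case (Suc m)
  let ?n = "Suc m"
  note A = Suc.prems(1) and h = Suc.prems(2)
  have "\<exists>e. eigenvalue A e"
  proof -
    have "degree (char_poly A) = ?n" using degree_monic_char_poly[OF A] by simp
    then have "\<not> constant (poly (char_poly A))" by (simp add: constant_degree)
    then obtain e where "poly (char_poly A) e = 0"
      using fundamental_theorem_of_algebra by blast
    then show ?thesis using eigenvalue_root_char_poly[OF A] by blast
  qed
  then obtain e v where v: "v \<in> carrier_vec ?n" "v \<noteq> 0\<^sub>v ?n" and ev: "A *\<^sub>v v = e \<cdot>\<^sub>v v"
    using A unfolding eigenvalue_def eigenvector_def by auto
  obtain W r where W: "W \<in> carrier_mat ?n ?n" and WW: "mat_adjoint W * W = 1\<^sub>m ?n"
    and W0: "col W 0 = r \<cdot>\<^sub>v v"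
    using unitary_with_first_column[OF v] by auto
  note Wa = mat_adjoint_carrier[OF W]
  have WW': "W * mat_adjoint W = 1\<^sub>m ?n"
    by (rule mat_mult_left_right_inverse[OF Wa W WW])
  define B where "B = mat_adjoint W * A * W"
  have WaA: "mat_adjoint W * A \<in> carrier_mat ?n ?n" using Wa A by (rule mult_carrier_mat)
  have B: "B \<in> carrier_mat ?n ?n" unfolding B_def using WaA W by (rule mult_carrier_mat)
  have adj_adj: "mat_adjoint (mat_adjoint W) = W"
    by (rule eq_matI) (use W Wa mat_adjoint_carrier[OF Wa] in \<open>auto simp: index_mat_adjoint[OF Wa] index_mat_adjoint[OF W]\<close>)
  have Bh: "mat_adjoint B = B"
    unfolding B_def mat_adjoint_mult[OF WaA W] mat_adjoint_mult[OF Wa A] h adj_adj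
    using assoc_mult_mat[OF Wa A W] by simp
  have Bcol: "B $$ (i, 0) = (if i = 0 then e else 0)" if i: "i < ?n" for i
  proof -
    have AW0: "(A * W) $$ (k, 0) = e * W $$ (k, 0)" if k: "k < ?n" for k
    proof -
      have "(A * W) $$ (k, 0) = (A *\<^sub>v col W 0) $ k" using A W k by (simp add: index_mult_mat(1))
      also have "A *\<^sub>v col W 0 = e \<cdot>\<^sub>v col W 0"
        unfolding W0 using A v ev by (simp add: mult_mat_vec smult_smult_assoc mult.commute)
      finally show ?thesis using W k by simp
    qed
    have "B = mat_adjoint W * (A * W)" unfolding B_def by (rule assoc_mult_mat[OF Wa A W])
    then have "B $$ (i, 0) = (\<Sum>k<?n. mat_adjoint W $$ (i, k) * (A * W) $$ (k, 0))"
      using index_mat_mult_sum[OF Wa mult_carrier_mat[OF A W] i, of 0] by simp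
    also have "\<dots> = e * (\<Sum>k<?n. mat_adjoint W $$ (i, k) * W $$ (k, 0))"
      unfolding sum_distrib_left by (intro sum.cong) (auto simp: AW0)
    also have "\<dots> = e * (mat_adjoint W * W) $$ (i, 0)"
      using index_mat_mult_sum[OF Wa W i, of 0] by simp
    also have "\<dots> = (if i = 0 then e else 0)" using i by (simp add: WW)
    finally show ?thesis .
  qed
  have Bent: "cnj (B $$ (j, i)) = B $$ (i, j)" if "i < ?n" "j < ?n" for i j
    using index_mat_adjoint[OF B that] Bh by simp
  have Brow: "B $$ (0, i) = (if i = 0 then e else 0)" if i: "i < ?n" for i
    using Bent[of 0 i] Bcol[OF i] Bcol[of 0] Bent[of 0 0] i by (auto split: if_splits)
  have e_real: "e = complex_of_real (Re e)"
    using hermitian_diagonal_real[OF B Bh, of 0] Bcol[of 0] by simp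
  define C where "C = mat m m (\<lambda>(i, j). B $$ (Suc i, Suc j))"
  have C: "C \<in> carrier_mat m m" by (simp add: C_def)
  have "mat_adjoint C = C"
  proof (rule eq_matI)
    fix i j assume "i < dim_row C" "j < dim_col C"
    then have "i < m" "j < m" by (auto simp: C_def)
    then show "mat_adjoint C $$ (i, j) = C $$ (i, j)"
      using Bent[of "Suc i" "Suc j"] index_mat_adjoint[OF C, of i j] by (simp add: C_def)
  qed (use C mat_adjoint_carrier[OF C] in auto)
  from Suc.IH[OF C this] obtain V d where V: "V \<in> carrier_mat m m"
    and VV: "V * mat_adjoint V = 1\<^sub>m m"
    and CV: "C = V * mat_diag m (\<lambda>i. complex_of_real (d i)) * mat_adjoint V" by blast
  have VVe: "(\<Sum>k<m. V $$ (i, k) * cnj (V $$ (j, k))) = (if i = j then 1 else 0)"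
    if "i < m" "j < m" for i j
    using arg_cong[OF VV, of "\<lambda>M. M $$ (i, j)"] that
    by (simp add: index_mat_mult_sum[OF V mat_adjoint_carrier[OF V]] index_mat_adjoint[OF V])
  have CVe: "(\<Sum>k<m. V $$ (i, k) * complex_of_real (d k) * cnj (V $$ (j, k))) = B $$ (Suc i, Suc j)"
    if "i < m" "j < m" for i j
    using arg_cong[OF CV, of "\<lambda>M. M $$ (i, j)"] that
    by (simp add: index_unitary_conj_diag[OF V] C_def)
  \<comment> \<open>\<open>X\<close> is the block matrix with the diagonal blocks \<open>1\<close> and \<open>V\<close>.\<close>
  define X where "X = mat ?n ?n (\<lambda>(i, j). case i of 0 \<Rightarrow> (if j = 0 then 1 else 0)
    | Suc i' \<Rightarrow> (case j of 0 \<Rightarrow> 0 | Suc j' \<Rightarrow> V $$ (i', j')))"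
  define d' where "d' j = (case j of 0 \<Rightarrow> Re e | Suc j' \<Rightarrow> d j')" for j
  have X: "X \<in> carrier_mat ?n ?n" by (simp add: X_def)
  note Xa = mat_adjoint_carrier[OF X]
  let ?D = "mat_diag ?n (\<lambda>i. complex_of_real (d' i))"
  have D: "?D \<in> carrier_mat ?n ?n" by simp
  have XX: "X * mat_adjoint X = 1\<^sub>m ?n"
  proof (rule eq_matI)
    fix i j assume "i < dim_row (1\<^sub>m ?n :: complex mat)" "j < dim_col (1\<^sub>m ?n :: complex mat)"
    then have i: "i < ?n" and j: "j < ?n" by auto
    have "(X * mat_adjoint X) $$ (i, j) = (\<Sum>k<?n. X $$ (i, k) * cnj (X $$ (j, k)))"
      using i j by (simp add: index_mat_mult_sum[OF X Xa] index_mat_adjoint[OF X] del: sum.lessThan_Suc)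
    also have "\<dots> = (if i = j then 1 else 0)"
      unfolding sum.lessThan_Suc_shift using i j VVe by (auto simp: X_def split: nat.splits)
    finally show "(X * mat_adjoint X) $$ (i, j) = 1\<^sub>m ?n $$ (i, j)" using i j by simp
  qed (use X Xa in auto)
  have XB: "B = X * ?D * mat_adjoint X"
  proof (rule eq_matI)
    have XDX: "X * ?D * mat_adjoint X \<in> carrier_mat ?n ?n" using X Xa D by (meson mult_carrier_mat)
    then show "dim_row B = dim_row (X * ?D * mat_adjoint X)"
      "dim_col B = dim_col (X * ?D * mat_adjoint X)" using B by auto
    fix i j assume "i < dim_row (X * ?D * mat_adjoint X)" "j < dim_col (X * ?D * mat_adjoint X)"
    then have i: "i < ?n" and j: "j < ?n" using XDX by auto
    show "B $$ (i, j) = (X * ?D * mat_adjoint X) $$ (i, j)"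
      unfolding index_unitary_conj_diag[OF X i j] sum.lessThan_Suc_shift
      using i j Bcol Brow CVe e_real by (auto simp: X_def d'_def split: nat.splits)
  qed
  define U where "U = W * X"
  have U: "U \<in> carrier_mat ?n ?n" unfolding U_def using W X by (rule mult_carrier_mat)
  have Ua: "mat_adjoint U = mat_adjoint X * mat_adjoint W" unfolding U_def by (rule mat_adjoint_mult[OF W X])
  have XaWa: "mat_adjoint X * mat_adjoint W \<in> carrier_mat ?n ?n" using Xa Wa by (rule mult_carrier_mat)
  have "U * mat_adjoint U = W * (X * (mat_adjoint X * mat_adjoint W))"
    unfolding Ua unfolding U_def by (rule assoc_mult_mat[OF W X XaWa])
  also have "X * (mat_adjoint X * mat_adjoint W) = mat_adjoint W"
    using assoc_mult_mat[OF X Xa Wa] XX left_mult_one_mat[OF Wa] by simp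
  finally have UU: "U * mat_adjoint U = 1\<^sub>m ?n" using WW' by simp
  have XD: "X * ?D \<in> carrier_mat ?n ?n" using X D by (rule mult_carrier_mat)
  have "U * ?D * mat_adjoint U = W * (X * ?D) * (mat_adjoint X * mat_adjoint W)"
    unfolding Ua unfolding U_def using assoc_mult_mat[OF W X D] by simp
  also have "\<dots> = W * ((X * ?D) * (mat_adjoint X * mat_adjoint W))"
    by (rule assoc_mult_mat[OF W XD XaWa])
  also have "(X * ?D) * (mat_adjoint X * mat_adjoint W) = B * mat_adjoint W"
    using assoc_mult_mat[OF XD Xa Wa] XB by simp
  also have "B * mat_adjoint W = mat_adjoint W * A"
    unfolding B_def using assoc_mult_mat[OF WaA W Wa] WW' right_mult_one_mat[OF WaA] by simp
  also have "W * (mat_adjoint W * A) = A"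
    using assoc_mult_mat[OF W Wa A] WW' left_mult_one_mat[OF A] by simp
  finally have "A = U * ?D * mat_adjoint U" by simp
  with U UU show ?case by blast
qed

text \<open>Two diagonalizations of the same matrix are intertwined by a unitary matrix \<open>T\<close> whose entry
  \<open>T\<^sub>i\<^sub>j\<close> vanishes unless the two eigenvalues agree; so applying \<open>f\<close> to the eigenvalues
  keeps the two matrices equal.\<close>

lemma unitary_diagonalization_fun_unique:
  fixes U V :: "complex mat"
  assumes U: "U \<in> carrier_mat n n" and UU: "U * mat_adjoint U = 1\<^sub>m n"
    and V: "V \<in> carrier_mat n n" and VV: "V * mat_adjoint V = 1\<^sub>m n"
    and eq: "U * mat_diag n (\<lambda>i. complex_of_real (d i)) * mat_adjoint U
      = V * mat_diag n (\<lambda>i. complex_of_real (e i)) * mat_adjoint V"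
  shows "U * mat_diag n (\<lambda>i. complex_of_real (f (d i))) * mat_adjoint U
      = V * mat_diag n (\<lambda>i. complex_of_real (f (e i))) * mat_adjoint V"
proof -
  note Ua = mat_adjoint_carrier[OF U] and Va = mat_adjoint_carrier[OF V]
  define T where "T = mat_adjoint U * V"
  have T: "T \<in> carrier_mat n n" unfolding T_def using Ua V by (rule mult_carrier_mat)
  have UaU: "mat_adjoint U * U = 1\<^sub>m n" by (rule mat_mult_left_right_inverse[OF U Ua UU])
  have VaV: "mat_adjoint V * V = 1\<^sub>m n" by (rule mat_mult_left_right_inverse[OF V Va VV])
  have intertwine: "(U * mat_diag n a * mat_adjoint U = V * mat_diag n b * mat_adjoint V)
      \<longleftrightarrow> mat_diag n a * T = T * mat_diag n b" for a b :: "nat \<Rightarrow> complex"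
  proof -
    let ?a = "mat_diag n a" and ?b = "mat_diag n b"
    have a: "?a \<in> carrier_mat n n" and b: "?b \<in> carrier_mat n n" by auto
    note c = U V Ua Va a b T
    have UT: "U * T = V" unfolding T_def using assoc_mult_mat[OF U Ua V] UU left_mult_one_mat[OF V] by simp
    have TV: "T * mat_adjoint V = mat_adjoint U"
      unfolding T_def using assoc_mult_mat[OF Ua V Va] VV right_mult_one_mat[OF Ua] by simp
    note m = mult_carrier_mat[of _ n n _ n]
    have 1: "mat_adjoint U * (U * ?a * mat_adjoint U) * V = ?a * T"
    proof -
      have "U * ?a * mat_adjoint U = U * (?a * mat_adjoint U)" by (rule assoc_mult_mat[OF U a Ua])
      then have "mat_adjoint U * (U * ?a * mat_adjoint U) = ?a * mat_adjoint U"
        using assoc_mult_mat[OF Ua U m[OF a Ua]] UaU left_mult_one_mat[OF m[OF a Ua]] by simp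
      then show ?thesis unfolding T_def using assoc_mult_mat[OF a Ua V] by simp
    qed
    have 2: "mat_adjoint U * (V * ?b * mat_adjoint V) * V = T * ?b"
    proof -
      have "mat_adjoint U * (V * ?b * mat_adjoint V) * V
          = mat_adjoint U * ((V * ?b * mat_adjoint V) * V)"
        by (rule assoc_mult_mat[OF Ua m[OF m[OF V b] Va] V])
      also have "(V * ?b * mat_adjoint V) * V = V * ?b"
        using assoc_mult_mat[OF m[OF V b] Va V] VaV right_mult_one_mat[OF m[OF V b]] by simp
      finally show ?thesis unfolding T_def using assoc_mult_mat[OF Ua V b] by simp
    qed
    have 3: "U * (?a * T) * mat_adjoint V = U * ?a * mat_adjoint U"
      using assoc_mult_mat[OF U m[OF a T] Va] assoc_mult_mat[OF a T Va] TV
        assoc_mult_mat[OF U a Ua] by simp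
    have 4: "U * (T * ?b) * mat_adjoint V = V * ?b * mat_adjoint V"
      using assoc_mult_mat[OF U T b] UT by simp
    show ?thesis using 1 2 3 4 by metis
  qed
  have entry: "mat_diag n a * T = T * mat_diag n b \<longleftrightarrow>
      (\<forall>i<n. \<forall>j<n. a i * T $$ (i, j) = T $$ (i, j) * b j)" for a b :: "nat \<Rightarrow> complex"
    unfolding mat_diag_mult_left[OF T] mat_diag_mult_right[OF T] by (auto simp: mat_eq_iff)
  have "\<forall>i<n. \<forall>j<n. complex_of_real (d i) * T $$ (i, j) = T $$ (i, j) * complex_of_real (e j)"
    using eq unfolding intertwine entry .
  then have "\<forall>i<n. \<forall>j<n. complex_of_real (f (d i)) * T $$ (i, j) = T $$ (i, j) * complex_of_real (f (e j))"
    by (metis mult.commute mult_cancel_left of_real_eq_iff)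
  then show ?thesis unfolding intertwine entry .
qed

lemma hermitian_fun_eq:
  fixes U :: "complex mat"
  assumes U: "U \<in> carrier_mat n n" and UU: "U * mat_adjoint U = 1\<^sub>m n"
  shows "hermitian_fun f (U * mat_diag n (\<lambda>i. complex_of_real (d i)) * mat_adjoint U)
    = U * mat_diag n (\<lambda>i. complex_of_real (f (d i))) * mat_adjoint U"
proof -
  let ?A = "U * mat_diag n (\<lambda>i. complex_of_real (d i)) * mat_adjoint U"
  have n: "dim_row ?A = n" using U by simp
  show ?thesis
    unfolding hermitian_fun_def Let_def n
  proof (rule the_equality)
    show "\<exists>V e. V \<in> carrier_mat n n \<and> V * mat_adjoint V = 1\<^sub>m n \<and>
        ?A = V * mat_diag n (\<lambda>i. complex_of_real (e i)) * mat_adjoint V \<and>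
        U * mat_diag n (\<lambda>i. complex_of_real (f (d i))) * mat_adjoint U
          = V * mat_diag n (\<lambda>i. complex_of_real (f (e i))) * mat_adjoint V"
      by (rule exI[of _ U], rule exI[of _ d]) (use assms in simp)
  next
    fix B
    assume "\<exists>V e. V \<in> carrier_mat n n \<and> V * mat_adjoint V = 1\<^sub>m n \<and>
        ?A = V * mat_diag n (\<lambda>i. complex_of_real (e i)) * mat_adjoint V \<and>
        B = V * mat_diag n (\<lambda>i. complex_of_real (f (e i))) * mat_adjoint V"
    then obtain V e where V: "V \<in> carrier_mat n n" "V * mat_adjoint V = 1\<^sub>m n"
      and AV: "?A = V * mat_diag n (\<lambda>i. complex_of_real (e i)) * mat_adjoint V"
      and B: "B = V * mat_diag n (\<lambda>i. complex_of_real (f (e i))) * mat_adjoint V" by blast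
    show "B = U * mat_diag n (\<lambda>i. complex_of_real (f (d i))) * mat_adjoint U"
      unfolding B by (rule unitary_diagonalization_fun_unique[OF U UU V AV, symmetric])
  qed
qed

text \<open>With the eigenvectors as the columns of \<open>u\<close>, the upper left entry of \<open>f\<close> applied to the matrix is a
  mean of the values of \<open>f\<close> at the eigenvalues, with weights \<open>\<bar>u\<^sub>0\<^sub>k\<bar>\<^sup>2\<close>. In this form the matrix function becomes a
  quadrature rule.\<close>

theorem hermitian_spectral_entries:
  fixes m :: "nat \<Rightarrow> nat \<Rightarrow> complex"
  assumes herm: "\<And>i j. m j i = cnj (m i j)"
  obtains u :: "nat \<Rightarrow> nat \<Rightarrow> complex" and d :: "nat \<Rightarrow> real" where
    "\<And>i j. i < n \<Longrightarrow> j < n \<Longrightarrow> (\<Sum>k<n. u i k * cnj (u j k)) = (if i = j then 1 else 0)"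
    "\<And>i j. i < n \<Longrightarrow> j < n \<Longrightarrow> (\<Sum>k<n. cnj (u k i) * u k j) = (if i = j then 1 else 0)"
    "\<And>i j. i < n \<Longrightarrow> j < n \<Longrightarrow> m i j = (\<Sum>k<n. u i k * d k * cnj (u j k))"
    "\<And>f. 0 < n \<Longrightarrow> hermitian_fun f (mat n n (\<lambda>(i, j). m i j)) $$ (0, 0)
       = complex_of_real (\<Sum>k<n. (cmod (u 0 k))\<^sup>2 * f (d k))"
proof -
  let ?A = "mat n n (\<lambda>(i, j). m i j)"
  have A: "?A \<in> carrier_mat n n" by simp
  have "mat_adjoint ?A = ?A"
    by (rule eq_matI) (auto simp: index_mat_adjoint[OF A] herm[symmetric])
  from hermitian_unitary_diagonalization[OF A this] obtain U d where U: "U \<in> carrier_mat n n"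
    and UU: "U * mat_adjoint U = 1\<^sub>m n"
    and AU: "?A = U * mat_diag n (\<lambda>i. complex_of_real (d i)) * mat_adjoint U" by blast
  note Ua = mat_adjoint_carrier[OF U]
  have UaU: "mat_adjoint U * U = 1\<^sub>m n" by (rule mat_mult_left_right_inverse[OF U Ua UU])
  show ?thesis
  proof (rule that[of "\<lambda>i j. U $$ (i, j)" d])
    show "(\<Sum>k<n. U $$ (i, k) * cnj (U $$ (j, k))) = (if i = j then 1 else 0)" if "i < n" "j < n" for i j
      using arg_cong[OF UU, of "\<lambda>M. M $$ (i, j)"] that
      by (simp add: index_mat_mult_sum[OF U Ua] index_mat_adjoint[OF U])
    show "(\<Sum>k<n. cnj (U $$ (k, i)) * U $$ (k, j)) = (if i = j then 1 else 0)" if "i < n" "j < n" for i j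
      using arg_cong[OF UaU, of "\<lambda>M. M $$ (i, j)"] that
      by (simp add: index_mat_mult_sum[OF Ua U] index_mat_adjoint[OF U])
    show "m i j = (\<Sum>k<n. U $$ (i, k) * complex_of_real (d k) * cnj (U $$ (j, k)))"
      if "i < n" "j < n" for i j
      using arg_cong[OF AU, of "\<lambda>M. M $$ (i, j)"] that by (simp add: index_unitary_conj_diag[OF U])
    show "hermitian_fun f ?A $$ (0, 0) = complex_of_real (\<Sum>k<n. (cmod (U $$ (0, k)))\<^sup>2 * f (d k))"
      if "0 < n" for f
      unfolding AU hermitian_fun_eq[OF U UU] index_unitary_conj_diag[OF U that that]
      by (simp add: complex_norm_square mult_ac del: of_real_power)
  qed
qed

section \<open>Square integrable functions on a finite measure space\<close>

definition sq_int :: "'a measure \<Rightarrow> ('a \<Rightarrow> complex) \<Rightarrow> bool" where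
  "sq_int M \<phi> \<longleftrightarrow> \<phi> \<in> borel_measurable M \<and> integrable M (\<lambda>x. (cmod (\<phi> x))\<^sup>2)"

definition ip :: "'a measure \<Rightarrow> ('a \<Rightarrow> complex) \<Rightarrow> ('a \<Rightarrow> complex) \<Rightarrow> complex" where
  "ip M \<phi> \<psi> = (LINT x|M. cnj (\<phi> x) * \<psi> x)"

definition nsq :: "'a measure \<Rightarrow> ('a \<Rightarrow> complex) \<Rightarrow> real" where
  "nsq M \<phi> = (LINT x|M. (cmod (\<phi> x))\<^sup>2)"

lemma borel_measurable_cnj [measurable (raw)]:
  "f \<in> borel_measurable M \<Longrightarrow> (\<lambda>x. cnj (f x)) \<in> borel_measurable M"
  by (rule borel_measurable_continuous_on[of cnj]) (auto intro: continuous_intros)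

lemma cmod_mult_le_sum_squares:
  assumes "t > 0"
  shows "cmod (a * b) \<le> (t * (cmod a)\<^sup>2 + (cmod b)\<^sup>2 / t) / 2"
proof -
  have "0 \<le> (t * cmod a - cmod b)\<^sup>2 / t" using assms by simp
  also have "\<dots> = t * (cmod a)\<^sup>2 + (cmod b)\<^sup>2 / t - 2 * (cmod a * cmod b)"
    using assms by (simp add: power2_eq_square field_simps)
  finally show ?thesis by (simp add: norm_mult)
qed

lemma sq_int_integrable_mult:
  assumes "sq_int M \<phi>" "sq_int M \<psi>"
  shows "integrable M (\<lambda>x. cnj (\<phi> x) * \<psi> x)"
proof (rule Bochner_Integration.integrable_bound)
  show "integrable M (\<lambda>x. ((cmod (\<phi> x))\<^sup>2 + (cmod (\<psi> x))\<^sup>2))"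
    using assms by (auto simp: sq_int_def)
  show "(\<lambda>x. cnj (\<phi> x) * \<psi> x) \<in> borel_measurable M"
    using assms by (auto simp: sq_int_def)
  show "AE x in M. norm (cnj (\<phi> x) * \<psi> x) \<le> norm ((cmod (\<phi> x))\<^sup>2 + (cmod (\<psi> x))\<^sup>2)"
  proof (rule AE_I2)
    fix x
    have "cmod (cnj (\<phi> x) * \<psi> x) \<le> ((cmod (\<phi> x))\<^sup>2 + (cmod (\<psi> x))\<^sup>2) / 2"
      using cmod_mult_le_sum_squares[of 1 "cnj (\<phi> x)" "\<psi> x"] by simp
    also have "\<dots> \<le> (cmod (\<phi> x))\<^sup>2 + (cmod (\<psi> x))\<^sup>2" by simp
    finally show "norm (cnj (\<phi> x) * \<psi> x) \<le> norm ((cmod (\<phi> x))\<^sup>2 + (cmod (\<psi> x))\<^sup>2)" by simp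
  qed
qed

lemma sq_int_cmult: "sq_int M \<phi> \<Longrightarrow> sq_int M (\<lambda>x. a * \<phi> x)"
  by (auto simp: sq_int_def norm_mult power_mult_distrib)

lemma sq_int_add:
  assumes "sq_int M \<phi>" "sq_int M \<psi>"
  shows "sq_int M (\<lambda>x. \<phi> x + \<psi> x)"
proof -
  have m: "(\<lambda>x. \<phi> x + \<psi> x) \<in> borel_measurable M" using assms by (auto simp: sq_int_def)
  have "integrable M (\<lambda>x. (cmod (\<phi> x + \<psi> x))\<^sup>2)"
  proof (rule Bochner_Integration.integrable_bound)
    show "integrable M (\<lambda>x. 2 * (cmod (\<phi> x))\<^sup>2 + 2 * (cmod (\<psi> x))\<^sup>2)"
      using assms by (auto simp: sq_int_def)
    show "(\<lambda>x. (cmod (\<phi> x + \<psi> x))\<^sup>2) \<in> borel_measurable M" using m by measurable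
    show "AE x in M. norm ((cmod (\<phi> x + \<psi> x))\<^sup>2) \<le> norm (2 * (cmod (\<phi> x))\<^sup>2 + 2 * (cmod (\<psi> x))\<^sup>2)"
    proof (rule AE_I2)
      fix x
      have "(cmod (\<phi> x + \<psi> x))\<^sup>2 \<le> (cmod (\<phi> x) + cmod (\<psi> x))\<^sup>2"
        by (intro power_mono norm_triangle_ineq) simp
      also have "\<dots> \<le> 2 * (cmod (\<phi> x))\<^sup>2 + 2 * (cmod (\<psi> x))\<^sup>2"
        using sum_squares_bound[of "cmod (\<phi> x)" "cmod (\<psi> x)"] by (simp add: power2_sum)
      finally show "norm ((cmod (\<phi> x + \<psi> x))\<^sup>2) \<le> norm (2 * (cmod (\<phi> x))\<^sup>2 + 2 * (cmod (\<psi> x))\<^sup>2)"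
        by simp
    qed
  qed
  then show ?thesis using m by (simp add: sq_int_def)
qed

lemma sq_int_diff: "sq_int M \<phi> \<Longrightarrow> sq_int M \<psi> \<Longrightarrow> sq_int M (\<lambda>x. \<phi> x - \<psi> x)"
  using sq_int_add[of M \<phi> "\<lambda>x. (-1) * \<psi> x"] sq_int_cmult[of M \<psi> "-1"] by simp

lemma sq_int_sum: "(\<And>i. i \<in> I \<Longrightarrow> sq_int M (\<phi> i)) \<Longrightarrow> sq_int M (\<lambda>x. \<Sum>i\<in>I. \<phi> i x)"
proof (induction I rule: infinite_finite_induct)
  case (insert i I)
  then show ?case using sq_int_add[of M "\<phi> i" "\<lambda>x. \<Sum>i\<in>I. \<phi> i x"] by simp
qed (auto simp: sq_int_def)

lemma nsq_nonneg [simp]: "0 \<le> nsq M \<phi>"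
  by (simp add: nsq_def)

lemma nsq_eq_0_iff:
  assumes "sq_int M \<phi>" shows "nsq M \<phi> = 0 \<longleftrightarrow> (AE x in M. \<phi> x = 0)"
  unfolding nsq_def using assms by (subst integral_nonneg_eq_0_iff_AE) (auto simp: sq_int_def)

lemma ip_self: "ip M \<phi> \<phi> = complex_of_real (nsq M \<phi>)"
  unfolding ip_def nsq_def integral_complex_of_real[symmetric]
  by (simp add: complex_norm_square mult.commute del: of_real_power)

lemma ip_commute: "ip M \<psi> \<phi> = cnj (ip M \<phi> \<psi>)"
proof -
  have "(\<lambda>x. cnj (\<psi> x) * \<phi> x) = (\<lambda>x. cnj (cnj (\<phi> x) * \<psi> x))" by auto
  then show ?thesis unfolding ip_def by (simp only: Bochner_Integration.integral_cnj)
qed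

lemma ip_cmult_right: "ip M \<phi> (\<lambda>x. a * \<psi> x) = a * ip M \<phi> \<psi>"
proof -
  have "ip M \<phi> (\<lambda>x. a * \<psi> x) = (LINT x|M. a * (cnj (\<phi> x) * \<psi> x))"
    unfolding ip_def by (intro Bochner_Integration.integral_cong) auto
  then show ?thesis unfolding ip_def by simp
qed

lemma ip_add_right:
  "sq_int M \<phi> \<Longrightarrow> sq_int M \<psi> \<Longrightarrow> sq_int M \<eta> \<Longrightarrow> ip M \<phi> (\<lambda>x. \<psi> x + \<eta> x) = ip M \<phi> \<psi> + ip M \<phi> \<eta>"
  by (simp add: ip_def distrib_left sq_int_integrable_mult)

lemma ip_diff_right:
  "sq_int M \<phi> \<Longrightarrow> sq_int M \<psi> \<Longrightarrow> sq_int M \<eta> \<Longrightarrow> ip M \<phi> (\<lambda>x. \<psi> x - \<eta> x) = ip M \<phi> \<psi> - ip M \<phi> \<eta>"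
  by (simp add: ip_def right_diff_distrib sq_int_integrable_mult)

lemma ip_diff_left:
  "sq_int M \<phi> \<Longrightarrow> sq_int M \<psi> \<Longrightarrow> sq_int M \<eta> \<Longrightarrow> ip M (\<lambda>x. \<psi> x - \<eta> x) \<phi> = ip M \<psi> \<phi> - ip M \<eta> \<phi>"
  by (simp add: ip_def left_diff_distrib sq_int_integrable_mult)

lemma ip_sum_right:
  assumes "sq_int M \<phi>" "\<And>i. i \<in> I \<Longrightarrow> sq_int M (\<psi> i)"
  shows "ip M \<phi> (\<lambda>x. \<Sum>i\<in>I. a i * \<psi> i x) = (\<Sum>i\<in>I. a i * ip M \<phi> (\<psi> i))"
proof -
  have "ip M \<phi> (\<lambda>x. \<Sum>i\<in>I. a i * \<psi> i x) = (\<Sum>i\<in>I. ip M \<phi> (\<lambda>x. a i * \<psi> i x))"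
    unfolding ip_def sum_distrib_left
    by (rule Bochner_Integration.integral_sum) (rule sq_int_integrable_mult[OF assms(1) sq_int_cmult[OF assms(2)]])
  then show ?thesis by (simp add: ip_cmult_right)
qed

lemma ip_sum_left:
  assumes "sq_int M \<phi>" "\<And>i. i \<in> I \<Longrightarrow> sq_int M (\<psi> i)"
  shows "ip M (\<lambda>x. \<Sum>i\<in>I. a i * \<psi> i x) \<phi> = (\<Sum>i\<in>I. cnj (a i) * ip M (\<psi> i) \<phi>)"
proof -
  have "ip M (\<lambda>x. \<Sum>i\<in>I. a i * \<psi> i x) \<phi> = cnj (ip M \<phi> (\<lambda>x. \<Sum>i\<in>I. a i * \<psi> i x))"
    by (rule ip_commute)
  also have "\<dots> = (\<Sum>i\<in>I. cnj (a i) * cnj (ip M \<phi> (\<psi> i)))"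
    by (simp add: ip_sum_right assms cnj_sum)
  also have "\<dots> = (\<Sum>i\<in>I. cnj (a i) * ip M (\<psi> i) \<phi>)" by (simp only: ip_commute[symmetric])
  finally show ?thesis .
qed

lemma ip_mult_real_swap: "ip M (\<lambda>x. complex_of_real (A x) * \<phi> x) \<psi> = ip M \<phi> (\<lambda>x. complex_of_real (A x) * \<psi> x)"
  unfolding ip_def by (intro Bochner_Integration.integral_cong) (auto simp: mult_ac)

text \<open>The Cauchy--Schwarz inequality, from optimizing \<open>t\<close> in \<open>2 \<bar>a b\<bar> \<le> t \<bar>a\<bar>\<^sup>2 + \<bar>b\<bar>\<^sup>2 / t\<close>.\<close>

lemma ip_bound:
  assumes \<phi>: "sq_int M \<phi>" and \<psi>: "sq_int M \<psi>"
  shows "(cmod (ip M \<phi> \<psi>))\<^sup>2 \<le> nsq M \<phi> * nsq M \<psi>"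
proof -
  let ?a = "nsq M \<phi>" and ?b = "nsq M \<psi>" and ?c = "cmod (ip M \<phi> \<psi>)"
  have *: "2 * ?c \<le> t * ?a + ?b / t" if t: "t > 0" for t
  proof -
    have "?c \<le> (LINT x|M. cmod (cnj (\<phi> x) * \<psi> x))"
      unfolding ip_def by (rule integral_norm_bound)
    also have "\<dots> \<le> (LINT x|M. (t * (cmod (\<phi> x))\<^sup>2 + (cmod (\<psi> x))\<^sup>2 / t) / 2)"
      using \<phi> \<psi> cmod_mult_le_sum_squares[OF t, of "cnj (\<phi> _)"]
      by (intro integral_mono integrable_norm sq_int_integrable_mult) (auto simp: sq_int_def)
    also have "\<dots> = (t * ?a + ?b / t) / 2"
      using \<phi> \<psi> by (simp add: nsq_def sq_int_def)
    finally show ?thesis by simp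
  qed
  show ?thesis
  proof (cases "?c = 0")
    case False
    then have c: "?c > 0" by simp
    show ?thesis
    proof (cases "?a = 0")
      case True
      \<comment> \<open>The optimal \<open>t\<close> would be infinite; this one is large enough for a contradiction.\<close>
      have "2 * ?c \<le> ?b / (?b / ?c + 1)" using *[of "?b / ?c + 1"] c True by (simp add: add_nonneg_pos)
      also have "\<dots> \<le> ?c"
        using c by (simp add: divide_le_eq add_nonneg_pos field_simps)
      finally show ?thesis using c by simp
    next
      case False
      then have a: "?a > 0" using nsq_nonneg[of M \<phi>] by linarith
      have "2 * ?c \<le> ?c / ?a * ?a + ?b / (?c / ?a)" using *[of "?c / ?a"] a c by simp
      then have "?c \<le> ?b * ?a / ?c" using a by simp
      then show ?thesis using c by (simp add: pos_le_divide_eq power2_eq_square mult.commute)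
    qed
  qed simp
qed

lemma tendsto_ip_zero:
  assumes "sq_int M \<theta>" "\<And>n. sq_int M (u n)" "(\<lambda>n. nsq M (u n)) \<longlonglongrightarrow> 0"
  shows "(\<lambda>n. ip M \<theta> (u n)) \<longlonglongrightarrow> 0"
proof -
  have "(\<lambda>n. (cmod (ip M \<theta> (u n)))\<^sup>2) \<longlonglongrightarrow> 0"
  proof (rule tendsto_sandwich[of "\<lambda>_. 0" _ _ "\<lambda>n. nsq M \<theta> * nsq M (u n)"])
    show "(\<lambda>n. nsq M \<theta> * nsq M (u n)) \<longlonglongrightarrow> 0" using tendsto_mult_right_zero[OF assms(3)] by simp
    show "\<forall>\<^sub>F n in sequentially. (cmod (ip M \<theta> (u n)))\<^sup>2 \<le> nsq M \<theta> * nsq M (u n)"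
      using ip_bound[OF assms(1,2)] by simp
    show "\<forall>\<^sub>F n in sequentially. 0 \<le> (cmod (ip M \<theta> (u n)))\<^sup>2" by simp
  qed simp
  then have "(\<lambda>n. cmod (ip M \<theta> (u n))) \<longlonglongrightarrow> 0"
    using tendsto_real_sqrt[of "\<lambda>n. (cmod (ip M \<theta> (u n)))\<^sup>2" 0] by simp
  then show ?thesis by (rule tendsto_norm_zero_cancel)
qed

text \<open>A sequence that is Cauchy in the mean square is Cauchy in \<open>L\<^sup>1\<close>, since the measure
  is finite, so a subsequence converges almost everywhere; Fatou's lemma turns its pointwise limit
  into the limit of the whole sequence in the mean square.\<close>

lemma (in finite_measure) sq_int_complete:
  assumes u: "\<And>n. sq_int M (u n)"
    and cauchy: "\<And>e. e > 0 \<Longrightarrow> \<exists>N. \<forall>i\<ge>N. \<forall>j\<ge>N. nsq M (\<lambda>x. u i x - u j x) < e"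
  obtains \<psi> where "sq_int M \<psi>" "(\<lambda>n. nsq M (\<lambda>x. u n x - \<psi> x)) \<longlonglongrightarrow> 0"
proof -
  have um [measurable]: "u n \<in> borel_measurable M" for n using u by (simp add: sq_int_def)
  have d: "sq_int M (\<lambda>x. u i x - u j x)" for i j using u by (intro sq_int_diff)
  have L1b: "(LINT x|M. cmod (\<phi> x)) \<le> (t * measure M (space M) + nsq M \<phi> / t) / 2"
    and L1i: "integrable M \<phi>"
    if "sq_int M \<phi>" "t > 0" for t :: real and \<phi>
  proof -
    have one: "sq_int M (\<lambda>_. 1)" by (simp add: sq_int_def)
    show i: "integrable M \<phi>" using sq_int_integrable_mult[OF one that(1)] by simp
    have "(LINT x|M. cmod (\<phi> x)) \<le> (LINT x|M. (t + (cmod (\<phi> x))\<^sup>2 / t) / 2)"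
      using cmod_mult_le_sum_squares[OF that(2), of 1] i that
      by (intro integral_mono) (auto simp: sq_int_def)
    also have "\<dots> = (t * measure M (space M) + nsq M \<phi> / t) / 2"
      using that by (simp add: nsq_def sq_int_def mult.commute)
    finally show "(LINT x|M. cmod (\<phi> x)) \<le> (t * measure M (space M) + nsq M \<phi> / t) / 2" .
  qed
  have average: "z \<le> (p + q) / 2 \<Longrightarrow> q < e \<Longrightarrow> p \<le> e \<Longrightarrow> z < e" for z p q e :: real
    by (simp add: field_simps)
  have L1: "\<exists>N. \<forall>i\<ge>N. \<forall>j\<ge>N. LINT x|M. norm (u i x - u j x) < e" if e: "e > 0" for e
  proof -
    define t where "t = e / (measure M (space M) + 1)"
    have t: "t > 0" using e by (simp add: t_def add_nonneg_pos)
    have tm: "t * measure M (space M) \<le> e"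
    proof -
      have "t * measure M (space M) \<le> t * (measure M (space M) + 1)"
        using t by (intro mult_left_mono) auto
      also have "\<dots> = e" using measure_nonneg[of M "space M"] by (simp add: t_def add_nonneg_eq_0_iff)
      finally show ?thesis .
    qed
    obtain N where N: "\<forall>i\<ge>N. \<forall>j\<ge>N. nsq M (\<lambda>x. u i x - u j x) < e * t"
      using cauchy[of "e * t"] e t by auto
    show ?thesis
    proof (intro exI[of _ N] allI impI)
      fix i j assume "N \<le> i" "N \<le> j"
      then have "nsq M (\<lambda>x. u i x - u j x) / t < e" using N t by (simp add: pos_divide_less_eq)
      then show "LINT x|M. norm (u i x - u j x) < e" 
        using average[OF L1b[OF d[of i j] t] _ tm] by blast
    qed
  qed
  have iu: "integrable M (u n)" for n by (rule L1i[OF u, of 1]) simp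
  obtain r where r: "strict_mono r" and rc: "AE x in M. Cauchy (\<lambda>i. u (r i) x)"
    using cauchy_L1_AE_cauchy_subseq[of M u, OF iu L1] by blast
  define \<psi> where "\<psi> x = lim (\<lambda>i. u (r i) x)" for x
  have \<psi>m [measurable]: "\<psi> \<in> borel_measurable M"
    unfolding \<psi>_def by (rule borel_measurable_lim_metric) simp
  have lim: "AE x in M. (\<lambda>i. u (r i) x) \<longlonglongrightarrow> \<psi> x"
    using rc unfolding \<psi>_def by eventually_elim (simp add: Cauchy_convergent_iff convergent_LIMSEQ_iff)
  have key: "sq_int M (\<lambda>x. u n x - \<psi> x) \<and> nsq M (\<lambda>x. u n x - \<psi> x) \<le> e"
    if e: "e > 0" and N: "\<forall>i\<ge>N. \<forall>j\<ge>N. nsq M (\<lambda>x. u i x - u j x) < e" and n: "N \<le> n" for e N n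
  proof -
    have "(\<integral>\<^sup>+x. ennreal ((cmod (u n x - \<psi> x))\<^sup>2) \<partial>M)
        = (\<integral>\<^sup>+x. liminf (\<lambda>i. ennreal ((cmod (u n x - u (r i) x))\<^sup>2)) \<partial>M)"
    proof (rule nn_integral_cong_AE)
      show "AE x in M. ennreal ((cmod (u n x - \<psi> x))\<^sup>2) = liminf (\<lambda>i. ennreal ((cmod (u n x - u (r i) x))\<^sup>2))"
        using lim
      proof eventually_elim
        case (elim x)
        have "(\<lambda>i. ennreal ((cmod (u n x - u (r i) x))\<^sup>2)) \<longlonglongrightarrow> ennreal ((cmod (u n x - \<psi> x))\<^sup>2)"
          using elim by (intro tendsto_ennrealI tendsto_intros)
        then show ?case by (intro lim_imp_Liminf[symmetric]) auto
      qed
    qed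
    also have "\<dots> \<le> liminf (\<lambda>i. \<integral>\<^sup>+x. ennreal ((cmod (u n x - u (r i) x))\<^sup>2) \<partial>M)"
      by (rule nn_integral_liminf) measurable
    also have "\<dots> \<le> limsup (\<lambda>i. \<integral>\<^sup>+x. ennreal ((cmod (u n x - u (r i) x))\<^sup>2) \<partial>M)"
      by (rule Liminf_le_Limsup) simp
    also have "\<dots> \<le> ennreal e"
    proof (rule Limsup_bounded)
      show "\<forall>\<^sub>F i in sequentially. (\<integral>\<^sup>+x. ennreal ((cmod (u n x - u (r i) x))\<^sup>2) \<partial>M) \<le> ennreal e"
      proof (rule eventually_sequentiallyI[of N])
        fix i assume "N \<le> i"
        then have "N \<le> r i" using seq_suble[OF r, of i] by linarith
        then have "nsq M (\<lambda>x. u n x - u (r i) x) < e" using N n by auto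
        moreover have "(\<integral>\<^sup>+x. ennreal ((cmod (u n x - u (r i) x))\<^sup>2) \<partial>M) = ennreal (nsq M (\<lambda>x. u n x - u (r i) x))"
          unfolding nsq_def by (rule nn_integral_eq_integral) (use d in \<open>auto simp: sq_int_def\<close>)
        ultimately show "(\<integral>\<^sup>+x. ennreal ((cmod (u n x - u (r i) x))\<^sup>2) \<partial>M) \<le> ennreal e"
          by (simp add: ennreal_leI)
      qed
    qed
    finally have le: "(\<integral>\<^sup>+x. ennreal ((cmod (u n x - \<psi> x))\<^sup>2) \<partial>M) \<le> ennreal e" .
    have i: "integrable M (\<lambda>x. (cmod (u n x - \<psi> x))\<^sup>2)"
      by (rule integrableI_bounded) (use le in \<open>auto simp: le_less_trans[OF _ ennreal_less_top]\<close>)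
    have "ennreal (nsq M (\<lambda>x. u n x - \<psi> x)) \<le> ennreal e"
      using le unfolding nsq_def by (subst nn_integral_eq_integral[OF i, symmetric]) auto
    then show ?thesis using i e by (simp add: sq_int_def)
  qed
  obtain N1 where "\<forall>i\<ge>N1. \<forall>j\<ge>N1. nsq M (\<lambda>x. u i x - u j x) < 1" using cauchy[of 1] by auto
  from key[OF _ this, of N1] have "sq_int M (\<lambda>x. u N1 x - \<psi> x)" by simp
  from sq_int_diff[OF u[of N1] this] have \<psi>: "sq_int M \<psi>" by simp
  have "(\<lambda>n. nsq M (\<lambda>x. u n x - \<psi> x)) \<longlonglongrightarrow> 0"
  proof (rule LIMSEQ_I)
    fix e :: real assume e: "e > 0"
    obtain N where N: "\<forall>i\<ge>N. \<forall>j\<ge>N. nsq M (\<lambda>x. u i x - u j x) < e / 2" using cauchy[of "e / 2"] e by auto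
    have "nsq M (\<lambda>x. u n x - \<psi> x) \<le> e / 2" if "N \<le> n" for n using key[OF _ N that] e by simp
    then show "\<exists>N. \<forall>n\<ge>N. norm (nsq M (\<lambda>x. u n x - \<psi> x) - 0) < e"
      using e by (intro exI[of _ N]) (fastforce)
  qed
  with \<psi> show ?thesis by (rule that)
qed

section \<open>Orthonormal bases and the Galerkin method\<close>

locale orthonormal_basis = finite_measure M for M :: "'a measure" +
  fixes \<phi> :: "nat \<Rightarrow> 'a \<Rightarrow> complex"
  assumes basis_sq_int: "\<And>i. sq_int M (\<phi> i)"
    and orthonormal: "\<And>i j. ip M (\<phi> i) (\<phi> j) = (if i = j then 1 else 0)"
    and dense: "\<And>\<psi> \<epsilon>. sq_int M \<psi> \<Longrightarrow> 0 < \<epsilon> \<Longrightarrow> \<exists>n a. nsq M (\<lambda>x. \<psi> x - (\<Sum>i\<le>n. a i * \<phi> i x)) < \<epsilon>"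
begin

lemma comb_sq_int: "sq_int M (\<lambda>x. \<Sum>i\<le>n. a i * \<phi> i x)"
  by (intro sq_int_sum sq_int_cmult basis_sq_int)

lemma ip_basis_comb: "ip M (\<phi> i) (\<lambda>x. \<Sum>j\<le>n. a j * \<phi> j x) = (if i \<le> n then a i else 0)"
  by (simp add: ip_sum_right basis_sq_int orthonormal if_distrib cong: if_cong)

lemma nsq_comb: "nsq M (\<lambda>x. \<Sum>j\<le>n. a j * \<phi> j x) = (\<Sum>j\<le>n. (cmod (a j))\<^sup>2)"
proof -
  have "complex_of_real (nsq M (\<lambda>x. \<Sum>j\<le>n. a j * \<phi> j x)) = (\<Sum>j\<le>n. cnj (a j) * a j)"
    unfolding ip_self[symmetric]
    by (simp add: ip_sum_left comb_sq_int basis_sq_int ip_basis_comb)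
  also have "\<dots> = complex_of_real (\<Sum>j\<le>n. (cmod (a j))\<^sup>2)"
    by (simp add: complex_norm_square mult.commute del: of_real_power)
  finally show ?thesis by (simp only: of_real_eq_iff)
qed

text \<open>Completing the square. The Fourier coefficients give the best approximation, and more of them a better one;
  this is why density of the span implies convergence of the Fourier series.\<close>

lemma nsq_diff_comb:
  assumes \<psi>: "sq_int M \<psi>"
  shows "nsq M (\<lambda>x. \<psi> x - (\<Sum>j\<le>n. a j * \<phi> j x)) =
    nsq M \<psi> - (\<Sum>j\<le>n. (cmod (ip M (\<phi> j) \<psi>))\<^sup>2) + (\<Sum>j\<le>n. (cmod (ip M (\<phi> j) \<psi> - a j))\<^sup>2)"
proof -
  let ?s = "\<lambda>x. \<Sum>j\<le>n. a j * \<phi> j x" and ?v = "\<lambda>j. ip M (\<phi> j) \<psi>"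
  note s = comb_sq_int[of a n]
  have 2: "ip M ?s \<psi> = (\<Sum>j\<le>n. cnj (a j) * ?v j)"
    by (simp add: ip_sum_left \<psi> basis_sq_int)
  have 1: "ip M \<psi> ?s = (\<Sum>j\<le>n. a j * cnj (?v j))"
    unfolding ip_commute[of M \<psi> ?s] 2 by (simp add: cnj_sum)
  have 3: "ip M ?s ?s = (\<Sum>j\<le>n. cnj (a j) * a j)"
    by (simp add: ip_sum_left comb_sq_int basis_sq_int ip_basis_comb)
  have "complex_of_real (nsq M (\<lambda>x. \<psi> x - ?s x))
      = complex_of_real (nsq M \<psi>) - (\<Sum>j\<le>n. a j * cnj (?v j)) - (\<Sum>j\<le>n. cnj (a j) * ?v j)
        + (\<Sum>j\<le>n. cnj (a j) * a j)"
    unfolding ip_self[symmetric]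
    by (simp add: ip_diff_right ip_diff_left \<psi> s sq_int_diff 1 2 3)
  also have "\<dots> = complex_of_real (nsq M \<psi>) + (\<Sum>j\<le>n. (cnj (?v j - a j)) * (?v j - a j) - cnj (?v j) * ?v j)"
    by (simp add: algebra_simps sum.distrib sum_subtractf)
  also have "\<dots> = complex_of_real (nsq M \<psi> + (\<Sum>j\<le>n. (cmod (?v j - a j))\<^sup>2 - (cmod (?v j))\<^sup>2))"
    by (simp add: complex_norm_square mult.commute del: of_real_power)
  finally show ?thesis by (simp only: of_real_eq_iff) (simp add: sum_subtractf)
qed

lemma bessel: "sq_int M \<psi> \<Longrightarrow> (\<Sum>j\<le>n. (cmod (ip M (\<phi> j) \<psi>))\<^sup>2) \<le> nsq M \<psi>"
  using nsq_diff_comb[of \<psi> "\<lambda>j. ip M (\<phi> j) \<psi>" n] nsq_nonneg[of M "\<lambda>x. \<psi> x - (\<Sum>j\<le>n. ip M (\<phi> j) \<psi> * \<phi> j x)"]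
  by simp

lemma summable_coeff: "sq_int M \<psi> \<Longrightarrow> summable (\<lambda>j. (cmod (ip M (\<phi> j) \<psi>))\<^sup>2)"
  by (rule bounded_imp_summable[of _ "nsq M \<psi>"]) (use bessel in \<open>auto simp: lessThan_Suc_atMost\<close>)

lemma fourier_tendsto:
  assumes \<psi>: "sq_int M \<psi>"
  shows "(\<lambda>n. nsq M (\<lambda>x. (\<Sum>j\<le>n. ip M (\<phi> j) \<psi> * \<phi> j x) - \<psi> x)) \<longlonglongrightarrow> 0"
proof (rule LIMSEQ_I)
  fix e :: real assume "e > 0"
  then obtain n a where na: "nsq M (\<lambda>x. \<psi> x - (\<Sum>i\<le>n. a i * \<phi> i x)) < e" using dense[OF \<psi>] by blast
  have "nsq M (\<lambda>x. (\<Sum>j\<le>m. ip M (\<phi> j) \<psi> * \<phi> j x) - \<psi> x) < e" if "n \<le> m" for m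
  proof -
    have "nsq M (\<lambda>x. (\<Sum>j\<le>m. ip M (\<phi> j) \<psi> * \<phi> j x) - \<psi> x)
        = nsq M \<psi> - (\<Sum>j\<le>m. (cmod (ip M (\<phi> j) \<psi>))\<^sup>2)"
      using nsq_diff_comb[OF \<psi>, of "\<lambda>j. ip M (\<phi> j) \<psi>" m] by (simp add: nsq_def norm_minus_commute)
    also have "\<dots> \<le> nsq M \<psi> - (\<Sum>j\<le>n. (cmod (ip M (\<phi> j) \<psi>))\<^sup>2)"
      using that by (simp add: sum_mono2)
    also have "\<dots> \<le> nsq M (\<lambda>x. \<psi> x - (\<Sum>i\<le>n. a i * \<phi> i x))"
      unfolding nsq_diff_comb[OF \<psi>] by (simp add: sum_nonneg)
    finally show ?thesis using na by simp
  qed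
  then show "\<exists>N. \<forall>n\<ge>N. norm (nsq M (\<lambda>x. (\<Sum>j\<le>n. ip M (\<phi> j) \<psi> * \<phi> j x) - \<psi> x) - 0) < e"
    by (intro exI[of _ n]) auto
qed

lemma eq_if_coeff_eq:
  assumes \<psi>: "sq_int M \<psi>" and \<eta>: "sq_int M \<eta>" and eq: "\<And>i. ip M (\<phi> i) \<psi> = ip M (\<phi> i) \<eta>"
  shows "AE x in M. \<psi> x = \<eta> x"
proof -
  note d = sq_int_diff[OF \<psi> \<eta>]
  have "ip M (\<phi> j) (\<lambda>x. \<psi> x - \<eta> x) = 0" for j by (simp add: ip_diff_right \<psi> \<eta> basis_sq_int eq)
  then have "(\<lambda>n::nat. nsq M (\<lambda>x. \<psi> x - \<eta> x)) \<longlonglongrightarrow> 0"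
    using fourier_tendsto[OF d] by (simp add: nsq_def norm_minus_commute)
  then have "nsq M (\<lambda>x. \<psi> x - \<eta> x) = 0" by (simp add: LIMSEQ_const_iff)
  then show ?thesis using nsq_eq_0_iff[OF d] by simp
qed

text \<open>The function \<open>u\<^sub>n = \<Sum>\<^sub>j y\<^sub>n\<^sub>j \<phi>\<^sub>j\<close> is the Galerkin approximation to the solution of \<open>A u = 1\<close> in the span of
  \<open>\<phi>\<^sub>0, \<dots>, \<phi>\<^sub>n\<close>, and \<open>y\<^sub>n\<^sub>0\<close> is its energy \<open>\<langle>u\<^sub>n, A u\<^sub>n\<rangle>\<close>. Galerkin orthogonality gives
  \<open>\<langle>u\<^sub>m - u\<^sub>n, A (u\<^sub>m - u\<^sub>n)\<rangle> = y\<^sub>m\<^sub>0 - y\<^sub>n\<^sub>0\<close> for \<open>n \<le> m\<close>. Hence \<open>y\<^sub>n\<^sub>0\<close> increases, and as it is bounded,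
  the \<open>u\<^sub>n\<close> form a Cauchy sequence. Its limit \<open>\<psi>\<close> satisfies \<open>\<langle>A \<phi>\<^sub>i, \<psi>\<rangle> = \<langle>\<phi>\<^sub>i, 1\<rangle>\<close> for all \<open>i\<close>. The assumption
  \<open>maximal\<close> says that the operator given by the infinite matrix of \<open>A\<close> on its maximal domain
  is not larger than the multiplication operator. Therefore \<open>A \<psi> = 1\<close>.\<close>

theorem galerkin_reciprocal:
  fixes A :: "'a \<Rightarrow> real" and y :: "nat \<Rightarrow> nat \<Rightarrow> complex"
  assumes A [measurable]: "A \<in> borel_measurable M"
    and s: "0 < s" and A_ge: "AE x in M. s \<le> A x"
    and A\<phi>: "\<And>i. sq_int M (\<lambda>x. complex_of_real (A x) * \<phi> i x)"
    and one: "AE x in M. \<phi> 0 x = 1"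
    and maximal: "\<And>\<psi>. sq_int M \<psi> \<Longrightarrow>
      summable (\<lambda>i. (cmod (ip M (\<lambda>x. complex_of_real (A x) * \<phi> i x) \<psi>))\<^sup>2) \<Longrightarrow>
      sq_int M (\<lambda>x. complex_of_real (A x) * \<psi> x)"
    and y: "\<And>n i. i \<le> n \<Longrightarrow>
      (\<Sum>j\<le>n. ip M (\<phi> i) (\<lambda>x. complex_of_real (A x) * \<phi> j x) * y n j) = (if i = 0 then 1 else 0)"
  shows "(\<lambda>n. Re (y n 0)) \<longlonglongrightarrow> (LINT x|M. 1 / A x)" and "incseq (\<lambda>n. Re (y n 0))"
proof -
  define u where "u n x = (\<Sum>j\<le>n. y n j * \<phi> j x)" for n x
  define Au where "Au n x = (\<Sum>j\<le>n. y n j * (complex_of_real (A x) * \<phi> j x))" for n x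
  have Au_eq: "Au n x = complex_of_real (A x) * u n x" for n x
    by (simp add: Au_def u_def sum_distrib_left mult_ac)
  have u: "sq_int M (u n)" for n unfolding u_def by (rule comb_sq_int)
  have Au: "sq_int M (Au n)" for n unfolding Au_def by (intro sq_int_sum sq_int_cmult A\<phi>)
  have row: "ip M (\<phi> i) (Au n) = (if i = 0 then 1 else 0)" if "i \<le> n" for i n
    unfolding Au_def using y[OF that] by (simp add: ip_sum_right basis_sq_int A\<phi> mult.commute)
  \<comment> \<open>Testing the equations for \<open>u n\<close> with \<open>u k\<close> only sees the zeroth coefficient.\<close>
  have test: "ip M (u k) (Au n) = cnj (y k 0)" if "k \<le> n" for k n
  proof -
    have "ip M (u k) (Au n) = (\<Sum>i\<le>k. cnj (y k i) * (if i = 0 then 1 else 0))"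
      unfolding u_def using that by (simp add: ip_sum_left Au basis_sq_int row)
    also have "\<dots> = cnj (y k 0)" by (simp add: if_distrib cong: if_cong)
    finally show ?thesis .
  qed
  have sym: "ip M (u k) (Au n) = cnj (ip M (u n) (Au k))" for k n
    unfolding Au_eq using ip_mult_real_swap[of M A "u k" "u n"]
      ip_commute[of M "u n" "\<lambda>x. complex_of_real (A x) * u k x"] by (simp add: Au_eq)
  have energy: "s * nsq M v \<le> Re (ip M v (\<lambda>x. complex_of_real (A x) * v x))"
    if v: "sq_int M v" and Av: "sq_int M (\<lambda>x. complex_of_real (A x) * v x)" for v
  proof -
    have eq: "cnj (v x) * (complex_of_real (A x) * v x) = complex_of_real (A x * (cmod (v x))\<^sup>2)" for x
      by (simp add: complex_norm_square mult_ac del: of_real_power)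
    have i: "integrable M (\<lambda>x. A x * (cmod (v x))\<^sup>2)"
      using integrable_Re[OF sq_int_integrable_mult[OF v Av]] unfolding eq by simp
    have "s * nsq M v = (LINT x|M. s * (cmod (v x))\<^sup>2)" by (simp add: nsq_def)
    also have "\<dots> \<le> (LINT x|M. A x * (cmod (v x))\<^sup>2)"
      using v A_ge by (intro integral_mono_AE i) (auto simp: sq_int_def intro: mult_right_mono elim!: eventually_mono)
    also have "\<dots> = Re (ip M v (\<lambda>x. complex_of_real (A x) * v x))"
      unfolding ip_def eq by (simp add: integral_complex_of_real del: of_real_mult of_real_power)
    finally show ?thesis .
  qed
  have real: "y n 0 = cnj (y n 0)" for n
    using test[of n n] sym[of n n] by simp
  have dist: "s * nsq M (\<lambda>x. u m x - u n x) \<le> Re (y m 0) - Re (y n 0)" if nm: "n \<le> m" for n m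
  proof -
    have *: "complex_of_real (A x) * (u m x - u n x) = Au m x - Au n x" for x
      by (simp add: Au_eq right_diff_distrib)
    have "s * nsq M (\<lambda>x. u m x - u n x) \<le> Re (ip M (\<lambda>x. u m x - u n x) (\<lambda>x. Au m x - Au n x))"
      using energy[of "\<lambda>x. u m x - u n x"] unfolding * by (simp add: sq_int_diff u Au)
    also have "ip M (\<lambda>x. u m x - u n x) (\<lambda>x. Au m x - Au n x)
        = (cnj (y m 0) - y n 0) - (cnj (y n 0) - cnj (y n 0))"
      using sym[of m n] test[OF nm]
      by (simp add: ip_diff_right ip_diff_left u Au sq_int_diff test nm)
    finally show ?thesis by simp
  qed
  show inc: "incseq (\<lambda>n. Re (y n 0))"
    unfolding incseq_def using dist s by (meson diff_ge_0_iff_ge mult_nonneg_nonneg nsq_nonneg order_trans less_imp_le)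
  \<comment> \<open>The energy equals \<open>y n 0\<close> and is at least \<open>s\<close> times the square of \<open>y n 0\<close>.\<close>
  have bound: "Re (y n 0) \<le> 1 / s" for n
  proof -
    have "(cmod (y n 0))\<^sup>2 \<le> nsq M (u n)"
      unfolding u_def nsq_comb by (rule member_le_sum) auto
    then have "(Re (y n 0))\<^sup>2 \<le> nsq M (u n)"
      unfolding cmod_power2 using zero_le_power2[of "Im (y n 0)"] by linarith
    then have "s * (Re (y n 0))\<^sup>2 \<le> s * nsq M (u n)" using s by simp
    also have "\<dots> \<le> Re (ip M (u n) (Au n))"
      using energy[OF u[of n]] Au[of n] by (simp add: Au_eq[abs_def])
    finally have "s * (Re (y n 0))\<^sup>2 \<le> Re (ip M (u n) (Au n))" .
    then have *: "s * Re (y n 0) * Re (y n 0) \<le> Re (y n 0)" by (simp add: test power2_eq_square)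
    show ?thesis
    proof (cases "Re (y n 0) \<le> 0")
      case True then show ?thesis using s by (auto intro: order_trans)
    next
      case False
      then have "s * Re (y n 0) \<le> 1" using * by simp
      then show ?thesis using s by (simp add: pos_le_divide_eq mult.commute)
    qed
  qed
  have "convergent (\<lambda>n. Re (y n 0))" using incseq_convergent[OF inc] bound by (meson convergentI)
  then have yc: "Cauchy (\<lambda>n. Re (y n 0))" by (simp add: Cauchy_convergent_iff)
  have nsq_swap: "nsq M (\<lambda>x. u i x - u j x) = nsq M (\<lambda>x. u j x - u i x)" for i j
    by (simp add: nsq_def norm_minus_commute)
  have uc: "\<exists>N. \<forall>i\<ge>N. \<forall>j\<ge>N. nsq M (\<lambda>x. u i x - u j x) < e" if e: "e > 0" for e
  proof -
    obtain N where N: "\<forall>i\<ge>N. \<forall>j\<ge>N. norm (Re (y i 0) - Re (y j 0)) < s * e"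
      using CauchyD[OF yc, of "s * e"] s e by auto
    have *: "nsq M (\<lambda>x. u i x - u j x) < e" if "N \<le> j" "j \<le> i" for i j
    proof -
      have "s * nsq M (\<lambda>x. u i x - u j x) < s * e"
        using dist[OF that(2)] N that by (smt (verit) order_trans real_norm_def)
      then show ?thesis using s by simp
    qed
    show ?thesis
      using * nsq_swap by (intro exI[of _ N] allI impI) (metis linear)
  qed
  obtain \<psi> where \<psi>: "sq_int M \<psi>" and u_lim: "(\<lambda>n. nsq M (\<lambda>x. u n x - \<psi> x)) \<longlonglongrightarrow> 0"
    using sq_int_complete[OF u uc] .
  have ip_lim: "(\<lambda>n. ip M \<theta> (u n)) \<longlonglongrightarrow> ip M \<theta> \<psi>" if \<theta>: "sq_int M \<theta>" for \<theta>
    using tendsto_ip_zero[OF \<theta> sq_int_diff[OF u \<psi>] u_lim]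
    by (simp add: ip_diff_right \<theta> u \<psi> LIM_zero_iff)
  have row_\<psi>: "ip M (\<lambda>x. complex_of_real (A x) * \<phi> i x) \<psi> = (if i = 0 then 1 else 0)" for i
  proof -
    have "(\<lambda>n. ip M (\<lambda>x. complex_of_real (A x) * \<phi> i x) (u n)) \<longlonglongrightarrow> (if i = 0 then 1 else 0)"
    proof (rule tendsto_eventually, rule eventually_sequentiallyI)
      fix n assume "i \<le> n"
      then show "ip M (\<lambda>x. complex_of_real (A x) * \<phi> i x) (u n) = (if i = 0 then 1 else 0)"
        using row[of i n] by (simp add: ip_mult_real_swap Au_eq[abs_def] cong: if_cong)
    qed
    then show ?thesis using LIMSEQ_unique ip_lim[OF A\<phi>] by blast
  qed
  have A\<psi>: "sq_int M (\<lambda>x. complex_of_real (A x) * \<psi> x)"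
    by (rule maximal[OF \<psi>], rule summable_finite[of "{0}"]) (auto simp: row_\<psi>)
  have "AE x in M. complex_of_real (A x) * \<psi> x = \<phi> 0 x"
    by (rule eq_if_coeff_eq[OF A\<psi> basis_sq_int]) (use row_\<psi> in \<open>simp add: ip_mult_real_swap orthonormal\<close>)
  then have \<psi>_eq: "AE x in M. \<psi> x = complex_of_real (1 / A x)"
    using A_ge one by eventually_elim (use s in \<open>auto simp: field_simps\<close>)
  have "ip M (\<phi> 0) \<psi> = (LINT x|M. complex_of_real (1 / A x))"
    unfolding ip_def using \<psi>_eq one basis_sq_int[of 0] \<psi>
    by (intro integral_cong_AE) (auto simp: sq_int_def elim!: eventually_elim2)
  moreover have "(\<lambda>n. ip M (\<phi> 0) (u n)) \<longlonglongrightarrow> ip M (\<phi> 0) \<psi>" by (rule ip_lim[OF basis_sq_int])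
  moreover have "ip M (\<phi> 0) (u n) = y n 0" for n unfolding u_def ip_basis_comb by simp
  ultimately have "(\<lambda>n. y n 0) \<longlonglongrightarrow> complex_of_real (LINT x|M. 1 / A x)"
    by (simp only: integral_complex_of_real)
  from tendsto_Re[OF this] show "(\<lambda>n. Re (y n 0)) \<longlonglongrightarrow> (LINT x|M. 1 / A x)" by simp
qed

end

section \<open>Convergence of a sequence of discrete measures\<close>

text \<open>The \<open>n\<close>-th rule has the nodes \<open>nd n k\<close> and the weights \<open>wt n k\<close>, for \<open>k \<le> n\<close>. It is meant to approximate the
  distribution of the random variable \<open>g\<close>.\<close>

locale quadrature_sequence = finite_measure M for M :: "'a measure" +
  fixes g :: "'a \<Rightarrow> real" and wt nd :: "nat \<Rightarrow> nat \<Rightarrow> real"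
  assumes mass_1: "measure M (space M) = 1"
    and g_measurable [measurable]: "g \<in> borel_measurable M"
    and wt_nonneg: "\<And>n k. 0 \<le> wt n k"
    and wt_sum: "\<And>n. (\<Sum>k\<le>n. wt n k) = 1"
begin

definition quad :: "nat \<Rightarrow> (real \<Rightarrow> real) \<Rightarrow> real" where
  "quad n h = (\<Sum>k\<le>n. wt n k * h (nd n k))"

definition quad_conv :: "(real \<Rightarrow> real) \<Rightarrow> bool" where
  "quad_conv h \<longleftrightarrow> integrable M (\<lambda>x. h (g x)) \<and> (\<lambda>n. quad n h) \<longlonglongrightarrow> (LINT x|M. h (g x))"

lemma quad_mono: "(\<And>k. k \<le> n \<Longrightarrow> h (nd n k) \<le> h' (nd n k)) \<Longrightarrow> quad n h \<le> quad n h'"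
  unfolding quad_def by (intro sum_mono mult_left_mono) (auto simp: wt_nonneg)

lemma quad_cong: "(\<And>k. k \<le> n \<Longrightarrow> h (nd n k) = h' (nd n k)) \<Longrightarrow> quad n h = quad n h'"
  unfolding quad_def by (intro sum.cong) auto

lemma quad_conv_integrable: "quad_conv h \<Longrightarrow> integrable M (\<lambda>x. h (g x))"
  by (simp add: quad_conv_def)

lemma quad_conv_tendsto: "quad_conv h \<Longrightarrow> (\<lambda>n. quad n h) \<longlonglongrightarrow> (LINT x|M. h (g x))"
  by (simp add: quad_conv_def)

lemma quad_conv_const [simp]: "quad_conv (\<lambda>_. a)"
  by (simp add: quad_conv_def quad_def mass_1 wt_sum flip: sum_distrib_right)

lemma quad_conv_add: "quad_conv h \<Longrightarrow> quad_conv h' \<Longrightarrow> quad_conv (\<lambda>x. h x + h' x)"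
  unfolding quad_conv_def quad_def by (auto simp: distrib_left sum.distrib intro: tendsto_add)

lemma quad_conv_cmult: "quad_conv h \<Longrightarrow> quad_conv (\<lambda>x. a * h x)"
proof -
  assume h: "quad_conv h"
  have "quad n (\<lambda>x. a * h x) = a * quad n h" for n
    unfolding quad_def by (simp add: sum_distrib_left mult_ac)
  then show ?thesis using h unfolding quad_conv_def by (auto intro: tendsto_mult_left)
qed

lemma quad_conv_diff: "quad_conv h \<Longrightarrow> quad_conv h' \<Longrightarrow> quad_conv (\<lambda>x. h x - h' x)"
  using quad_conv_add[of h "\<lambda>x. (-1) * h' x"] quad_conv_cmult[of h' "-1"] by simp

lemma quad_conv_sum: "(\<And>i. i \<in> I \<Longrightarrow> quad_conv (h i)) \<Longrightarrow> quad_conv (\<lambda>x. \<Sum>i\<in>I. h i x)"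
  by (induction I rule: infinite_finite_induct) (auto intro: quad_conv_add)

lemma quad_conv_cong:
  assumes h: "quad_conv h" and m: "(\<lambda>x. h' (g x)) \<in> borel_measurable M"
    and nd: "\<And>n k. k \<le> n \<Longrightarrow> h (nd n k) = h' (nd n k)" and ae: "AE x in M. h (g x) = h' (g x)"
  shows "quad_conv h'"
proof -
  have i: "integrable M (\<lambda>x. h (g x))" using h by (simp add: quad_conv_def)
  have "integrable M (\<lambda>x. h' (g x))"
    using i m ae integrable_cong_AE[of "\<lambda>x. h (g x)" M "\<lambda>x. h' (g x)"] by auto
  moreover have "(LINT x|M. h (g x)) = (LINT x|M. h' (g x))"
    by (rule integral_cong_AE) (use i m ae in auto)
  moreover have "quad n h = quad n h'" for n using nd by (rule quad_cong)
  ultimately show ?thesis using h by (simp add: quad_conv_def)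
qed

definition brackets :: "(real \<Rightarrow> real) \<Rightarrow> real \<Rightarrow> (real \<Rightarrow> real) \<Rightarrow> (real \<Rightarrow> real) \<Rightarrow> bool" where
  "brackets h \<epsilon> L U \<longleftrightarrow> quad_conv L \<and> quad_conv U \<and>
      (\<forall>n. \<forall>k\<le>n. L (nd n k) \<le> h (nd n k) \<and> h (nd n k) \<le> U (nd n k)) \<and>
      (AE x in M. L (g x) \<le> h (g x) \<and> h (g x) \<le> U (g x)) \<and>
      (LINT x|M. U (g x) - L (g x)) \<le> \<epsilon>"

text \<open>The set of functions for which the quadratures converge is closed under squeezing, which is how
  discontinuous functions are reached below. As \<open>h\<close> itself may fail to be measurable, its integral is
  expressed through a measurable representative \<open>k\<close> of \<open>h \<circ> g\<close>, which is the almost sure limit of lower bounds.\<close>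

theorem quad_squeeze:
  assumes squeeze: "\<And>\<epsilon>. 0 < \<epsilon> \<Longrightarrow> \<exists>L U. brackets h \<epsilon> L U"
  obtains k where "integrable M k" "AE x in M. h (g x) = k x" "(\<lambda>n. quad n h) \<longlonglongrightarrow> (LINT x|M. k x)"
proof -
  have "\<forall>m. \<exists>L U. brackets h (inverse (real (Suc m))) L U" using squeeze by simp
  then obtain L U where LU: "brackets h (inverse (real (Suc m))) (L m) (U m)" for m by metis
  have cL: "quad_conv (L m)" and cU: "quad_conv (U m)"
    and ndL: "j \<le> n \<Longrightarrow> L m (nd n j) \<le> h (nd n j)" and ndU: "j \<le> n \<Longrightarrow> h (nd n j) \<le> U m (nd n j)"
    and aeLU: "AE x in M. L m (g x) \<le> h (g x) \<and> h (g x) \<le> U m (g x)"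
    and width: "(LINT x|M. U m (g x) - L m (g x)) \<le> inverse (real (Suc m))" for m n j
    using LU[of m] unfolding brackets_def by auto
  have iL: "integrable M (\<lambda>x. L m (g x))" and iU: "integrable M (\<lambda>x. U m (g x))" for m
    using cL cU by (auto simp: quad_conv_def)
  have mL [measurable]: "(\<lambda>x. L m (g x)) \<in> borel_measurable M" for m using iL by auto
  have ae_all: "AE x in M. \<forall>m. L m (g x) \<le> h (g x) \<and> h (g x) \<le> U m (g x)"
    using aeLU by (simp add: AE_all_countable)
  have "(\<lambda>m. LINT x|M. norm (U m (g x) - L m (g x))) \<longlonglongrightarrow> 0"
  proof (rule tendsto_sandwich[of "\<lambda>_. 0" _ _ "\<lambda>m. inverse (real (Suc m))"])
    have nonneg: "AE x in M. norm (U m (g x) - L m (g x)) = U m (g x) - L m (g x)" for m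
      using aeLU[of m] by eventually_elim auto
    have "(LINT x|M. norm (U m (g x) - L m (g x))) = (LINT x|M. U m (g x) - L m (g x))" for m
      by (intro integral_cong_AE nonneg) (use iL iU in auto)
    then show "\<forall>\<^sub>F m in sequentially. (LINT x|M. norm (U m (g x) - L m (g x))) \<le> inverse (real (Suc m))"
      using width by simp
    show "(\<lambda>m. inverse (real (Suc m))) \<longlonglongrightarrow> 0" by (rule LIMSEQ_inverse_real_of_nat)
  qed auto
  then obtain r where r: "strict_mono r" and r0: "AE x in M. (\<lambda>m. U (r m) (g x) - L (r m) (g x)) \<longlonglongrightarrow> 0"
    using tendsto_L1_AE_subseq[of M "\<lambda>m x. U m (g x) - L m (g x)", OF Bochner_Integration.integrable_diff[OF iU iL]]
    by blast
  define k where "k x = lim (\<lambda>m. L (r m) (g x))" for x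
  have mk [measurable]: "k \<in> borel_measurable M"
    unfolding k_def by (rule borel_measurable_lim_metric) simp
  have hk: "AE x in M. h (g x) = k x"
    using ae_all r0
  proof eventually_elim
    case (elim x)
    have "(\<lambda>m. h (g x) - L (r m) (g x)) \<longlonglongrightarrow> 0"
      by (rule tendsto_sandwich[OF _ _ tendsto_const elim(2)]) (use elim(1) in auto)
    from tendsto_diff[OF tendsto_const[of "h (g x)"] this] have "(\<lambda>m. L (r m) (g x)) \<longlonglongrightarrow> h (g x)" by simp
    then show ?case unfolding k_def by (simp add: limI)
  qed
  have ik: "integrable M k"
  proof (rule Bochner_Integration.integrable_bound[OF Bochner_Integration.integrable_add[OF integrable_abs[OF iL[of 0]] integrable_abs[OF iU[of 0]]] mk])
    show "AE x in M. norm (k x) \<le> norm (\<bar>L 0 (g x)\<bar> + \<bar>U 0 (g x)\<bar>)"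
      using hk ae_all
    proof eventually_elim
      case (elim x)
      have "L 0 (g x) \<le> k x" "k x \<le> U 0 (g x)" using elim by metis+
      then show ?case by simp
    qed
  qed
  have "(\<lambda>n. quad n h) \<longlonglongrightarrow> (LINT x|M. k x)"
  proof (rule LIMSEQ_I)
    fix \<epsilon> :: real assume e: "\<epsilon> > 0"
    obtain m where m: "inverse (real (Suc m)) < \<epsilon> / 2" using reals_Archimedean[of "\<epsilon> / 2"] e by auto
    have b1: "(LINT x|M. L m (g x)) \<le> (LINT x|M. k x)"
      by (intro integral_mono_AE iL ik) (use hk ae_all in eventually_elim, metis)
    have b2: "(LINT x|M. k x) \<le> (LINT x|M. U m (g x))"
      by (intro integral_mono_AE iU ik) (use hk ae_all in eventually_elim, metis)
    have b3: "(LINT x|M. U m (g x)) - (LINT x|M. L m (g x)) < \<epsilon> / 2"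
      using width[of m] m iL iU by simp
    have lower: "\<forall>\<^sub>F n in sequentially. (LINT x|M. L m (g x)) - \<epsilon> / 2 < quad n (L m)"
      by (rule order_tendstoD(1)[OF quad_conv_tendsto[OF cL]]) (use e in simp)
    have upper: "\<forall>\<^sub>F n in sequentially. quad n (U m) < (LINT x|M. U m (g x)) + \<epsilon> / 2"
      by (rule order_tendstoD(2)[OF quad_conv_tendsto[OF cU]]) (use e in simp)
    have b4: "quad n (L m) \<le> quad n h" "quad n h \<le> quad n (U m)" for n
      using ndL ndU by (auto intro: quad_mono)
    have "\<forall>\<^sub>F n in sequentially. norm (quad n h - (LINT x|M. k x)) < \<epsilon>"
      using lower upper
    proof eventually_elim
      case (elim n)
      have "quad n h < (LINT x|M. k x) + \<epsilon>" "(LINT x|M. k x) - \<epsilon> < quad n h"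
        using elim b1 b2 b3 b4[of n] by (simp_all add: field_simps)
      then show ?case by (simp add: abs_less_iff)
    qed
    then show "\<exists>N. \<forall>n\<ge>N. norm (quad n h - (LINT x|M. k x)) < \<epsilon>"
      by (simp add: eventually_sequentially)
  qed
  with ik hk show ?thesis by (rule that)
qed

lemma quad_conv_squeeze:
  assumes m: "(\<lambda>x. h (g x)) \<in> borel_measurable M"
    and squeeze: "\<And>\<epsilon>. 0 < \<epsilon> \<Longrightarrow> \<exists>L U. brackets h \<epsilon> L U"
  shows "quad_conv h"
proof -
  obtain k where k: "integrable M k" "AE x in M. h (g x) = k x" "(\<lambda>n. quad n h) \<longlonglongrightarrow> (LINT x|M. k x)"
    using quad_squeeze[OF squeeze] .
  have "integrable M (\<lambda>x. h (g x))"
    using k m integrable_cong_AE[of "\<lambda>x. h (g x)" M k] by auto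
  moreover have "(LINT x|M. h (g x)) = (LINT x|M. k x)"
    by (rule integral_cong_AE) (use k m in auto)
  ultimately show ?thesis using k by (simp add: quad_conv_def)
qed

lemma quad_conv_uniform_limit:
  assumes m: "(\<lambda>x. h (g x)) \<in> borel_measurable M"
    and approx: "\<And>\<epsilon>. 0 < \<epsilon> \<Longrightarrow> \<exists>h'. quad_conv h' \<and> (\<forall>n. \<forall>k\<le>n. \<bar>h (nd n k) - h' (nd n k)\<bar> \<le> \<epsilon>) \<and>
      (AE x in M. \<bar>h (g x) - h' (g x)\<bar> \<le> \<epsilon>)"
  shows "quad_conv h"
proof (rule quad_conv_squeeze[OF m])
  fix \<epsilon> :: real assume "0 < \<epsilon>"
  then obtain h' where h': "quad_conv h'" "\<forall>n. \<forall>k\<le>n. \<bar>h (nd n k) - h' (nd n k)\<bar> \<le> \<epsilon> / 2"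
      "AE x in M. \<bar>h (g x) - h' (g x)\<bar> \<le> \<epsilon> / 2" using approx[of "\<epsilon> / 2"] by auto
  show "\<exists>L U. brackets h \<epsilon> L U"
    unfolding brackets_def
  proof (intro exI conjI allI impI)
    show "quad_conv (\<lambda>x. h' x - \<epsilon> / 2)" "quad_conv (\<lambda>x. h' x + \<epsilon> / 2)"
      using h'(1) by (auto intro: quad_conv_diff quad_conv_add)
    show "h' (nd n k) - \<epsilon> / 2 \<le> h (nd n k)" "h (nd n k) \<le> h' (nd n k) + \<epsilon> / 2" if "k \<le> n" for n k
      using h'(2)[rule_format, OF that] by (simp_all add: field_simps; linarith)+
    show "AE x in M. h' (g x) - \<epsilon> / 2 \<le> h (g x) \<and> h (g x) \<le> h' (g x) + \<epsilon> / 2"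
      using h'(3) by eventually_elim (simp only: abs_le_iff, linarith)
    show "(LINT x|M. h' (g x) + \<epsilon> / 2 - (h' (g x) - \<epsilon> / 2)) \<le> \<epsilon>" by (simp add: mass_1)
  qed
qed

text \<open>A finite measure has only countably many atoms.\<close>

lemma exists_non_atom:
  assumes "u < v" shows "\<exists>t\<in>{u<..<v}. AE x in M. g x \<noteq> t"
proof -
  interpret dg: finite_measure "distr M borel g" by (rule finite_measure_distr) simp
  have "uncountable ({u<..<v} - {t. measure (distr M borel g) {t} \<noteq> 0})"
    using assms by (intro uncountable_minus_countable dg.countable_support) (simp add: uncountable_open_interval)
  then have "{u<..<v} - {t. measure (distr M borel g) {t} \<noteq> 0} \<noteq> {}"
    using countable_empty by fastforce
  then obtain t where t: "t \<in> {u<..<v}" "measure (distr M borel g) {t} = 0" by blast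
  have "emeasure M (g -` {t} \<inter> space M) = 0"
    using t(2) by (simp add: measure_distr emeasure_eq_measure)
  then have "AE x in M. g x \<noteq> t"
    by (intro AE_I[of _ _ "g -` {t} \<inter> space M"]) auto
  then show ?thesis using t by blast
qed

end

text \<open>The nodes and the values of \<open>g\<close> lie on one side of \<open>c\<close>: below it if \<open>\<sigma> = 1\<close>, above it if
  \<open>\<sigma> = -1\<close>. The quadrature rules converge from below for the functions \<open>x \<mapsto> 1 / (s + \<bar>x - c\<bar>)\<close>.\<close>

locale one_sided_quadrature = quadrature_sequence +
  fixes c \<sigma> :: real
  assumes sign: "\<sigma> = 1 \<or> \<sigma> = -1"
    and g_side: "AE x in M. 0 \<le> \<sigma> * (c - g x)"
    and nd_side: "\<And>n k. k \<le> n \<Longrightarrow> 0 < \<sigma> * (c - nd n k)"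
    and resolvent_conv: "\<And>s. 0 < s \<Longrightarrow> quad_conv (\<lambda>x. 1 / (s + \<sigma> * (c - x)))"
    and resolvent_le: "\<And>s n. 0 < s \<Longrightarrow>
      quad n (\<lambda>x. 1 / (s + \<sigma> * (c - x))) \<le> (LINT x|M. 1 / (s + \<sigma> * (c - g x)))"
begin

definition D :: "real \<Rightarrow> real" where "D x = \<sigma> * (c - x)"

text \<open>This variable maps the half-line to the bounded interval from \<open>0\<close> to \<open>1\<close>, on which polynomials are
  dense.\<close>

definition T :: "real \<Rightarrow> real" where "T x = 1 / (1 + D x)"

lemma D_measurable [measurable]: "D \<in> borel_measurable borel" unfolding D_def by measurable
lemma T_measurable [measurable]: "T \<in> borel_measurable borel" unfolding T_def by measurable

lemma D_nd: "k \<le> n \<Longrightarrow> 0 < D (nd n k)" using nd_side by (simp add: D_def)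
lemma D_g: "AE x in M. 0 \<le> D (g x)" using g_side by (simp add: D_def)
lemma abs_diff_c: "\<bar>x - c\<bar> = \<bar>D x\<bar>" using sign by (auto simp: D_def abs_mult)

lemma T_bounds: assumes "0 \<le> D x" shows "0 < T x" "T x \<le> 1"
  using assms by (auto simp: T_def)

text \<open>All powers of \<open>t = 1 / (1 + \<bar>x - c\<bar>)\<close> are obtained from resolvents as follows. The difference
  quotient \<open>(t\<^sup>m\<^sup>+\<^sup>1 / (1 - z t) - t\<^sup>m\<^sup>+\<^sup>1) / z\<close>
  equals \<open>t\<^sup>m\<^sup>+\<^sup>2 / (1 - z t)\<close>, which tends to \<open>t\<^sup>m\<^sup>+\<^sup>2\<close> uniformly as \<open>z \<rightarrow> 0\<close>. The induction starts with
  \<open>t / (1 - z t) = 1 / ((1 - z) + \<bar>x - c\<bar>)\<close>.\<close>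

lemma quad_conv_T_power_aux:
  assumes "0 \<le> z" "z < 1"
  shows "quad_conv (\<lambda>x. T x ^ Suc m / (1 - z * T x))"
  using assms
proof (induction m arbitrary: z)
  case 0
  have *: "1 / ((1 - z) + \<sigma> * (c - x)) = T x ^ Suc 0 / (1 - z * T x)" if "0 \<le> D x" for x
  proof -
    have "1 - z * T x = ((1 - z) + D x) / (1 + D x)" using that by (simp add: T_def field_simps)
    then show ?thesis using that 0 by (simp add: T_def D_def)
  qed
  show ?case
  proof (rule quad_conv_cong[OF resolvent_conv[of "1 - z"]])
    show "AE x in M. 1 / (1 - z + \<sigma> * (c - g x)) = T (g x) ^ Suc 0 / (1 - z * T (g x))"
      using D_g by eventually_elim (rule *)
    show "1 / (1 - z + \<sigma> * (c - nd n k)) = T (nd n k) ^ Suc 0 / (1 - z * T (nd n k))" if "k \<le> n" for n k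
      using D_nd[OF that] by (intro *) simp
  qed (use 0 in simp, measurable)
next
  case (Suc m)
  have zT: "1 - z * T x > 0" if "0 \<le> D x" "0 \<le> z" "z < 1" for x z
    using T_bounds[OF that(1)] that mult_left_le[of "T x" z] by simp
  have pos: "quad_conv (\<lambda>x. T x ^ Suc (Suc m) / (1 - z * T x))" if z: "0 < z" "z < 1" for z
  proof (rule quad_conv_cong)
    show "quad_conv (\<lambda>x. (1 / z) * (T x ^ Suc m / (1 - z * T x) - T x ^ Suc m / (1 - 0 * T x)))"
      using z by (intro quad_conv_cmult quad_conv_diff Suc.IH) auto
    have *: "(1 / z) * (T x ^ Suc m / (1 - z * T x) - T x ^ Suc m / (1 - 0 * T x)) = T x ^ Suc (Suc m) / (1 - z * T x)"
      if "0 \<le> D x" for x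
      using zT[OF that, of z] z by (simp add: field_simps)
    show "AE x in M. (1 / z) * (T (g x) ^ Suc m / (1 - z * T (g x)) - T (g x) ^ Suc m / (1 - 0 * T (g x))) =
        T (g x) ^ Suc (Suc m) / (1 - z * T (g x))"
      using D_g by eventually_elim (rule *)
    show "(1 / z) * (T (nd n k) ^ Suc m / (1 - z * T (nd n k)) - T (nd n k) ^ Suc m / (1 - 0 * T (nd n k))) =
        T (nd n k) ^ Suc (Suc m) / (1 - z * T (nd n k))" if "k \<le> n" for n k
      using D_nd[OF that] by (intro *) simp
  qed measurable
  show ?case
  proof (cases "z = 0")
    case False
    then show ?thesis using pos Suc.prems by simp
  next
    case True
    have "quad_conv (\<lambda>x. T x ^ Suc (Suc m))"
    proof (rule quad_conv_uniform_limit)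
      fix \<epsilon> :: real assume e: "0 < \<epsilon>"
      define z where "z = \<epsilon> / (1 + \<epsilon>)"
      have z: "0 < z" "z < 1" "z / (1 - z) = \<epsilon>" using e by (auto simp: z_def field_simps)
      have *: "\<bar>T x ^ Suc (Suc m) - T x ^ Suc (Suc m) / (1 - z * T x)\<bar> \<le> \<epsilon>" if "0 \<le> D x" for x
      proof -
        note t = T_bounds[OF that]
        have p: "1 - z * T x > 0" using zT[OF that] z by simp
        have "T x ^ Suc (Suc m) / (1 - z * T x) - T x ^ Suc (Suc m) = T x ^ Suc (Suc (Suc m)) * (z / (1 - z * T x))"
          using p by (simp add: field_simps)
        moreover have "0 \<le> T x ^ Suc (Suc (Suc m)) * (z / (1 - z * T x))"
          using t z p by (intro mult_nonneg_nonneg) auto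
        moreover have "T x ^ Suc (Suc (Suc m)) * (z / (1 - z * T x)) \<le> 1 * (z / (1 - z))"
          using t z p by (intro mult_mono power_le_one divide_left_mono mult_pos_pos) (auto simp: mult_left_le)
        ultimately show ?thesis using z(3) by simp
      qed
      show "\<exists>h'. quad_conv h' \<and> (\<forall>n. \<forall>k\<le>n. \<bar>T (nd n k) ^ Suc (Suc m) - h' (nd n k)\<bar> \<le> \<epsilon>) \<and>
          (AE x in M. \<bar>T (g x) ^ Suc (Suc m) - h' (g x)\<bar> \<le> \<epsilon>)"
      proof (intro exI[of _ "\<lambda>x. T x ^ Suc (Suc m) / (1 - z * T x)"] conjI allI impI)
        show "AE x in M. \<bar>T (g x) ^ Suc (Suc m) - T (g x) ^ Suc (Suc m) / (1 - z * T (g x))\<bar> \<le> \<epsilon>"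
          using D_g by eventually_elim (rule *)
      qed (use pos[OF z(1,2)] * D_nd[THEN less_imp_le] in auto)
    qed measurable
    then show ?thesis using True by simp
  qed
qed

lemma quad_conv_T_power: "quad_conv (\<lambda>x. T x ^ m)"
  using quad_conv_T_power_aux[of 0 "m - 1"] by (cases m) auto

lemma quad_conv_continuous:
  assumes q: "continuous_on {0..1} q" and m [measurable]: "q \<in> borel_measurable borel"
  shows "quad_conv (\<lambda>x. q (T x))"
proof (rule quad_conv_uniform_limit)
  fix \<epsilon> :: real assume e: "0 < \<epsilon>"
  obtain r where r: "real_polynomial_function r" "\<And>t. t \<in> {0..1} \<Longrightarrow> \<bar>q t - r t\<bar> < \<epsilon>"
    using Stone_Weierstrass_real_polynomial_function[OF compact_Icc q e] by blast
  then obtain a N where a: "r = (\<lambda>t. \<Sum>i\<le>N. a i * t ^ i)"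
    using real_polynomial_function_iff_sum by blast
  have *: "\<bar>q (T x) - r (T x)\<bar> \<le> \<epsilon>" if "0 \<le> D x" for x
    using r(2)[of "T x"] T_bounds[OF that] by simp
  show "\<exists>h'. quad_conv h' \<and> (\<forall>n. \<forall>k\<le>n. \<bar>q (T (nd n k)) - h' (nd n k)\<bar> \<le> \<epsilon>) \<and>
      (AE x in M. \<bar>q (T (g x)) - h' (g x)\<bar> \<le> \<epsilon>)"
  proof (intro exI[of _ "\<lambda>x. r (T x)"] conjI allI impI)
    show "quad_conv (\<lambda>x. r (T x))" unfolding a by (intro quad_conv_sum quad_conv_cmult quad_conv_T_power)
    show "AE x in M. \<bar>q (T (g x)) - r (T (g x))\<bar> \<le> \<epsilon>" using D_g by eventually_elim (rule *)
  qed (use * D_nd[THEN less_imp_le] in auto)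
qed measurable

text \<open>Both indicator functions are squeezed between the same two continuous ramps. When the ramps get steeper, the
  integral of their difference tends to the probability that \<open>g\<close> lies on the boundary, which is zero.\<close>

lemma quad_conv_half_line:
  assumes y: "0 < y" and no_atom: "AE x in M. D (g x) \<noteq> y"
  shows "quad_conv (\<lambda>x. of_bool (D x < y))" and "quad_conv (\<lambda>x. of_bool (D x \<le> y))"
proof -
  define \<tau> where "\<tau> = 1 / (1 + y)"
  define lo where "lo \<delta> t = max 0 (min 1 ((t - \<tau>) / \<delta>))" for \<delta> t :: real
  define hi where "hi \<delta> t = max 0 (min 1 ((t - \<tau>) / \<delta> + 1))" for \<delta> t :: real
  have lt: "D x < y \<longleftrightarrow> \<tau> < T x" and le: "D x \<le> y \<longleftrightarrow> \<tau> \<le> T x" if "0 \<le> D x" for x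
    using that y by (auto simp: \<tau>_def T_def divide_less_cancel frac_less2 frac_le_eq divide_simps)
  have cont: "continuous_on {0..1} (lo \<delta>)" "continuous_on {0..1} (hi \<delta>)" if "\<delta> > 0" for \<delta>
    unfolding lo_def hi_def using that by (auto intro!: continuous_intros)
  have meas [measurable]: "lo \<delta> \<in> borel_measurable borel" "hi \<delta> \<in> borel_measurable borel" for \<delta>
    unfolding lo_def hi_def by measurable
  have lo_le: "lo \<delta> t \<le> of_bool (\<tau> < t)" if "\<delta> > 0" for \<delta> t
    using that by (auto simp: lo_def divide_simps)
  have hi_ge: "of_bool (\<tau> \<le> t) \<le> hi \<delta> t" if "\<delta> > 0" for \<delta> t
    using that by (auto simp: hi_def divide_simps)
  have conv: "quad_conv (\<lambda>x. lo \<delta> (T x))" "quad_conv (\<lambda>x. hi \<delta> (T x))" if "\<delta> > 0" for \<delta>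
    using cont[OF that] by (auto intro: quad_conv_continuous)
  have lim0: "(\<lambda>m. hi (1 / Suc m) t - lo (1 / Suc m) t) \<longlonglongrightarrow> 0" if "t \<noteq> \<tau>" for t
  proof -
    have *: "eventually (\<lambda>m. 1 \<le> \<bar>t - \<tau>\<bar> * Suc m) sequentially"
    proof -
      obtain m0 where "1 / \<bar>t - \<tau>\<bar> < real m0" using reals_Archimedean2 by blast
      then have "1 < real m0 * \<bar>t - \<tau>\<bar>" using that by (simp add: pos_divide_less_eq)
      moreover have "real m0 * \<bar>t - \<tau>\<bar> \<le> \<bar>t - \<tau>\<bar> * Suc m" if "m0 \<le> m" for m
        using that by (subst mult.commute) (intro mult_left_mono, auto)
      ultimately show ?thesis by (intro eventually_sequentiallyI[of m0]) force
    qed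
    have "eventually (\<lambda>m. hi (1 / Suc m) t - lo (1 / Suc m) t = 0) sequentially"
      using *
    proof eventually_elim
      case (elim m)
      show ?case
      proof (cases "t > \<tau>")
        case True
        then have "1 \<le> (t - \<tau>) * real (Suc m)" using elim by simp
        then show ?thesis by (simp add: hi_def lo_def)
      next
        case False
        then have "(t - \<tau>) * real (Suc m) \<le> -1" using elim that by (simp add: abs_if algebra_simps split: if_splits)
        then show ?thesis by (simp add: hi_def lo_def)
      qed
    qed
    then show ?thesis by (rule tendsto_eventually)
  qed
  have "(\<lambda>m. LINT x|M. hi (1 / Suc m) (T (g x)) - lo (1 / Suc m) (T (g x))) \<longlonglongrightarrow> (LINT x|M. 0)"
  proof (rule integral_dominated_convergence[where w = "\<lambda>_. 1"])
    show "AE x in M. (\<lambda>m. hi (1 / Suc m) (T (g x)) - lo (1 / Suc m) (T (g x))) \<longlonglongrightarrow> 0"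
      using no_atom D_g
    proof eventually_elim
      case (elim x)
      then have "T (g x) \<noteq> \<tau>" using y by (auto simp: T_def \<tau>_def)
      then show ?case by (rule lim0)
    qed
    show "AE x in M. norm (hi (1 / Suc m) (T (g x)) - lo (1 / Suc m) (T (g x))) \<le> 1" for m
      by (intro AE_I2) (auto simp: hi_def lo_def)
  qed auto
  then have width: "\<exists>m. (LINT x|M. hi (1 / Suc m) (T (g x)) - lo (1 / Suc m) (T (g x))) \<le> \<epsilon>" if "\<epsilon> > 0" for \<epsilon>
    using that order_tendstoD(2)[of _ 0 sequentially \<epsilon>] by (force simp: eventually_sequentially intro: less_imp_le)
  have between: "lo \<delta> (T x) \<le> of_bool (D x < y) \<and> of_bool (D x < y) \<le> hi \<delta> (T x)"
      "lo \<delta> (T x) \<le> of_bool (D x \<le> y) \<and> of_bool (D x \<le> y) \<le> hi \<delta> (T x)" if "\<delta> > 0" "0 \<le> D x" for \<delta> x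
    using lo_le[OF that(1), of "T x"] hi_ge[OF that(1), of "T x"] lt[OF that(2)] le[OF that(2)]
    by (auto intro: order_trans simp: of_bool_def split: if_splits)
  have *: "quad_conv h" if h: "\<And>\<delta> x. \<delta> > 0 \<Longrightarrow> 0 \<le> D x \<Longrightarrow> lo \<delta> (T x) \<le> h x \<and> h x \<le> hi \<delta> (T x)"
    and hm: "(\<lambda>x. h (g x)) \<in> borel_measurable M" for h
  proof (rule quad_conv_squeeze[OF hm])
    fix \<epsilon> :: real assume "0 < \<epsilon>"
    then obtain m where m: "(LINT x|M. hi (1 / Suc m) (T (g x)) - lo (1 / Suc m) (T (g x))) \<le> \<epsilon>"
      using width by blast
    have d: "1 / real (Suc m) > 0" by simp
    show "\<exists>L U. brackets h \<epsilon> L U"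
      unfolding brackets_def
    proof (rule exI[of _ "\<lambda>x. lo (1 / Suc m) (T x)"], rule exI[of _ "\<lambda>x. hi (1 / Suc m) (T x)"], intro conjI)
      show "AE x in M. lo (1 / Suc m) (T (g x)) \<le> h (g x) \<and> h (g x) \<le> hi (1 / Suc m) (T (g x))"
        using D_g by eventually_elim (rule h[OF d])
    qed (use conv[OF d] m h[OF d] D_nd[THEN less_imp_le] in auto)
  qed
  show "quad_conv (\<lambda>x. of_bool (D x < y))" by (rule *[OF between(1)]) (auto, measurable)
  show "quad_conv (\<lambda>x. of_bool (D x \<le> y))" by (rule *[OF between(2)]) (auto, measurable)
qed

lemma quad_conv_interval:
  assumes "\<alpha> < \<beta>" "0 < D \<alpha>" "0 < D \<beta>" "AE x in M. g x \<noteq> \<alpha>" "AE x in M. g x \<noteq> \<beta>"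
  shows "quad_conv (indicator {\<alpha><..\<beta>})"
proof -
  have inj: "D u = D v \<longleftrightarrow> u = v" for u v using sign by (auto simp: D_def)
  have a: "AE x in M. D (g x) \<noteq> D \<alpha>" and b: "AE x in M. D (g x) \<noteq> D \<beta>" using assms inj by auto
  note hl = quad_conv_half_line[OF assms(2) a] quad_conv_half_line[OF assms(3) b]
  have "(indicator {\<alpha><..\<beta>} :: real \<Rightarrow> real) =
    (if \<sigma> = 1 then (\<lambda>x. of_bool (D x < D \<alpha>) - of_bool (D x < D \<beta>))
     else (\<lambda>x. of_bool (D x \<le> D \<beta>) - of_bool (D x \<le> D \<alpha>)))"
    unfolding D_def using sign assms(1) by (auto simp: indicator_def fun_eq_iff)
  then show ?thesis using hl by (auto intro: quad_conv_diff)
qed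

end

section \<open>Negative powers as superpositions of resolvents\<close>

definition powr_kernel :: "real \<Rightarrow> real \<Rightarrow> real \<Rightarrow> real" where
  "powr_kernel p y s = indicator {0<..} s * (s powr (- p) / (s + y))"

lemma powr_kernel_nonneg: "0 \<le> y \<Longrightarrow> 0 \<le> powr_kernel p y s"
  by (auto simp: powr_kernel_def indicator_def)

lemma powr_kernel_measurable [measurable]: "(\<lambda>(y, s). powr_kernel p y s) \<in> borel_measurable (borel \<Otimes>\<^sub>M borel)"
  unfolding powr_kernel_def by measurable

lemma powr_kernel_measurable' [measurable]: "powr_kernel p y \<in> borel_measurable borel"
  unfolding powr_kernel_def by measurable

text \<open>Substituting \<open>s = y u\<close> shows that the integral is \<open>y\<^sup>-\<^sup>p\<close> up to a constant factor, which
  the next two lemmas show to be positive and finite.\<close>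

lemma nn_integral_powr_kernel_scale:
  assumes "0 < y"
  shows "(\<integral>\<^sup>+s. ennreal (powr_kernel p y s) \<partial>lborel)
    = ennreal (y powr (- p)) * (\<integral>\<^sup>+s. ennreal (powr_kernel p 1 s) \<partial>lborel)"
proof -
  have scale: "powr_kernel p y (0 + y * u) = y powr (- p) / y * powr_kernel p 1 u" for u
  proof (cases "0 < u")
    case True
    have "y * u + y = y * (u + 1)" by (simp add: algebra_simps)
    then show ?thesis using True assms by (simp add: powr_kernel_def powr_mult)
  next
    case False
    then have "\<not> 0 < y * u" using assms by (simp add: zero_less_mult_iff)
    then show ?thesis using False by (simp add: powr_kernel_def)
  qed
  have "(\<integral>\<^sup>+s. ennreal (powr_kernel p y s) \<partial>lborel)
      = \<bar>y\<bar> * (\<integral>\<^sup>+u. ennreal (powr_kernel p y (0 + y * u)) \<partial>lborel)"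
    using assms by (intro nn_integral_real_affine) auto
  also have "(\<integral>\<^sup>+u. ennreal (powr_kernel p y (0 + y * u)) \<partial>lborel)
      = ennreal (y powr (- p) / y) * (\<integral>\<^sup>+u. ennreal (powr_kernel p 1 u) \<partial>lborel)"
  proof -
    have "ennreal (powr_kernel p y (0 + y * u)) = ennreal (y powr (- p) / y) * ennreal (powr_kernel p 1 u)" for u
      unfolding scale using assms by (intro ennreal_mult) (auto simp: powr_kernel_nonneg)
    then show ?thesis by (simp only:) (rule nn_integral_cmult, measurable)
  qed
  also have "ennreal \<bar>y\<bar> * (ennreal (y powr (- p) / y) * (\<integral>\<^sup>+u. ennreal (powr_kernel p 1 u) \<partial>lborel))
      = ennreal (y powr (- p)) * (\<integral>\<^sup>+u. ennreal (powr_kernel p 1 u) \<partial>lborel)"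
    using assms by (simp add: mult.assoc[symmetric] ennreal_mult[symmetric])
  finally show ?thesis .
qed

lemma nn_integral_powr_kernel_pos: "0 < (\<integral>\<^sup>+s. ennreal (powr_kernel p 1 s) \<partial>lborel)"
proof (rule ccontr)
  assume "\<not> ?thesis"
  then have "(\<integral>\<^sup>+s. ennreal (powr_kernel p 1 s) \<partial>lborel) = 0" by simp
  then have "AE s in lborel. ennreal (powr_kernel p 1 s) = 0"
    by (subst (asm) nn_integral_0_iff_AE) auto
  then have "AE s in lborel. s \<notin> {1..2::real}"
  proof eventually_elim
    case (elim s)
    show ?case
    proof
      assume "s \<in> {1..2}"
      then have "0 < powr_kernel p 1 s" by (simp add: powr_kernel_def)
      then show False using elim by simp
    qed
  qed
  then have "emeasure lborel {1..2::real} = 0"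
    by (subst (asm) AE_iff_measurable[of "{1..2}"]) auto
  then show False by simp
qed

lemma nn_integral_powr_kernel_finite:
  assumes p: "0 < p" "p < 1"
  shows "(\<integral>\<^sup>+s. ennreal (powr_kernel p 1 s) \<partial>lborel) < \<infinity>"
proof -
  have 1: "(\<integral>\<^sup>+s. ennreal (s powr (- p)) * indicator {0..1} s \<partial>lborel) = ennreal (1 / (1 - p))"
    using nn_integral_has_integral_lebesgue'[OF _ has_integral_powr_from_0[of "- p" 1]] p by simp
  have 2: "(\<integral>\<^sup>+s. ennreal (s powr (- p - 1)) * indicator {1..} s \<partial>lborel) = ennreal (0 - (- (1 powr (- p)) / p))"
  proof (rule nn_integral_FTC_atLeast)
    show "DERIV (\<lambda>s. - (s powr (- p)) / p) s :> s powr (- p - 1)" if "1 \<le> s" for s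
      using that p by (auto intro!: derivative_eq_intros)
    have "((\<lambda>s::real. s powr (- p)) \<longlongrightarrow> 0) at_top"
      using p tendsto_neg_powr[of "- p" "\<lambda>x. x" at_top] by (simp add: filterlim_ident)
    from tendsto_divide[OF tendsto_minus[OF this] tendsto_const[of p]]
    show "((\<lambda>s::real. - (s powr (- p)) / p) \<longlongrightarrow> 0) at_top" using p by simp
  qed auto
  have "(\<integral>\<^sup>+s. ennreal (powr_kernel p 1 s) \<partial>lborel)
      \<le> (\<integral>\<^sup>+s. ennreal (s powr (- p)) * indicator {0..1} s + ennreal (s powr (- p - 1)) * indicator {1..} s \<partial>lborel)"
  proof (rule nn_integral_mono)
    fix s :: real
    have "s powr (- p) / (s + 1) \<le> s powr (- p)" if "0 < s"
      using that by (simp add: divide_le_eq)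
    moreover have "s powr (- p) / (s + 1) \<le> s powr (- p - 1)" if "1 \<le> s"
      using that by (simp add: powr_diff frac_le)
    ultimately show "ennreal (powr_kernel p 1 s) \<le>
        ennreal (s powr (- p)) * indicator {0..1} s + ennreal (s powr (- p - 1)) * indicator {1..} s"
      by (cases "1 \<le> s") (auto simp: powr_kernel_def indicator_def ennreal_leI add_increasing)
  qed
  also have "\<dots> = ennreal (1 / (1 - p)) + ennreal (0 - (- (1 powr (- p)) / p))"
    by (subst nn_integral_add) (auto simp: 1 2)
  also have "\<dots> < \<infinity>" by simp
  finally show ?thesis .
qed

context one_sided_quadrature
begin

text \<open>The bound for resolvents carries over to \<open>\<bar>x - c\<bar>\<^sup>-\<^sup>p\<close>: for \<open>p = 1\<close> let \<open>s\<close> tend to \<open>0\<close>; for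
  \<open>p < 1\<close> integrate the bounds with respect to \<open>s\<close>, with weight \<open>s\<^sup>-\<^sup>p\<close>.\<close>

lemma quad_powr_le:
  assumes p: "0 < p" "p \<le> 1" and no_atom: "AE x in M. D (g x) \<noteq> 0"
    and int: "integrable M (\<lambda>x. D (g x) powr (- p))"
  shows "quad n (\<lambda>x. D x powr (- p)) \<le> (LINT x|M. D (g x) powr (- p))"
proof -
  have D_pos: "AE x in M. 0 < D (g x)" using no_atom D_g by eventually_elim simp
  have res: "quad n (\<lambda>x. 1 / (s + D x)) \<le> (LINT x|M. 1 / (s + D (g x)))" if "0 < s" for s
    using resolvent_le[OF that, of n] by (simp add: D_def)
  have res_int: "integrable M (\<lambda>x. 1 / (s + D (g x)))" if "0 < s" for s
    using quad_conv_integrable[OF resolvent_conv[OF that]] by (simp add: D_def)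
  show ?thesis
  proof (cases "p = 1")
    case True
    have "(\<lambda>m. quad n (\<lambda>x. 1 / (inverse (real (Suc m)) + D x))) \<longlonglongrightarrow> quad n (\<lambda>x. 1 / (0 + D x))"
      unfolding quad_def
    proof (intro tendsto_intros LIMSEQ_inverse_real_of_nat)
      fix k assume "k \<in> {..n}"
      then show "0 + D (nd n k) \<noteq> 0" using D_nd[of k n] by simp
    qed
    moreover have "quad n (\<lambda>x. 1 / (inverse (real (Suc m)) + D x)) \<le> (LINT x|M. D (g x) powr (- p))" for m
    proof -
      have s: "0 < inverse (real (Suc m))" by simp
      have "(LINT x|M. 1 / (inverse (real (Suc m)) + D (g x))) \<le> (LINT x|M. D (g x) powr (- p))"
      proof (rule integral_mono_AE[OF res_int[OF s] int])
        show "AE x in M. 1 / (inverse (real (Suc m)) + D (g x)) \<le> D (g x) powr (- p)"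
          using D_pos
        proof eventually_elim
          case (elim x)
          then have "1 / (inverse (real (Suc m)) + D (g x)) \<le> 1 / D (g x)"
            by (intro divide_left_mono mult_pos_pos) (auto intro: add_pos_pos)
          then show ?case using elim True by (simp add: powr_minus_divide)
        qed
      qed
      then show ?thesis using res[OF s] by linarith
    qed
    ultimately have "quad n (\<lambda>x. 1 / (0 + D x)) \<le> (LINT x|M. D (g x) powr (- p))"
      by (intro LIMSEQ_le_const2) auto
    moreover have "quad n (\<lambda>x. D x powr (- p)) = quad n (\<lambda>x. 1 / (0 + D x))"
      using D_nd True by (intro quad_cong) (simp add: powr_minus_divide abs_of_pos)
    ultimately show ?thesis by simp
  next
    case False
    with p have p1: "0 < p" "p < 1" by auto
    define K where "K = (\<integral>\<^sup>+s. ennreal (powr_kernel p 1 s) \<partial>lborel)"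
    have K: "K \<noteq> 0" "K \<noteq> \<infinity>"
      using nn_integral_powr_kernel_pos[of p] nn_integral_powr_kernel_finite[OF p1] by (auto simp: K_def)
    have scale: "(\<integral>\<^sup>+s. ennreal (powr_kernel p y s) \<partial>lborel) = ennreal (y powr (- p)) * K" if "0 < y" for y
      unfolding K_def using that by (rule nn_integral_powr_kernel_scale)
    have kernel: "powr_kernel p y s = indicator {0<..} s * s powr (- p) * (1 / (s + y))" for y s
      by (simp add: powr_kernel_def)
    interpret lb: pair_sigma_finite M lborel
      by (simp add: pair_sigma_finite_def sigma_finite_lborel sigma_finite_measure_axioms)
    have "ennreal (quad n (\<lambda>x. D x powr (- p))) * K
        = (\<Sum>k\<le>n. ennreal (wt n k) * (ennreal (D (nd n k) powr (- p)) * K))"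
      unfolding quad_def
      by (subst sum_ennreal[symmetric]) (auto simp: wt_nonneg ennreal_mult sum_distrib_right mult.assoc)
    also have "\<dots> = (\<Sum>k\<le>n. ennreal (wt n k) * (\<integral>\<^sup>+s. ennreal (powr_kernel p (D (nd n k)) s) \<partial>lborel))"
      using D_nd by (intro sum.cong refl) (simp add: scale)
    also have "\<dots> = (\<integral>\<^sup>+s. (\<Sum>k\<le>n. ennreal (wt n k) * ennreal (powr_kernel p (D (nd n k)) s)) \<partial>lborel)"
      by (simp add: nn_integral_sum nn_integral_cmult)
    also have "\<dots> \<le> (\<integral>\<^sup>+s. (\<integral>\<^sup>+x. ennreal (powr_kernel p (D (g x)) s) \<partial>M) \<partial>lborel)"
    proof (rule nn_integral_mono)
      fix s :: real
      show "(\<Sum>k\<le>n. ennreal (wt n k) * ennreal (powr_kernel p (D (nd n k)) s))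
          \<le> (\<integral>\<^sup>+x. ennreal (powr_kernel p (D (g x)) s) \<partial>M)"
      proof (cases "0 < s")
        case True
        have "(\<Sum>k\<le>n. ennreal (wt n k) * ennreal (powr_kernel p (D (nd n k)) s))
            = (\<Sum>k\<le>n. ennreal (wt n k * powr_kernel p (D (nd n k)) s))"
          using D_nd by (intro sum.cong refl) (simp add: ennreal_mult wt_nonneg powr_kernel_nonneg less_imp_le)
        also have "\<dots> = ennreal (\<Sum>k\<le>n. wt n k * powr_kernel p (D (nd n k)) s)"
          using D_nd by (intro sum_ennreal) (simp add: wt_nonneg powr_kernel_nonneg less_imp_le)
        also have "(\<Sum>k\<le>n. wt n k * powr_kernel p (D (nd n k)) s) = s powr (- p) * quad n (\<lambda>x. 1 / (s + D x))"
          using True by (simp add: kernel quad_def sum_distrib_left mult_ac)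
        also have "ennreal \<dots> \<le> ennreal (s powr (- p) * (LINT x|M. 1 / (s + D (g x))))"
          using res[OF True] by (intro ennreal_leI mult_left_mono) auto
        also have "s powr (- p) * (LINT x|M. 1 / (s + D (g x))) = (LINT x|M. powr_kernel p (D (g x)) s)"
          unfolding integral_mult_right_zero[symmetric] using True by (simp add: kernel)
        also have "ennreal \<dots> = (\<integral>\<^sup>+x. ennreal (powr_kernel p (D (g x)) s) \<partial>M)"
        proof (rule nn_integral_eq_integral[symmetric])
          show "integrable M (\<lambda>x. powr_kernel p (D (g x)) s)" 
            using True integrable_mult_right[OF res_int[OF True], of "s powr (- p)"] by (simp add: kernel)
          show "AE x in M. 0 \<le> powr_kernel p (D (g x)) s" using D_g by eventually_elim (rule powr_kernel_nonneg)
        qed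
        finally show ?thesis .
      next
        case False
        then show ?thesis by (simp add: powr_kernel_def)
      qed
    qed
    also have "\<dots> = (\<integral>\<^sup>+x. (\<integral>\<^sup>+s. ennreal (powr_kernel p (D (g x)) s) \<partial>lborel) \<partial>M)"
      by (rule lb.Fubini') measurable
    also have "\<dots> = (\<integral>\<^sup>+x. ennreal (D (g x) powr (- p)) * K \<partial>M)"
      by (rule nn_integral_cong_AE) (use D_pos in eventually_elim, simp add: scale)
    also have "\<dots> = (\<integral>\<^sup>+x. ennreal (D (g x) powr (- p)) \<partial>M) * K"
      by (rule nn_integral_multc) measurable
    also have "(\<integral>\<^sup>+x. ennreal (D (g x) powr (- p)) \<partial>M) = ennreal (LINT x|M. D (g x) powr (- p))"
      by (rule nn_integral_eq_integral[OF int]) simp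
    finally have "ennreal (quad n (\<lambda>x. D x powr (- p))) * K \<le> ennreal (LINT x|M. D (g x) powr (- p)) * K" .
    then have "ennreal (quad n (\<lambda>x. D x powr (- p))) \<le> ennreal (LINT x|M. D (g x) powr (- p))"
      using K by (simp add: ennreal_mult_le_mult_iff mult.commute[of _ K] top.not_eq_extremum)
    then show ?thesis by (subst (asm) ennreal_le_iff) (auto intro: integral_nonneg)
  qed
qed

lemma quad_conv_shifted_powr:
  assumes s: "0 < s" and p: "0 < p"
  shows "quad_conv (\<lambda>x. (s + D x) powr (- p))"
proof -
  define q where "q t = (t / (1 - (1 - s) * t)) powr p" for t :: real
  have pos: "0 < 1 - (1 - s) * t" if "t \<in> {0..1}" for t
  proof -
    have "0 < (1 - t) + s * t" using that s by (cases "t = 1") (auto intro: add_pos_nonneg)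
    then show ?thesis by (simp add: algebra_simps)
  qed
  have "continuous_on {0..1} q"
    unfolding q_def using pos p
    by (intro continuous_on_powr' continuous_intros) (auto simp: less_imp_le less_imp_neq[THEN not_sym] divide_nonneg_pos)
  moreover have [measurable]: "q \<in> borel_measurable borel" unfolding q_def by measurable
  ultimately have conv: "quad_conv (\<lambda>x. q (T x))" by (rule quad_conv_continuous)
  have *: "q (T x) = (s + D x) powr (- p)" if "0 \<le> D x" for x
  proof -
    have "1 - (1 - s) * T x = (s + D x) * T x" using that by (simp add: T_def field_simps)
    then have "T x / (1 - (1 - s) * T x) = 1 / (s + D x)" using T_bounds[OF that] by simp
    then show ?thesis using that s by (simp add: q_def powr_minus powr_divide inverse_eq_divide)
  qed
  show ?thesis
  proof (rule quad_conv_cong[OF conv])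
    show "AE x in M. q (T (g x)) = (s + D (g x)) powr (- p)" using D_g by eventually_elim (rule *)
  qed (use * D_nd[THEN less_imp_le] in auto)
qed

text \<open>For the function \<open>\<bar>x - c\<bar>\<^sup>-\<^sup>p\<close> the limit of the quadratures is at least the integral since this holds for the
  smaller functions \<open>(s + \<bar>x - c\<bar>)\<^sup>-\<^sup>p\<close>, and at most the integral by the inequality above.\<close>

lemma quad_conv_powr:
  assumes p: "0 < p" "p \<le> 1" and no_atom: "AE x in M. D (g x) \<noteq> 0"
    and int: "integrable M (\<lambda>x. D (g x) powr (- p))"
  shows "quad_conv (\<lambda>x. D x powr (- p))"
    and "(\<lambda>m. LINT x|M. D (g x) powr (- p) - (inverse (real (Suc m)) + D (g x)) powr (- p)) \<longlonglongrightarrow> 0"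
proof -
  let ?s = "\<lambda>m. inverse (real (Suc m))" and ?I = "LINT x|M. D (g x) powr (- p)"
  have D_pos: "AE x in M. 0 < D (g x)" using no_atom D_g by eventually_elim simp
  have shift_le: "(s + D x) powr (- p) \<le> D x powr (- p)" if "0 < D x" "0 < s" for x s
    using that p by (intro powr_mono2') auto
  have si: "integrable M (\<lambda>x. (?s m + D (g x)) powr (- p))" for m
    by (rule quad_conv_integrable[OF quad_conv_shifted_powr]) (use p in auto)
  have "(\<lambda>m. LINT x|M. (?s m + D (g x)) powr (- p)) \<longlonglongrightarrow> ?I"
  proof (rule integral_dominated_convergence[OF _ _ int])
    show "AE x in M. (\<lambda>m. (?s m + D (g x)) powr (- p)) \<longlonglongrightarrow> D (g x) powr (- p)"
      using D_pos
    proof eventually_elim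
      case (elim x)
      have "(\<lambda>m. (?s m + D (g x)) powr (- p)) \<longlonglongrightarrow> (0 + D (g x)) powr (- p)"
        using elim by (intro tendsto_intros LIMSEQ_inverse_real_of_nat) auto
      then show ?case by simp
    qed
    show "AE x in M. norm ((?s m + D (g x)) powr (- p)) \<le> D (g x) powr (- p)" for m
      using D_pos by eventually_elim (use shift_le[where s = "?s m"] in simp)
  qed measurable
  then show "(\<lambda>m. LINT x|M. D (g x) powr (- p) - (?s m + D (g x)) powr (- p)) \<longlonglongrightarrow> 0"
    using int si by (simp add: Bochner_Integration.integral_diff LIM_zero_iff tendsto_minus_cancel_left
        tendsto_diff[OF tendsto_const, of _ ?I sequentially ?I, simplified])
  have "(\<lambda>n. quad n (\<lambda>x. D x powr (- p))) \<longlonglongrightarrow> ?I"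
  proof (rule LIMSEQ_I)
    fix \<epsilon> :: real assume e: "0 < \<epsilon>"
    from order_tendstoD(1)[OF \<open>(\<lambda>m. LINT x|M. (?s m + D (g x)) powr (- p)) \<longlonglongrightarrow> ?I\<close>, of "?I - \<epsilon>"] e
    obtain m where m: "?I - \<epsilon> < (LINT x|M. (?s m + D (g x)) powr (- p))"
      by (auto simp: eventually_sequentially)
    have "\<forall>\<^sub>F n in sequentially. ?I - \<epsilon> < quad n (\<lambda>x. (?s m + D x) powr (- p))"
      by (rule order_tendstoD(1)[OF quad_conv_tendsto[OF quad_conv_shifted_powr] m]) (use p in auto)
    then have "\<forall>\<^sub>F n in sequentially. norm (quad n (\<lambda>x. D x powr (- p)) - ?I) < \<epsilon>"
    proof eventually_elim
      case (elim n)
      have "quad n (\<lambda>x. (?s m + D x) powr (- p)) \<le> quad n (\<lambda>x. D x powr (- p))"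
        using D_nd by (intro quad_mono shift_le) auto
      then have "?I - \<epsilon> < quad n (\<lambda>x. D x powr (- p))" using elim by linarith
      moreover have "quad n (\<lambda>x. D x powr (- p)) < ?I + \<epsilon>"
        using quad_powr_le[OF p no_atom int, of n] e by linarith
      ultimately show ?case by (simp add: abs_less_iff)
    qed
    then show "\<exists>N. \<forall>n\<ge>N. norm (quad n (\<lambda>x. D x powr (- p)) - ?I) < \<epsilon>"
      by (simp add: eventually_sequentially)
  qed
  then show "quad_conv (\<lambda>x. D x powr (- p))" using int by (simp add: quad_conv_def)
qed

section \<open>Functions that are controlled away from \<open>c\<close>\<close>

text \<open>Only endpoints of probability zero are allowed, because the quadrature rules need not converge for the
  indicator function of an interval that ends in an atom.\<close>

definition squeezed_on_intervals :: "(real \<Rightarrow> real) \<Rightarrow> bool" where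
  "squeezed_on_intervals f \<longleftrightarrow> (\<forall>\<alpha> \<beta> \<epsilon>. 0 < \<epsilon> \<longrightarrow> \<alpha> < \<beta> \<longrightarrow> 0 < D \<alpha> \<longrightarrow> 0 < D \<beta> \<longrightarrow>
      (AE x in M. g x \<noteq> \<alpha>) \<longrightarrow> (AE x in M. g x \<noteq> \<beta>) \<longrightarrow>
      (\<exists>L U. quad_conv L \<and> quad_conv U \<and> (\<forall>x\<in>{\<alpha><..\<beta>}. L x \<le> f x \<and> f x \<le> U x) \<and>
        (\<forall>x. x \<notin> {\<alpha><..\<beta>} \<longrightarrow> L x = 0 \<and> U x = 0) \<and> (LINT x|M. U (g x) - L (g x)) \<le> \<epsilon>))"

lemma squeezed_on_intervalsD:
  assumes "squeezed_on_intervals f" "0 < \<epsilon>" "\<alpha> < \<beta>" "0 < D \<alpha>" "0 < D \<beta>"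
    "AE x in M. g x \<noteq> \<alpha>" "AE x in M. g x \<noteq> \<beta>"
  shows "\<exists>L U. quad_conv L \<and> quad_conv U \<and> (\<forall>x\<in>{\<alpha><..\<beta>}. L x \<le> f x \<and> f x \<le> U x) \<and>
        (\<forall>x. x \<notin> {\<alpha><..\<beta>} \<longrightarrow> L x = 0 \<and> U x = 0) \<and> (LINT x|M. U (g x) - L (g x)) \<le> \<epsilon>"
  using assms unfolding squeezed_on_intervals_def by blast

text \<open>The half-line on the side of \<open>g\<close> splits into a small neighbourhood of \<open>c\<close>, a half-open interval with
  endpoints of probability zero, and a remainder of small probability.\<close>

lemma exhausting_interval:
  assumes \<delta>: "0 < \<delta>" and \<eta>: "0 < \<eta>"
  obtains \<alpha> \<beta> near where "\<alpha> < \<beta>" "0 < D \<alpha>" "0 < D \<beta>" "AE x in M. g x \<noteq> \<alpha>" "AE x in M. g x \<noteq> \<beta>"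
    "quad_conv near" "\<And>x. near x = 0 \<or> near x = (1::real)"
    "\<And>x. 0 \<le> D x \<Longrightarrow> near x + indicator {\<alpha><..\<beta>} x \<le> 1"
    "\<And>x. near x = 1 \<Longrightarrow> D x < \<delta>"
    "(LINT x|M. 1 - indicator {\<alpha><..\<beta>} (g x) - near (g x)) \<le> \<eta>"
proof -
  have D_inv: "D (c - \<sigma> * y) = y" for y using sign by (auto simp: D_def)
  have inj: "D u = D v \<longleftrightarrow> u = v" for u v using sign by (auto simp: D_def)
  have non_atom: "\<exists>y\<in>{u<..<v}. AE x in M. g x \<noteq> c - \<sigma> * y" if uv: "u < v" for u v
  proof (cases "\<sigma> = 1")
    case True
    then show ?thesis using exists_non_atom[of "c - v" "c - u"] uv
      by (auto intro!: bexI[of _ "c - _"])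
  next
    case False
    then have "\<sigma> = -1" using sign by simp
    then show ?thesis using exists_non_atom[of "c + u" "c + v"] uv
      by (auto intro!: bexI[of _ "_ - c"])
  qed
  obtain r where r: "0 < r" "r < \<delta>" and ra: "AE x in M. g x \<noteq> c - \<sigma> * r" using non_atom[OF \<delta>] by auto
  have "(\<lambda>m. LINT x|M. of_bool (real m \<le> D (g x))) \<longlonglongrightarrow> (LINT x|M. (0::real))"
  proof (rule integral_dominated_convergence[where w = "\<lambda>_. 1"])
    show "AE x in M. (\<lambda>m. of_bool (real m \<le> D (g x)) :: real) \<longlonglongrightarrow> 0"
    proof (rule AE_I2)
      fix x
      obtain m0 where "D (g x) < real m0" using reals_Archimedean2 by blast
      then have "\<forall>\<^sub>F m in sequentially. (of_bool (real m \<le> D (g x)) :: real) = 0"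
        by (intro eventually_sequentiallyI[of m0]) (auto simp: of_bool_def)
      then show "(\<lambda>m. of_bool (real m \<le> D (g x)) :: real) \<longlonglongrightarrow> 0" by (rule tendsto_eventually)
    qed
  qed auto
  then have "\<forall>\<^sub>F m in sequentially. (LINT x|M. of_bool (real m \<le> D (g x))) < \<eta>"
    using \<eta> by (simp add: order_tendstoD(2))
  then obtain m where m: "(LINT x|M. of_bool (real m \<le> D (g x))) < \<eta>"
    by (auto simp: eventually_sequentially)
  obtain R where R: "max (real m) \<delta> < R" and Ra: "AE x in M. g x \<noteq> c - \<sigma> * R"
    using non_atom[of "max (real m) \<delta>" "max (real m) \<delta> + 1"] by auto
  have rR: "r < R" "real m < R" using r R by auto
  define \<alpha> where "\<alpha> = (if \<sigma> = 1 then c - R else c + r)"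
  define \<beta> where "\<beta> = (if \<sigma> = 1 then c - r else c + R)"
  define near :: "real \<Rightarrow> real" where "near x = (if \<sigma> = 1 then of_bool (D x < r) else of_bool (D x \<le> r))" for x
  have ra': "AE x in M. D (g x) \<noteq> r"
    using ra by eventually_elim (metis D_inv inj)
  have near_conv: "quad_conv near"
    using quad_conv_half_line[OF r(1) ra'] by (cases "\<sigma> = 1") (auto simp: near_def[abs_def])
  show ?thesis
  proof (rule that[of \<alpha> \<beta> near])
    show "\<alpha> < \<beta>" "0 < D \<alpha>" "0 < D \<beta>" using r rR sign by (auto simp: \<alpha>_def \<beta>_def D_def)
    show "AE x in M. g x \<noteq> \<alpha>" "AE x in M. g x \<noteq> \<beta>" using ra Ra sign by (auto simp: \<alpha>_def \<beta>_def)
    show "quad_conv near" by (rule near_conv)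
    show "near x = 0 \<or> near x = 1" for x by (simp add: near_def)
    show "near x + indicator {\<alpha><..\<beta>} x \<le> 1" if "0 \<le> D x" for x
      using sign unfolding near_def \<alpha>_def \<beta>_def D_def by (auto simp: indicator_def)
    show "D x < \<delta>" if "near x = 1" for x using that r by (auto simp: near_def split: if_splits)
    have far: "1 - indicator {\<alpha><..\<beta>} x - near x \<le> of_bool (real m \<le> D x)" if "0 \<le> D x" for x
      using that sign rR unfolding near_def \<alpha>_def \<beta>_def D_def by (auto simp: indicator_def)
    have [measurable]: "(\<lambda>x. near (g x)) \<in> borel_measurable M"
      using quad_conv_integrable[OF near_conv] by simp
    have ni: "integrable M (\<lambda>x. near (g x))" by (rule quad_conv_integrable[OF near_conv])
    have "(LINT x|M. 1 - indicator {\<alpha><..\<beta>} (g x) - near (g x)) \<le> (LINT x|M. of_bool (real m \<le> D (g x)))"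
    proof (rule integral_mono_AE)
      show "integrable M (\<lambda>x. 1 - indicator {\<alpha><..\<beta>} (g x) - near (g x))"
        by (intro Bochner_Integration.integrable_diff ni integrable_const_bound[where B = 1])
          (auto simp: indicator_def)
      show "integrable M (\<lambda>x. of_bool (real m \<le> D (g x)) :: real)"
        by (intro integrable_const_bound[where B = 1]) auto
      show "AE x in M. 1 - indicator {\<alpha><..\<beta>} (g x) - near (g x) \<le> of_bool (real m \<le> D (g x))"
        using D_g by eventually_elim (rule far)
    qed
    then show "(LINT x|M. 1 - indicator {\<alpha><..\<beta>} (g x) - near (g x)) \<le> \<eta>" using m by linarith
  qed
qed

text \<open>Inside an interval, \<open>f\<close> is squeezed by assumption; outside, it differs from the constant \<open>\<kappa>\<close> at most by a function \<open>V\<close>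
  of small integral. The set \<open>S\<close> contains the points that matter: the nodes and almost all values of \<open>g\<close>.\<close>

theorem quad_squeeze_from_intervals:
  assumes S: "\<And>n k. k \<le> n \<Longrightarrow> nd n k \<in> S" "AE x in M. g x \<in> S"
    and inner: "squeezed_on_intervals f"
    and outer: "\<And>\<epsilon>. 0 < \<epsilon> \<Longrightarrow> \<exists>\<alpha> \<beta> V. \<alpha> < \<beta> \<and> 0 < D \<alpha> \<and> 0 < D \<beta> \<and>
      (AE x in M. g x \<noteq> \<alpha>) \<and> (AE x in M. g x \<noteq> \<beta>) \<and> quad_conv V \<and>
      (\<forall>x\<in>S. 0 \<le> V x) \<and> (\<forall>x\<in>S - {\<alpha><..\<beta>}. \<bar>f x - \<kappa>\<bar> \<le> V x) \<and> (LINT x|M. V (g x)) \<le> \<epsilon>"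
  obtains k where "integrable M k" "AE x in M. f (g x) = k x" "(\<lambda>n. quad n f) \<longlonglongrightarrow> (LINT x|M. k x)"
proof (rule quad_squeeze)
  fix \<epsilon> :: real assume e: "0 < \<epsilon>"
  obtain \<alpha> \<beta> V where ab: "\<alpha> < \<beta>" "0 < D \<alpha>" "0 < D \<beta>" "AE x in M. g x \<noteq> \<alpha>" "AE x in M. g x \<noteq> \<beta>"
    and V: "quad_conv V" "\<forall>x\<in>S. 0 \<le> V x" "\<forall>x\<in>S - {\<alpha><..\<beta>}. \<bar>f x - \<kappa>\<bar> \<le> V x" "(LINT x|M. V (g x)) \<le> \<epsilon> / 4"
    using outer[of "\<epsilon> / 4"] e by auto
  obtain L U where LU: "quad_conv L" "quad_conv U" "\<forall>x\<in>{\<alpha><..\<beta>}. L x \<le> f x \<and> f x \<le> U x"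
      "\<forall>x. x \<notin> {\<alpha><..\<beta>} \<longrightarrow> L x = 0 \<and> U x = 0" "(LINT x|M. U (g x) - L (g x)) \<le> \<epsilon> / 2"
    using squeezed_on_intervalsD[OF inner _ ab, of "\<epsilon> / 2"] e by auto
  let ?J = "indicator {\<alpha><..\<beta>} :: real \<Rightarrow> real"
  define L' where "L' x = L x + \<kappa> * (1 - ?J x) - V x" for x
  define U' where "U' x = U x + \<kappa> * (1 - ?J x) + V x" for x
  note J = quad_conv_interval[OF ab]
  have conv: "quad_conv L'" "quad_conv U'"
    unfolding L'_def U'_def
    by (intro quad_conv_add quad_conv_diff quad_conv_cmult quad_conv_const LU V J)+
  have between: "L' x \<le> f x \<and> f x \<le> U' x" if "x \<in> S" for x
  proof (cases "x \<in> {\<alpha><..\<beta>}")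
    case True
    then have "L x \<le> f x" "f x \<le> U x" using LU(3) by auto
    then show ?thesis using True V(2) that unfolding L'_def U'_def by (auto intro: order_trans add_increasing2)
  next
    case False
    then have "\<bar>f x - \<kappa>\<bar> \<le> V x" using V(3) that by auto
    then show ?thesis using False LU(4) unfolding L'_def U'_def by auto
  qed
  have "(LINT x|M. U' (g x) - L' (g x)) = (LINT x|M. (U (g x) - L (g x)) + 2 * V (g x))"
    by (intro Bochner_Integration.integral_cong) (auto simp: L'_def U'_def)
  also have "\<dots> = (LINT x|M. U (g x) - L (g x)) + 2 * (LINT x|M. V (g x))"
    using LU V by (simp add: quad_conv_integrable)
  also have "\<dots> \<le> \<epsilon>" using LU(5) V(4) by (simp add: field_simps)
  finally have width: "(LINT x|M. U' (g x) - L' (g x)) \<le> \<epsilon>" .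
  show "\<exists>L U. brackets f \<epsilon> L U"
    unfolding brackets_def
    by (rule exI[of _ L'], rule exI[of _ U'])
      (use conv between S width in \<open>auto elim!: eventually_mono\<close>)
qed

lemma small_neighbourhood:
  fixes \<eta> :: real
  assumes no_atom: "AE x in M. g x \<noteq> c" and \<eta>: "0 < \<eta>"
  obtains \<delta> where "0 < \<delta>" "(LINT x|M. of_bool (D (g x) < \<delta>)) \<le> \<eta>"
proof -
  have "(\<lambda>m. LINT x|M. of_bool (D (g x) < inverse (real (Suc m)))) \<longlonglongrightarrow> (LINT x|M. (0::real))"
  proof (rule integral_dominated_convergence[where w = "\<lambda>_. 1"])
    show "AE x in M. (\<lambda>m. of_bool (D (g x) < inverse (real (Suc m))) :: real) \<longlonglongrightarrow> 0"
      using no_atom D_g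
    proof eventually_elim
      case (elim x)
      then have "0 < D (g x)" using sign by (auto simp: D_def)
      then have "\<forall>\<^sub>F m in sequentially. inverse (real (Suc m)) < D (g x)"
        by (rule order_tendstoD(2)[OF LIMSEQ_inverse_real_of_nat])
      then have "\<forall>\<^sub>F m in sequentially. (of_bool (D (g x) < inverse (real (Suc m))) :: real) = 0"
        by eventually_elim simp
      then show ?case by (rule tendsto_eventually)
    qed
  qed auto
  then have "\<forall>\<^sub>F m in sequentially. (LINT x|M. of_bool (D (g x) < inverse (real (Suc m)))) < \<eta>"
    using order_tendstoD(2)[of _ "LINT x|M. 0" sequentially \<eta>] \<eta> by simp
  then obtain m where "(LINT x|M. of_bool (D (g x) < inverse (real (Suc m)))) < \<eta>"
    by (auto simp: eventually_sequentially)
  then show ?thesis by (intro that[of "inverse (real (Suc m))"]) auto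
qed

text \<open>If \<open>g \<noteq> c\<close> almost surely, it suffices that \<open>\<bar>f\<bar>\<close> is bounded up to functions \<open>R\<close> of small integral for
  which the quadrature converges.\<close>

theorem quad_tendsto_no_atom:
  assumes no_atom: "AE x in M. g x \<noteq> c"
    and inner: "squeezed_on_intervals f"
    and tail: "\<And>\<epsilon>. 0 < \<epsilon> \<Longrightarrow> \<exists>C R. 0 \<le> C \<and> quad_conv R \<and>
      (\<forall>x. 0 < D x \<longrightarrow> 0 \<le> R x \<and> \<bar>f x\<bar> \<le> C + R x) \<and> (LINT x|M. R (g x)) \<le> \<epsilon>"
  obtains k where "integrable M k" "AE x in M. f (g x) = k x" "(\<lambda>n. quad n f) \<longlonglongrightarrow> (LINT x|M. k x)"
proof (rule quad_squeeze_from_intervals[where S = "{x. 0 < D x}" and \<kappa> = 0, OF _ _ inner])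
  show "AE x in M. g x \<in> {x. 0 < D x}"
    using no_atom D_g by eventually_elim (use sign in \<open>auto simp: D_def\<close>)
next
  fix \<epsilon> :: real assume e: "0 < \<epsilon>"
  obtain C R where C: "0 \<le> C" and R: "quad_conv R" "\<And>x. 0 < D x \<Longrightarrow> 0 \<le> R x \<and> \<bar>f x\<bar> \<le> C + R x"
      "(LINT x|M. R (g x)) \<le> \<epsilon> / 2" using tail[of "\<epsilon> / 2"] e by auto
  define \<eta> where "\<eta> = \<epsilon> / (4 * (C + 1))"
  have \<eta>: "0 < \<eta>" "C * \<eta> \<le> \<epsilon> / 4" using e C by (auto simp: \<eta>_def field_simps)
  obtain \<delta> where \<delta>: "0 < \<delta>" "(LINT x|M. of_bool (D (g x) < \<delta>)) \<le> \<eta>"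
    using small_neighbourhood[OF no_atom \<eta>(1)] .
  obtain \<alpha> \<beta> near where ab: "\<alpha> < \<beta>" "0 < D \<alpha>" "0 < D \<beta>" "AE x in M. g x \<noteq> \<alpha>" "AE x in M. g x \<noteq> \<beta>"
    and near: "quad_conv near" "\<And>x. near x = 0 \<or> near x = (1::real)"
      "\<And>x. 0 \<le> D x \<Longrightarrow> near x + indicator {\<alpha><..\<beta>} x \<le> 1" "\<And>x. near x = 1 \<Longrightarrow> D x < \<delta>"
    and far: "(LINT x|M. 1 - indicator {\<alpha><..\<beta>} (g x) - near (g x)) \<le> \<eta>"
    by (rule exhausting_interval[OF \<delta>(1) \<eta>(1)]) (rule that)
  let ?J = "indicator {\<alpha><..\<beta>} :: real \<Rightarrow> real"
  note J = quad_conv_interval[OF ab]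
  have ni: "integrable M (\<lambda>x. near (g x))" and Ji: "integrable M (\<lambda>x. ?J (g x))" and Ri: "integrable M (\<lambda>x. R (g x))"
    using near(1) J R(1) by (auto intro: quad_conv_integrable)
  have "(LINT x|M. near (g x)) \<le> (LINT x|M. of_bool (D (g x) < \<delta>))"
  proof (rule integral_mono[OF ni])
    show "integrable M (\<lambda>x. of_bool (D (g x) < \<delta>) :: real)"
      by (intro integrable_const_bound[where B = 1]) auto
    show "near (g x) \<le> of_bool (D (g x) < \<delta>)" for x using near(2)[of "g x"] near(4)[of "g x"] by auto
  qed
  then have "(LINT x|M. 1 - ?J (g x)) \<le> 2 * \<eta>"
    using far \<delta>(2) ni Ji by simp
  then have "C * (LINT x|M. 1 - ?J (g x)) \<le> C * (2 * \<eta>)" using C by (rule mult_left_mono)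
  then have V: "(LINT x|M. C * (1 - ?J (g x)) + R (g x)) \<le> \<epsilon>"
    using \<eta>(2) R(3) Ji Ri by (simp add: algebra_simps)
  show "\<exists>\<alpha> \<beta> V. \<alpha> < \<beta> \<and> 0 < D \<alpha> \<and> 0 < D \<beta> \<and> (AE x in M. g x \<noteq> \<alpha>) \<and> (AE x in M. g x \<noteq> \<beta>) \<and>
      quad_conv V \<and> (\<forall>x\<in>{x. 0 < D x}. 0 \<le> V x) \<and>
      (\<forall>x\<in>{x. 0 < D x} - {\<alpha><..\<beta>}. \<bar>f x - 0\<bar> \<le> V x) \<and> (LINT x|M. V (g x)) \<le> \<epsilon>"
  proof (rule exI[of _ \<alpha>], rule exI[of _ \<beta>], rule exI[of _ "\<lambda>x. C * (1 - ?J x) + R x"], intro conjI)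
    show "quad_conv (\<lambda>x. C * (1 - ?J x) + R x)"
      by (intro quad_conv_add quad_conv_cmult quad_conv_diff quad_conv_const J R(1))
    show "\<forall>x\<in>{x. 0 < D x}. 0 \<le> C * (1 - ?J x) + R x"
      using C R(2) by (auto simp: indicator_def)
    show "\<forall>x\<in>{x. 0 < D x} - {\<alpha><..\<beta>}. \<bar>f x - 0\<bar> \<le> C * (1 - ?J x) + R x"
      using R(2) by (auto simp: indicator_def)
  qed (use ab V in auto)
qed (use D_nd in auto)

text \<open>If \<open>g = c\<close> has positive probability, continuity at \<open>c\<close> replaces smallness: the nodes near \<open>c\<close>
  carry the mass of the atom in the limit, and there \<open>f\<close> is close to \<open>f c\<close>.\<close>

theorem quad_tendsto_atom:
  assumes S: "\<And>n k. k \<le> n \<Longrightarrow> nd n k \<in> S" "AE x in M. g x \<in> S" "\<And>x. x \<in> S \<Longrightarrow> 0 \<le> D x"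
    and inner: "squeezed_on_intervals f"
    and bounded: "\<And>x. 0 < D x \<Longrightarrow> \<bar>f x\<bar> \<le> C" and C: "0 \<le> C"
    and cont: "\<And>\<epsilon>. 0 < \<epsilon> \<Longrightarrow> \<exists>\<delta>>0. \<forall>x\<in>S. D x < \<delta> \<longrightarrow> \<bar>f x - f c\<bar> \<le> \<epsilon>"
  obtains k where "integrable M k" "AE x in M. f (g x) = k x" "(\<lambda>n. quad n f) \<longlonglongrightarrow> (LINT x|M. k x)"
proof (rule quad_squeeze_from_intervals[where S = S and \<kappa> = "f c", OF S(1,2) inner])
  fix \<epsilon> :: real assume e: "0 < \<epsilon>"
  obtain \<delta> where \<delta>: "0 < \<delta>" "\<And>x. x \<in> S \<Longrightarrow> D x < \<delta> \<Longrightarrow> \<bar>f x - f c\<bar> \<le> \<epsilon> / 2" using cont[of "\<epsilon> / 2"] e by auto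
  define C' where "C' = C + \<bar>f c\<bar>"
  have C': "0 \<le> C'" using C by (simp add: C'_def)
  define \<eta> where "\<eta> = \<epsilon> / (2 * (C' + 1))"
  have \<eta>: "0 < \<eta>" "C' * \<eta> \<le> \<epsilon> / 2" using e C' by (auto simp: \<eta>_def field_simps)
  obtain \<alpha> \<beta> near where ab: "\<alpha> < \<beta>" "0 < D \<alpha>" "0 < D \<beta>" "AE x in M. g x \<noteq> \<alpha>" "AE x in M. g x \<noteq> \<beta>"
    and near: "quad_conv near" "\<And>x. near x = 0 \<or> near x = (1::real)"
      "\<And>x. 0 \<le> D x \<Longrightarrow> near x + indicator {\<alpha><..\<beta>} x \<le> 1" "\<And>x. near x = 1 \<Longrightarrow> D x < \<delta>"
    and far: "(LINT x|M. 1 - indicator {\<alpha><..\<beta>} (g x) - near (g x)) \<le> \<eta>"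
    by (rule exhausting_interval[OF \<delta>(1) \<eta>(1)]) (rule that)
  let ?J = "indicator {\<alpha><..\<beta>} :: real \<Rightarrow> real"
  note J = quad_conv_interval[OF ab]
  have ni: "integrable M (\<lambda>x. near (g x))" and Ji: "integrable M (\<lambda>x. ?J (g x))"
    using near(1) J by (auto intro: quad_conv_integrable)
  have "C' * (LINT x|M. 1 - ?J (g x) - near (g x)) \<le> C' * \<eta>" using far C' by (rule mult_left_mono)
  then have V: "(LINT x|M. \<epsilon> / 2 + C' * (1 - ?J (g x) - near (g x))) \<le> \<epsilon>"
    using \<eta>(2) ni Ji by (simp add: mass_1)
  show "\<exists>\<alpha> \<beta> V. \<alpha> < \<beta> \<and> 0 < D \<alpha> \<and> 0 < D \<beta> \<and> (AE x in M. g x \<noteq> \<alpha>) \<and> (AE x in M. g x \<noteq> \<beta>) \<and>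
      quad_conv V \<and> (\<forall>x\<in>S. 0 \<le> V x) \<and>
      (\<forall>x\<in>S - {\<alpha><..\<beta>}. \<bar>f x - f c\<bar> \<le> V x) \<and> (LINT x|M. V (g x)) \<le> \<epsilon>"
  proof (rule exI[of _ \<alpha>], rule exI[of _ \<beta>], rule exI[of _ "\<lambda>x. \<epsilon> / 2 + C' * (1 - ?J x - near x)"], intro conjI ballI)
    show "quad_conv (\<lambda>x. \<epsilon> / 2 + C' * (1 - ?J x - near x))"
      by (intro quad_conv_add quad_conv_cmult quad_conv_diff quad_conv_const J near(1))
    show "0 \<le> \<epsilon> / 2 + C' * (1 - ?J x - near x)" if "x \<in> S" for x
      using near(3)[OF S(3)[OF that]] C' e by (intro add_nonneg_nonneg mult_nonneg_nonneg) auto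
    show "\<bar>f x - f c\<bar> \<le> \<epsilon> / 2 + C' * (1 - ?J x - near x)" if x: "x \<in> S - {\<alpha><..\<beta>}" for x
    proof (cases "near x = 1")
      case True
      then have "\<bar>f x - f c\<bar> \<le> \<epsilon> / 2" using \<delta>(2)[of x] near(4)[of x] x by blast
      moreover have "?J x = 0" using x by simp
      ultimately show ?thesis using True by simp
    next
      case False
      then have n0: "near x = 0" using near(2)[of x] by blast
      have "\<bar>f x - f c\<bar> \<le> C'"
      proof (cases "D x = 0")
        case True
        then have "x = c" using sign by (auto simp: D_def)
        then show ?thesis using C' by simp
      next
        case False
        then have "\<bar>f x\<bar> \<le> C" using bounded S(3)[of x] x by auto
        then show ?thesis by (simp add: C'_def)
      qed
      moreover have "?J x = 0" using x by simp
      ultimately show ?thesis using n0 e by simp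
    qed
  qed (use ab V in auto)
qed

text \<open>The bound \<open>a + b \<bar>x - c\<bar>\<^sup>-\<^sup>p\<close>: subtracting \<open>b (s + \<bar>x - c\<bar>)\<^sup>-\<^sup>p\<close> leaves a small integral, and what is
  subtracted is bounded.\<close>

lemma tail_powr:
  assumes p: "0 < p" "p \<le> 1" and ab: "0 \<le> a" "0 \<le> b" and no_atom: "AE x in M. D (g x) \<noteq> 0"
    and int: "integrable M (\<lambda>x. D (g x) powr (- p))"
    and bound: "\<And>x. 0 < D x \<Longrightarrow> \<bar>f x\<bar> \<le> a + b * D x powr (- p)" and e: "0 < \<epsilon>"
  shows "\<exists>C R. 0 \<le> C \<and> quad_conv R \<and>
      (\<forall>x. 0 < D x \<longrightarrow> 0 \<le> R x \<and> \<bar>f x\<bar> \<le> C + R x) \<and> (LINT x|M. R (g x)) \<le> \<epsilon>"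
proof -
  note conv = quad_conv_powr[OF p no_atom int]
  have "\<forall>\<^sub>F m in sequentially. (LINT x|M. D (g x) powr (- p) - (inverse (real (Suc m)) + D (g x)) powr (- p)) < \<epsilon> / (b + 1)"
    by (rule order_tendstoD(2)[OF conv(2)]) (use e ab in auto)
  then obtain m where m: "(LINT x|M. D (g x) powr (- p) - (inverse (real (Suc m)) + D (g x)) powr (- p)) < \<epsilon> / (b + 1)"
    by (auto simp: eventually_sequentially)
  define s where "s = inverse (real (Suc m))"
  have s: "0 < s" by (simp add: s_def)
  define R where "R x = b * (D x powr (- p) - (s + D x) powr (- p))" for x
  have Rc: "quad_conv R"
    unfolding R_def by (intro quad_conv_cmult quad_conv_diff conv(1) quad_conv_shifted_powr s p)
  have le: "(s + D x) powr (- p) \<le> D x powr (- p)" "(s + D x) powr (- p) \<le> s powr (- p)" if "0 < D x" for x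
    using that s p by (auto intro!: powr_mono2')
  have "(LINT x|M. R (g x)) \<le> b * (\<epsilon> / (b + 1))"
    unfolding R_def s_def integral_mult_right_zero by (intro mult_left_mono less_imp_le[OF m] ab)
  also have "\<dots> \<le> \<epsilon>" using e ab by (simp add: field_simps)
  finally have int_R: "(LINT x|M. R (g x)) \<le> \<epsilon>" .
  show ?thesis
  proof (rule exI[of _ "a + b * s powr (- p)"], rule exI[of _ R], intro conjI allI impI)
    show "0 \<le> R x" if "0 < D x" for x using le(1)[OF that] ab by (simp add: R_def)
    show "\<bar>f x\<bar> \<le> a + b * s powr (- p) + R x" if "0 < D x" for x
    proof -
      have "b * (s + D x) powr (- p) \<le> b * s powr (- p)" using le(2)[OF that] ab by (simp add: mult_left_mono)
      then show ?thesis using bound[OF that] by (simp add: R_def right_diff_distrib)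
    qed
  qed (use ab Rc int_R in auto)
qed

end

section \<open>Quadrature rules from truncated matrices\<close>

text \<open>The spectral data of the finite sections: in the \<open>n\<close>-th one, \<open>u n i k\<close> is the \<open>i\<close>-th component of the \<open>k\<close>-th
  normalized eigenvector, with eigenvalue \<open>d n k\<close>.\<close>

locale truncated_matrices = orthonormal_basis M \<phi> for M :: "'a measure" and \<phi> +
  fixes g :: "'a \<Rightarrow> real" and u :: "nat \<Rightarrow> nat \<Rightarrow> nat \<Rightarrow> complex" and d :: "nat \<Rightarrow> nat \<Rightarrow> real"
  assumes total_mass: "measure M (space M) = 1"
    and \<phi>_0: "AE x in M. \<phi> 0 x = 1"
    and g_meas [measurable]: "g \<in> borel_measurable M"
    and g\<phi>: "\<And>i. sq_int M (\<lambda>x. complex_of_real (g x) * \<phi> i x)"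
    and u_rows: "\<And>n i j. i \<le> n \<Longrightarrow> j \<le> n \<Longrightarrow> (\<Sum>k\<le>n. u n i k * cnj (u n j k)) = (if i = j then 1 else 0)"
    and u_cols: "\<And>n i j. i \<le> n \<Longrightarrow> j \<le> n \<Longrightarrow> (\<Sum>k\<le>n. cnj (u n k i) * u n k j) = (if i = j then 1 else 0)"
    and spectral: "\<And>n i j. i \<le> n \<Longrightarrow> j \<le> n \<Longrightarrow>
      ip M (\<phi> i) (\<lambda>x. complex_of_real (g x) * \<phi> j x) = (\<Sum>k\<le>n. u n i k * d n k * cnj (u n j k))"
begin

lemma eigenvector:
  assumes "i \<le> n" "k \<le> n"
  shows "(\<Sum>j\<le>n. ip M (\<phi> i) (\<lambda>x. complex_of_real (g x) * \<phi> j x) * u n j k) = d n k * u n i k"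
proof -
  have "(\<Sum>j\<le>n. ip M (\<phi> i) (\<lambda>x. complex_of_real (g x) * \<phi> j x) * u n j k)
      = (\<Sum>j\<le>n. \<Sum>l\<le>n. u n i l * d n l * (cnj (u n j l) * u n j k))"
    using assms by (intro sum.cong refl) (simp add: spectral sum_distrib_right mult.assoc)
  also have "\<dots> = (\<Sum>l\<le>n. u n i l * d n l * (\<Sum>j\<le>n. cnj (u n j l) * u n j k))"
    by (subst sum.swap) (simp add: sum_distrib_left)
  also have "\<dots> = (\<Sum>l\<le>n. if l = k then u n i l * d n l else 0)"
    using assms by (intro sum.cong refl) (simp add: u_cols)
  also have "\<dots> = d n k * u n i k" using assms by simp
  finally show ?thesis .
qed

lemma affine_sq_int:
  "sq_int M \<psi> \<Longrightarrow> sq_int M (\<lambda>x. complex_of_real (g x) * \<psi> x) \<Longrightarrow>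
    sq_int M (\<lambda>x. complex_of_real (a + b * g x) * \<psi> x)"
  using sq_int_add[OF sq_int_cmult[of M \<psi> "complex_of_real a"]
      sq_int_cmult[of M "\<lambda>x. complex_of_real (g x) * \<psi> x" "complex_of_real b"]]
  by (simp add: algebra_simps)

lemma ip_affine:
  assumes "sq_int M \<theta>" "sq_int M \<psi>" "sq_int M (\<lambda>x. complex_of_real (g x) * \<psi> x)"
  shows "ip M \<theta> (\<lambda>x. complex_of_real (a + b * g x) * \<psi> x) =
    a * ip M \<theta> \<psi> + b * ip M \<theta> (\<lambda>x. complex_of_real (g x) * \<psi> x)"
proof -
  have "(\<lambda>x. complex_of_real (a + b * g x) * \<psi> x)
      = (\<lambda>x. complex_of_real a * \<psi> x + complex_of_real b * (complex_of_real (g x) * \<psi> x))"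
    by (auto simp: algebra_simps)
  then show ?thesis using assms by (simp only: ip_add_right sq_int_cmult ip_cmult_right)
qed

text \<open>If \<open>v\<close> is the function that belongs to the normalized eigenvector, then \<open>a + b d\<close> is the mean of \<open>a + b g\<close> with the
  density \<open>\<bar>v\<bar>\<^sup>2\<close>. Hence one-sided bounds for \<open>g\<close> are bounds for the eigenvalues.\<close>

lemma affine_rayleigh:
  assumes k: "k \<le> n" and nonneg: "AE x in M. 0 \<le> a + b * g x"
  shows "0 \<le> a + b * d n k"
proof -
  define v where "v x = (\<Sum>j\<le>n. u n j k * \<phi> j x)" for x
  have v: "sq_int M v" unfolding v_def by (rule comb_sq_int)
  have gv_eq: "(\<lambda>x. complex_of_real (g x) * v x) = (\<lambda>x. \<Sum>j\<le>n. u n j k * (complex_of_real (g x) * \<phi> j x))"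
    by (auto simp: v_def sum_distrib_left mult_ac)
  have gv: "sq_int M (\<lambda>x. complex_of_real (g x) * v x)"
    unfolding gv_eq by (intro sq_int_sum sq_int_cmult g\<phi>)
  have vv: "ip M v v = 1"
    unfolding ip_self v_def nsq_comb using u_cols[OF k k]
    by (simp add: complex_norm_square mult.commute del: of_real_power)
  have "ip M v (\<lambda>x. complex_of_real (g x) * v x)
      = (\<Sum>i\<le>n. cnj (u n i k) * (\<Sum>j\<le>n. u n j k * ip M (\<phi> i) (\<lambda>x. complex_of_real (g x) * \<phi> j x)))"
    unfolding gv_eq unfolding v_def
    by (subst ip_sum_left) (auto intro!: sum.cong sq_int_sum sq_int_cmult g\<phi> basis_sq_int simp: ip_sum_right basis_sq_int g\<phi>)
  also have "\<dots> = (\<Sum>i\<le>n. cnj (u n i k) * (d n k * u n i k))"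
    using eigenvector[OF _ k] by (intro sum.cong refl) (simp add: mult.commute)
  also have "\<dots> = d n k * (\<Sum>i\<le>n. cnj (u n i k) * u n i k)" by (simp add: sum_distrib_left mult_ac)
  also have "\<dots> = d n k" using u_cols[OF k k] by simp
  finally have "ip M v (\<lambda>x. complex_of_real (a + b * g x) * v x) = complex_of_real (a + b * d n k)"
    unfolding ip_affine[OF v v gv] vv by simp
  moreover have "ip M v (\<lambda>x. complex_of_real (a + b * g x) * v x)
      = (LINT x|M. complex_of_real ((a + b * g x) * (cmod (v x))\<^sup>2))"
    unfolding ip_def by (intro Bochner_Integration.integral_cong refl)
      (simp add: complex_norm_square mult_ac del: of_real_power)
  ultimately have "a + b * d n k = (LINT x|M. (a + b * g x) * (cmod (v x))\<^sup>2)"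
    by (simp only: integral_complex_of_real of_real_eq_iff)
  also have "\<dots> \<ge> 0"
    by (rule integral_nonneg_AE) (use nonneg in eventually_elim, simp)
  finally show ?thesis .
qed

definition wt :: "nat \<Rightarrow> nat \<Rightarrow> real" where "wt n k = (cmod (u n 0 k))\<^sup>2"

lemma weights_sum: "(\<Sum>k\<le>n. wt n k) = 1"
proof -
  have "complex_of_real (\<Sum>k\<le>n. wt n k) = 1"
    using u_rows[of 0 n 0] by (simp add: wt_def complex_norm_square del: of_real_power)
  then show ?thesis by (simp only: of_real_eq_1_iff)
qed

sublocale quadrature_sequence M g wt d
proof
  show "0 \<le> wt n k" for n k by (simp add: wt_def)
qed (rule total_mass g_meas weights_sum)+

text \<open>Write \<open>s + \<bar>g - c\<bar> = a + b g\<close>. The Galerkin system has the solution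
  \<open>y\<^sub>j = \<Sum>\<^sub>k u\<^sub>j\<^sub>k (a + b d\<^sub>k)\<^sup>-\<^sup>1 cnj u\<^sub>0\<^sub>k\<close>, and \<open>y\<^sub>0\<close> is the quadrature of \<open>1 / (a + b x)\<close>.\<close>

lemma resolvent_quadrature:
  assumes sign: "\<sigma> = 1 \<or> \<sigma> = -1" and g_side: "AE x in M. 0 \<le> \<sigma> * (c - g x)"
    and s: "0 < s"
    and maximal: "\<And>\<psi>. sq_int M \<psi> \<Longrightarrow>
      summable (\<lambda>i. (cmod (ip M (\<lambda>x. complex_of_real (g x) * \<phi> i x) \<psi>))\<^sup>2) \<Longrightarrow>
      sq_int M (\<lambda>x. complex_of_real (g x) * \<psi> x)"
  shows "(\<lambda>n. quad n (\<lambda>x. 1 / (s + \<sigma> * (c - x)))) \<longlonglongrightarrow> (LINT x|M. 1 / (s + \<sigma> * (c - g x)))"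
    and "incseq (\<lambda>n. quad n (\<lambda>x. 1 / (s + \<sigma> * (c - x))))"
proof -
  define a where "a = s + \<sigma> * c"
  define b where "b = - \<sigma>"
  have b0: "b \<noteq> 0" using sign by (auto simp: b_def)
  have affine: "s + \<sigma> * (c - x) = a + b * x" for x by (simp add: a_def b_def algebra_simps)
  define y where "y n j = (\<Sum>k\<le>n. u n j k * complex_of_real (1 / (a + b * d n k)) * cnj (u n 0 k))" for n j
  have pos: "0 < a + b * d n k" if "k \<le> n" for n k
  proof -
    have "AE x in M. 0 \<le> (a - s) + b * g x"
      using g_side by eventually_elim (simp add: a_def b_def algebra_simps)
    from affine_rayleigh[OF that this] show ?thesis using s by linarith
  qed
  have rows: "(\<Sum>j\<le>n. ip M (\<phi> i) (\<lambda>x. complex_of_real (a + b * g x) * \<phi> j x) * y n j) = (if i = 0 then 1 else 0)"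
    if i: "i \<le> n" for n i
  proof -
    have entry: "(\<Sum>j\<le>n. ip M (\<phi> i) (\<lambda>x. complex_of_real (a + b * g x) * \<phi> j x) * u n j k)
        = complex_of_real (a + b * d n k) * u n i k" if k: "k \<le> n" for k
    proof -
      have "(\<Sum>j\<le>n. ip M (\<phi> i) (\<lambda>x. complex_of_real (a + b * g x) * \<phi> j x) * u n j k)
          = (\<Sum>j\<le>n. complex_of_real a * (if i = j then 1 else 0) * u n j k) +
            complex_of_real b * (\<Sum>j\<le>n. ip M (\<phi> i) (\<lambda>x. complex_of_real (g x) * \<phi> j x) * u n j k)"
        by (simp only: ip_affine basis_sq_int g\<phi> orthonormal distrib_right sum.distrib sum_distrib_left mult.assoc)
      also have "(\<Sum>j\<le>n. complex_of_real a * (if i = j then 1 else 0) * u n j k) = a * u n i k"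
      proof -
        have "(\<Sum>j\<le>n. complex_of_real a * (if i = j then 1 else 0) * u n j k)
            = (\<Sum>j\<le>n. if i = j then complex_of_real a * u n j k else 0)" by (intro sum.cong) auto
        then show ?thesis using i by simp
      qed
      finally show ?thesis unfolding eigenvector[OF i k] by (simp add: algebra_simps)
    qed
    have "(\<Sum>j\<le>n. ip M (\<phi> i) (\<lambda>x. complex_of_real (a + b * g x) * \<phi> j x) * y n j)
        = (\<Sum>j\<le>n. \<Sum>k\<le>n. ip M (\<phi> i) (\<lambda>x. complex_of_real (a + b * g x) * \<phi> j x) * u n j k
            * (complex_of_real (1 / (a + b * d n k)) * cnj (u n 0 k)))"
      unfolding y_def by (simp only: sum_distrib_left mult.assoc)
    also have "\<dots> = (\<Sum>k\<le>n. (\<Sum>j\<le>n. ip M (\<phi> i) (\<lambda>x. complex_of_real (a + b * g x) * \<phi> j x) * u n j k)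
            * (complex_of_real (1 / (a + b * d n k)) * cnj (u n 0 k)))"
      by (subst sum.swap) (simp only: sum_distrib_right)
    also have "\<dots> = (\<Sum>k\<le>n. u n i k * cnj (u n 0 k))"
    proof (rule sum.cong[OF refl])
      fix k assume "k \<in> {..n}"
      then have k: "k \<le> n" by simp
      have "complex_of_real (a + b * d n k) * complex_of_real (1 / (a + b * d n k)) = 1"
        unfolding of_real_mult[symmetric] using pos[OF k] by simp
      then show "(\<Sum>j\<le>n. ip M (\<phi> i) (\<lambda>x. complex_of_real (a + b * g x) * \<phi> j x) * u n j k)
            * (complex_of_real (1 / (a + b * d n k)) * cnj (u n 0 k)) = u n i k * cnj (u n 0 k)"
        unfolding entry[OF k] by (metis (no_types, lifting) mult.assoc mult.commute mult_1)
    qed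
    also have "\<dots> = (if i = 0 then 1 else 0)" using u_rows[OF i, of 0] by simp
    finally show ?thesis .
  qed
  have max: "sq_int M (\<lambda>x. complex_of_real (a + b * g x) * \<psi> x)"
    if \<psi>: "sq_int M \<psi>" and sm: "summable (\<lambda>i. (cmod (ip M (\<lambda>x. complex_of_real (a + b * g x) * \<phi> i x) \<psi>))\<^sup>2)" for \<psi>
  proof (rule affine_sq_int[OF \<psi> maximal[OF \<psi>]])
    have eq: "ip M (\<lambda>x. complex_of_real (g x) * \<phi> i x) \<psi> =
        (ip M (\<lambda>x. complex_of_real (a + b * g x) * \<phi> i x) \<psi> - a * ip M (\<phi> i) \<psi>) / b" for i
    proof -
      have "ip M (\<lambda>x. complex_of_real (a + b * g x) * \<phi> i x) \<psi>
          = cnj (ip M \<psi> (\<lambda>x. complex_of_real (a + b * g x) * \<phi> i x))" by (rule ip_commute)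
      also have "\<dots> = a * ip M (\<phi> i) \<psi> + b * ip M (\<lambda>x. complex_of_real (g x) * \<phi> i x) \<psi>"
        by (simp only: ip_affine \<psi> basis_sq_int g\<phi> complex_cnj_add complex_cnj_mult complex_cnj_complex_of_real
            ip_commute[of M "\<phi> i" \<psi>] ip_commute[of M "\<lambda>x. complex_of_real (g x) * \<phi> i x" \<psi>])
      finally show ?thesis using b0 by simp
    qed
    show "summable (\<lambda>i. (cmod (ip M (\<lambda>x. complex_of_real (g x) * \<phi> i x) \<psi>))\<^sup>2)"
    proof (rule summable_comparison_test')
      show "summable (\<lambda>i. 2 * (cmod (ip M (\<lambda>x. complex_of_real (a + b * g x) * \<phi> i x) \<psi>))\<^sup>2
          + 2 * a\<^sup>2 * (cmod (ip M (\<phi> i) \<psi>))\<^sup>2)"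
        by (intro summable_add summable_mult sm summable_coeff \<psi>)
      fix i
      let ?z = "ip M (\<lambda>x. complex_of_real (a + b * g x) * \<phi> i x) \<psi>" and ?v = "ip M (\<phi> i) \<psi>"
      have b1: "cmod (complex_of_real b) = 1" using sign by (auto simp: b_def)
      have "(cmod ((?z - a * ?v) / b))\<^sup>2 \<le> (cmod ?z + \<bar>a\<bar> * cmod ?v)\<^sup>2"
        unfolding norm_divide b1 using norm_triangle_ineq4[of ?z "a * ?v"]
        by (intro power_mono) (auto simp: norm_mult)
      also have "\<dots> \<le> 2 * (cmod ?z)\<^sup>2 + 2 * a\<^sup>2 * (cmod ?v)\<^sup>2"
        using sum_squares_bound[of "cmod ?z" "\<bar>a\<bar> * cmod ?v"] by (simp add: power2_sum power_mult_distrib)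
      finally show "norm ((cmod (ip M (\<lambda>x. complex_of_real (g x) * \<phi> i x) \<psi>))\<^sup>2)
          \<le> 2 * (cmod ?z)\<^sup>2 + 2 * a\<^sup>2 * (cmod ?v)\<^sup>2"
        unfolding eq by simp
    qed
  qed
  have ge: "AE x in M. s \<le> a + b * g x"
    using g_side by eventually_elim (simp add: a_def b_def algebra_simps)
  have y0: "Re (y n 0) = quad n (\<lambda>x. 1 / (s + \<sigma> * (c - x)))" for n
  proof -
    have "y n 0 = (\<Sum>k\<le>n. complex_of_real (wt n k * (1 / (a + b * d n k))))"
      unfolding y_def wt_def of_real_mult complex_norm_square by (intro sum.cong refl) (simp only: mult_ac)
    then show ?thesis unfolding quad_def affine by (simp add: Re_sum)
  qed
  have meas: "(\<lambda>x. a + b * g x) \<in> borel_measurable M" by measurable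
  note galerkin = galerkin_reciprocal[OF meas s ge affine_sq_int[OF basis_sq_int g\<phi>] \<phi>_0 max rows]
  show "(\<lambda>n. quad n (\<lambda>x. 1 / (s + \<sigma> * (c - x)))) \<longlonglongrightarrow> (LINT x|M. 1 / (s + \<sigma> * (c - g x)))"
    using galerkin(1) unfolding y0 affine .
  show "incseq (\<lambda>n. quad n (\<lambda>x. 1 / (s + \<sigma> * (c - x))))"
    using galerkin(2) unfolding y0 .
qed

theorem one_sided_quadrature_truncated:
  assumes sign: "\<sigma> = 1 \<or> \<sigma> = -1" and g_side: "AE x in M. 0 \<le> \<sigma> * (c - g x)"
    and not_eigen: "\<And>n k. k \<le> n \<Longrightarrow> d n k \<noteq> c"
    and maximal: "\<And>\<psi>. sq_int M \<psi> \<Longrightarrow>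
      summable (\<lambda>i. (cmod (ip M (\<lambda>x. complex_of_real (g x) * \<phi> i x) \<psi>))\<^sup>2) \<Longrightarrow>
      sq_int M (\<lambda>x. complex_of_real (g x) * \<psi> x)"
  shows "one_sided_quadrature M g wt d c \<sigma>"
proof unfold_locales
  show "0 < \<sigma> * (c - d n k)" if "k \<le> n" for n k
  proof -
    have "AE x in M. 0 \<le> \<sigma> * c + (- \<sigma>) * g x"
      using g_side by eventually_elim (simp add: algebra_simps)
    from affine_rayleigh[OF that this] have "0 \<le> \<sigma> * (c - d n k)" by (simp add: algebra_simps)
    moreover have "\<sigma> * (c - d n k) \<noteq> 0" using not_eigen[OF that] sign by auto
    ultimately show ?thesis by linarith
  qed
  fix s :: real assume s: "0 < s"
  note rq = resolvent_quadrature[OF sign g_side s maximal]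
  have "integrable M (\<lambda>x. 1 / (s + \<sigma> * (c - g x)))"
  proof (rule integrable_const_bound[where B = "1 / s"])
    show "AE x in M. norm (1 / (s + \<sigma> * (c - g x))) \<le> 1 / s"
      using g_side by eventually_elim (use s in \<open>auto intro!: divide_left_mono\<close>)
  qed measurable
  then show "quad_conv (\<lambda>x. 1 / (s + \<sigma> * (c - x)))" using rq(1) by (simp add: quad_conv_def)
  show "quad n (\<lambda>x. 1 / (s + \<sigma> * (c - x))) \<le> (LINT x|M. 1 / (s + \<sigma> * (c - g x)))" for n
    using rq by (rule incseq_le[rotated])
qed (use sign g_side in auto)

end

section \<open>Riemann--Stieltjes integrability\<close>

context quadrature_sequence
begin

definition cdf_g :: "real \<Rightarrow> real" where "cdf_g t = measure M {x \<in> space M. g x \<le> t}"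

lemma cdf_g_le_1: "cdf_g t \<le> 1"
  using bounded_measure[of "{x \<in> space M. g x \<le> t}"] mass_1 by (simp add: cdf_g_def)

lemma cdf_g_nonneg: "0 \<le> cdf_g t" by (simp add: cdf_g_def)

lemma cdf_g_mono: "s \<le> t \<Longrightarrow> cdf_g s \<le> cdf_g t"
  unfolding cdf_g_def by (rule finite_measure_mono) auto

lemma integral_interval_cdf:
  assumes "s \<le> t"
  shows "(LINT x|M. indicator {s<..t} (g x)) = cdf_g t - cdf_g s"
proof -
  have *: "(LINT x|M. indicator {..t} (g x)) = cdf_g t" for t
  proof -
    have "(LINT x|M. indicator {..t} (g x)) = (LINT x|M. indicator {x \<in> space M. g x \<le> t} x :: real)"
      by (intro Bochner_Integration.integral_cong) (auto simp: indicator_def)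
    then show ?thesis by (simp add: cdf_g_def Int_absorb1)
  qed
  have int: "integrable M (\<lambda>x. indicator {..t} (g x) :: real)" for t
    by (intro integrable_const_bound[where B = 1]) (auto simp: indicator_def)
  have "(LINT x|M. indicator {s<..t} (g x)) = (LINT x|M. indicator {..t} (g x) - indicator {..s} (g x) :: real)"
    using assms by (intro Bochner_Integration.integral_cong) (auto simp: indicator_def)
  then show ?thesis using int * by simp
qed

lemma partition_non_atoms:
  assumes ab: "\<alpha> < \<beta>" "AE x in M. g x \<noteq> \<alpha>" "AE x in M. g x \<noteq> \<beta>" and \<delta>: "0 < \<delta>"
  obtains N t where "t 0 = \<alpha>" "t N = \<beta>" "\<And>k. k < N \<Longrightarrow> t k < t (Suc k) \<and> t (Suc k) - t k < \<delta>"
    "\<And>k. k \<le> N \<Longrightarrow> AE x in M. g x \<noteq> t k"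
proof -
  \<comment> \<open>Move the inner points of an equidistant partition by less than a quarter of the mesh size \<open>h\<close>; the mesh then
    stays below \<open>3 h / 2\<close>.\<close>
  obtain N where N: "2 * (\<beta> - \<alpha>) / \<delta> < real N" using reals_Archimedean2 by blast
  have "0 < 2 * (\<beta> - \<alpha>) / \<delta>" using ab \<delta> by simp
  then have N0: "0 < N" using N by linarith
  define h where "h = (\<beta> - \<alpha>) / N"
  have h: "0 < h" "2 * h < \<delta>" using N N0 \<delta> ab by (auto simp: h_def field_simps)
  have "\<forall>k::nat. \<exists>s. \<bar>s - (\<alpha> + k * h)\<bar> < h / 4 \<and> (AE x in M. g x \<noteq> s)"
  proof
    fix k :: nat
    obtain s where s: "s \<in> {\<alpha> + k * h - h / 4<..<\<alpha> + k * h + h / 4}" and ae: "AE x in M. g x \<noteq> s"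
      using exists_non_atom[of "\<alpha> + k * h - h / 4" "\<alpha> + k * h + h / 4"] h by auto
    have "\<bar>s - (\<alpha> + k * h)\<bar> < h / 4"
      using s unfolding greaterThanLessThan_iff by linarith
    then show "\<exists>s. \<bar>s - (\<alpha> + k * h)\<bar> < h / 4 \<and> (AE x in M. g x \<noteq> s)" using ae by blast
  qed
  then obtain s where s: "\<And>k. \<bar>s k - (\<alpha> + real k * h)\<bar> < h / 4" "\<And>k. AE x in M. g x \<noteq> s k" by metis
  define t where "t k = (if k = 0 then \<alpha> else if k = N then \<beta> else s k)" for k
  have Nh: "\<alpha> + real N * h = \<beta>" using N0 by (simp add: h_def)
  have close: "\<bar>t k - (\<alpha> + real k * h)\<bar> < h / 4" if "k \<le> N" for k
    using s(1)[of k] Nh h by (auto simp: t_def)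
  show ?thesis
  proof (rule that[of t N])
    show "t 0 = \<alpha>" "t N = \<beta>" using N0 by (auto simp: t_def)
    show "AE x in M. g x \<noteq> t k" for k using s(2)[of k] ab by (auto simp: t_def)
    show "t k < t (Suc k) \<and> t (Suc k) - t k < \<delta>" if "k < N" for k
    proof -
      have "\<bar>t k - (\<alpha> + real k * h)\<bar> < h / 4" "\<bar>t (Suc k) - (\<alpha> + real k * h + h)\<bar> < h / 4"
        using close[of k] close[of "Suc k"] that by (simp_all add: algebra_simps)
      then have "t k < t (Suc k)" "t (Suc k) - t k < \<delta>" using h by linarith+
      then show ?thesis ..
    qed
  qed
qed

text \<open>Choosing the tags where \<open>f\<close> is nearly largest and nearly smallest shows that upper and lower Darboux
  sums are close. The partition points can be taken to have probability zero.\<close>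

lemma RS_integrable_bracket:
  assumes RS: "RS_integrable f cdf_g \<alpha> \<beta>"
    and ab: "\<alpha> < \<beta>" "AE x in M. g x \<noteq> \<alpha>" "AE x in M. g x \<noteq> \<beta>"
    and bounded: "\<And>x. x \<in> {\<alpha>..\<beta>} \<Longrightarrow> \<bar>f x\<bar> \<le> K" and e: "0 < \<epsilon>"
  obtains N t lo up where "t 0 = \<alpha>" "t N = \<beta>" "\<And>k. k < N \<Longrightarrow> t k < t (Suc k)"
    "\<And>k. k \<le> N \<Longrightarrow> t k \<in> {\<alpha>..\<beta>}" "\<And>k. k \<le> N \<Longrightarrow> AE x in M. g x \<noteq> t k"
    "\<And>k x. k < N \<Longrightarrow> x \<in> {t k..t (Suc k)} \<Longrightarrow> lo k \<le> f x \<and> f x \<le> up k"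
    "(\<Sum>k<N. (up k - lo k) * (cdf_g (t (Suc k)) - cdf_g (t k))) \<le> \<epsilon>"
proof -
  obtain I where I: "\<forall>\<epsilon>>0. \<exists>\<delta>>0. \<forall>n t \<xi>.
     t 0 = \<alpha> \<and> t n = \<beta> \<and>
     (\<forall>k<n. t k < t (Suc k) \<and> t (Suc k) - t k < \<delta> \<and> \<xi> k \<in> {t k..t (Suc k)}) \<longrightarrow>
     \<bar>(\<Sum>k<n. f (\<xi> k) * (cdf_g (t (Suc k)) - cdf_g (t k))) - I\<bar> < \<epsilon>"
    using RS unfolding RS_integrable_def by blast
  define \<theta> where "\<theta> = \<epsilon> / 4"
  have \<theta>: "0 < \<theta>" using e by (simp add: \<theta>_def)
  obtain \<delta> where \<delta>: "0 < \<delta>" and sums0: "\<forall>n t \<xi>.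
     t 0 = \<alpha> \<and> t n = \<beta> \<and>
     (\<forall>k<n. t k < t (Suc k) \<and> t (Suc k) - t k < \<delta> \<and> \<xi> k \<in> {t k..t (Suc k)}) \<longrightarrow>
     \<bar>(\<Sum>k<n. f (\<xi> k) * (cdf_g (t (Suc k)) - cdf_g (t k))) - I\<bar> < \<theta>"
    using I[THEN spec, THEN mp, OF \<theta>] by blast
  have sums: "\<bar>(\<Sum>k<n. f (\<xi> k) * (cdf_g (t (Suc k)) - cdf_g (t k))) - I\<bar> < \<theta>"
    if "t 0 = \<alpha>" "t n = \<beta>"
      "\<And>k. k < n \<Longrightarrow> t k < t (Suc k) \<and> t (Suc k) - t k < \<delta> \<and> \<xi> k \<in> {t k..t (Suc k)}" for n t \<xi>
    by (rule sums0[THEN spec, THEN spec, THEN spec, THEN mp]) (use that in blast)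
  obtain N t where t: "t 0 = \<alpha>" "t N = \<beta>" "\<And>k. k < N \<Longrightarrow> t k < t (Suc k) \<and> t (Suc k) - t k < \<delta>"
    "\<And>k. k \<le> N \<Longrightarrow> AE x in M. g x \<noteq> t k"
    by (rule partition_non_atoms[OF ab \<delta>]) (rule that)
  have tmono: "t j \<le> t k" if "j \<le> k" "k \<le> N" for j k
    using that
  proof (induction k rule: dec_induct)
    case (step k)
    then show ?case using t(3)[of k] by auto
  qed simp
  have tin: "t k \<in> {\<alpha>..\<beta>}" if "k \<le> N" for k
    using tmono[of 0 k] tmono[of k N] that t(1,2) by auto
  have fK: "\<bar>f x\<bar> \<le> K" if "k < N" "x \<in> {t k..t (Suc k)}" for k x
    using bounded[of x] tin[of k] tin[of "Suc k"] that by auto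
  define up where "up k = Sup (f ` {t k..t (Suc k)})" for k
  define lo where "lo k = Inf (f ` {t k..t (Suc k)})" for k
  have bdd: "bdd_above (f ` {t k..t (Suc k)})" "bdd_below (f ` {t k..t (Suc k)})" if "k < N" for k
    using fK[OF that] by (auto intro!: bdd_aboveI2[where M = K] bdd_belowI2[where m = "- K"] simp: abs_le_iff)
      (smt (verit))+
  have ne: "f ` {t k..t (Suc k)} \<noteq> {}" if "k < N" for k using t(3)[OF that] by auto
  have "\<exists>x. x \<in> {t k..t (Suc k)} \<and> up k - \<theta> < f x" if k: "k < N" for k
  proof -
    have "up k - \<theta> < Sup (f ` {t k..t (Suc k)})" using \<theta> by (simp add: up_def)
    then obtain z where "z \<in> f ` {t k..t (Suc k)}" "up k - \<theta> < z"
      using less_cSupD[OF ne[OF k]] by blast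
    then show ?thesis by blast
  qed
  then obtain \<xi> where \<xi>: "\<And>k. k < N \<Longrightarrow> \<xi> k \<in> {t k..t (Suc k)} \<and> up k - \<theta> < f (\<xi> k)" by metis
  have "\<exists>x. x \<in> {t k..t (Suc k)} \<and> f x < lo k + \<theta>" if "k < N" for k
  proof -
    have "Inf (f ` {t k..t (Suc k)}) < lo k + \<theta>" using \<theta> by (simp add: lo_def)
    from cInf_lessD[OF ne[OF that] this] show ?thesis by blast
  qed
  then obtain \<zeta> where \<zeta>: "\<And>k. k < N \<Longrightarrow> \<zeta> k \<in> {t k..t (Suc k)} \<and> f (\<zeta> k) < lo k + \<theta>" by metis
  let ?\<Delta> = "\<lambda>k. cdf_g (t (Suc k)) - cdf_g (t k)"
  have \<Delta>: "0 \<le> ?\<Delta> k" if "k < N" for k using cdf_g_mono t(3)[OF that] by (simp add: less_imp_le)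
  have \<Delta>_sum: "(\<Sum>k<N. ?\<Delta> k) \<le> 1"
    using sum_lessThan_telescope[of "\<lambda>k. cdf_g (t k)" N] cdf_g_le_1[of "t N"] cdf_g_nonneg[of "t 0"] by simp
  have S1: "\<bar>(\<Sum>k<N. f (\<xi> k) * ?\<Delta> k) - I\<bar> < \<theta>" by (rule sums) (use t \<xi> in auto)
  have S2: "\<bar>(\<Sum>k<N. f (\<zeta> k) * ?\<Delta> k) - I\<bar> < \<theta>" by (rule sums) (use t \<zeta> in auto)
  have "(\<Sum>k<N. (up k - lo k) * ?\<Delta> k) \<le> (\<Sum>k<N. (f (\<xi> k) - f (\<zeta> k) + 2 * \<theta>) * ?\<Delta> k)"
  proof (intro sum_mono mult_right_mono)
    fix k assume "k \<in> {..<N}"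
    then have k: "k < N" by simp
    show "up k - lo k \<le> f (\<xi> k) - f (\<zeta> k) + 2 * \<theta>" using \<xi>[OF k] \<zeta>[OF k] by linarith
    show "0 \<le> ?\<Delta> k" by (rule \<Delta>[OF k])
  qed
  also have "\<dots> = (\<Sum>k<N. f (\<xi> k) * ?\<Delta> k) - (\<Sum>k<N. f (\<zeta> k) * ?\<Delta> k) + 2 * \<theta> * (\<Sum>k<N. ?\<Delta> k)"
    by (simp add: algebra_simps sum.distrib sum_subtractf sum_distrib_left)
  also have "\<dots> \<le> 2 * \<theta> + 2 * \<theta> * 1"
    using S1 S2 \<Delta>_sum \<theta> by (intro add_mono mult_left_mono) linarith+
  also have "\<dots> = \<epsilon>" by (simp add: \<theta>_def)
  finally have width: "(\<Sum>k<N. (up k - lo k) * ?\<Delta> k) \<le> \<epsilon>" .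
  show ?thesis
  proof (rule that[of t N lo up])
    show "lo k \<le> f x \<and> f x \<le> up k" if "k < N" "x \<in> {t k..t (Suc k)}" for k x
      unfolding lo_def up_def using bdd[OF that(1)] that(2) by (auto intro: cInf_lower cSup_upper)
  qed (use t tin width in auto)
qed

end

context one_sided_quadrature
begin

text \<open>The bounding step functions of the partition, with half-open steps, so that the points between \<open>\<alpha>\<close> and \<open>\<beta>\<close> lie
  in exactly one step.\<close>

lemma RS_integrable_inner:
  assumes RS: "RS_integrable f cdf_g \<alpha> \<beta>"
    and ab: "\<alpha> < \<beta>" "0 < D \<alpha>" "0 < D \<beta>" "AE x in M. g x \<noteq> \<alpha>" "AE x in M. g x \<noteq> \<beta>"
    and bounded: "\<And>x. x \<in> {\<alpha>..\<beta>} \<Longrightarrow> \<bar>f x\<bar> \<le> K" and e: "0 < \<epsilon>"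
  shows "\<exists>L U. quad_conv L \<and> quad_conv U \<and> (\<forall>x\<in>{\<alpha><..\<beta>}. L x \<le> f x \<and> f x \<le> U x) \<and>
        (\<forall>x. x \<notin> {\<alpha><..\<beta>} \<longrightarrow> L x = 0 \<and> U x = 0) \<and> (LINT x|M. U (g x) - L (g x)) \<le> \<epsilon>"
proof -
  obtain N t lo up where t: "t 0 = \<alpha>" "t N = \<beta>" "\<And>k. k < N \<Longrightarrow> t k < t (Suc k)"
    "\<And>k. k \<le> N \<Longrightarrow> t k \<in> {\<alpha>..\<beta>}" "\<And>k. k \<le> N \<Longrightarrow> AE x in M. g x \<noteq> t k"
    and lu: "\<And>k x. k < N \<Longrightarrow> x \<in> {t k..t (Suc k)} \<Longrightarrow> lo k \<le> f x \<and> f x \<le> up k"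
    and width: "(\<Sum>k<N. (up k - lo k) * (cdf_g (t (Suc k)) - cdf_g (t k))) \<le> \<epsilon>"
    by (rule RS_integrable_bracket[OF RS ab(1,4,5) bounded e]) (assumption, rule that)
  let ?J = "\<lambda>k. indicator {t k<..t (Suc k)} :: real \<Rightarrow> real"
  have Dpos: "0 < D x" if "x \<in> {\<alpha>..\<beta>}" for x
    using that ab(2,3) sign by (auto simp: D_def)
  have J: "quad_conv (?J k)" if "k < N" for k
    using that t by (intro quad_conv_interval Dpos) auto
  define L where "L x = (\<Sum>k<N. lo k * ?J k x)" for x
  define U where "U x = (\<Sum>k<N. up k * ?J k x)" for x
  have conv: "quad_conv L" "quad_conv U"
    unfolding L_def U_def by (intro quad_conv_sum quad_conv_cmult J; simp)+
  have part: "(\<Sum>k<N. ?J k x) = 1" if "x \<in> {\<alpha><..\<beta>}" for x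
  proof -
    have "?J k x = of_bool (x \<le> t (Suc k)) - of_bool (x \<le> t k)" if "k < N" for k
      using t(3)[OF that] by (auto simp: indicator_def)
    then have "(\<Sum>k<N. ?J k x) = (\<Sum>k<N. of_bool (x \<le> t (Suc k)) - of_bool (x \<le> t k))"
      by (intro sum.cong) auto
    also have "\<dots> = of_bool (x \<le> t N) - of_bool (x \<le> t 0)" 
      by (rule sum_lessThan_telescope[of "\<lambda>k. of_bool (x \<le> t k)"])
    finally show ?thesis using that t(1,2) by simp
  qed
  have between: "L x \<le> f x \<and> f x \<le> U x" if "x \<in> {\<alpha><..\<beta>}" for x
  proof -
    have f: "f x = (\<Sum>k<N. f x * ?J k x)" using part[OF that] by (simp flip: sum_distrib_left)
    have le: "lo k * ?J k x \<le> f x * ?J k x \<and> f x * ?J k x \<le> up k * ?J k x" if "k \<in> {..<N}" for k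
      using lu[of k x] that by (auto simp: indicator_def)
    have "L x \<le> (\<Sum>k<N. f x * ?J k x)" "(\<Sum>k<N. f x * ?J k x) \<le> U x"
      unfolding L_def U_def by (intro sum_mono conjunct1[OF le] conjunct2[OF le]; assumption)+
    then show ?thesis using f by simp
  qed
  have zero: "L x = 0 \<and> U x = 0" if "x \<notin> {\<alpha><..\<beta>}" for x
  proof -
    have "?J k x = 0" if "k < N" for k
      using \<open>x \<notin> {\<alpha><..\<beta>}\<close> t(4)[of k] t(4)[of "Suc k"] that by (auto simp: indicator_def)
    then show ?thesis by (simp add: L_def U_def)
  qed
  have Ji: "integrable M (\<lambda>x. ?J k (g x))" if "k < N" for k using J[OF that] by (rule quad_conv_integrable)
  have "(LINT x|M. U (g x) - L (g x)) = (LINT x|M. (\<Sum>k<N. (up k - lo k) * ?J k (g x)))"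
    unfolding U_def L_def left_diff_distrib sum_subtractf ..
  also have "\<dots> = (\<Sum>k<N. (up k - lo k) * (LINT x|M. ?J k (g x)))"
    unfolding integral_mult_right_zero[symmetric]
    by (rule Bochner_Integration.integral_sum) (simp add: Ji del: integrable_mult_right_iff)
  also have "\<dots> = (\<Sum>k<N. (up k - lo k) * (cdf_g (t (Suc k)) - cdf_g (t k)))"
    using t(3) by (intro sum.cong refl) (simp add: integral_interval_cdf less_imp_le)
  finally have "(LINT x|M. U (g x) - L (g x)) \<le> \<epsilon>" using width by simp
  with conv between zero show ?thesis by blast
qed

end

section \<open>The weighted space as a space over a probability measure\<close>

locale weighted_domain =
  fixes \<Omega> :: "(real^'d) set" and w :: "real^'d \<Rightarrow> real"
  assumes \<Omega>_lebesgue: "\<Omega> \<in> sets lebesgue"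
    and w_measurable [measurable]: "w \<in> borel_measurable (lebesgue_on \<Omega>)"
    and w_nonneg: "\<And>x. x \<in> \<Omega> \<Longrightarrow> 0 \<le> w x"
    and w_integral: "(LINT x|lebesgue_on \<Omega>. w x) = 1"
begin

definition \<mu> :: "(real^'d) measure" where "\<mu> = density (lebesgue_on \<Omega>) (\<lambda>x. ennreal (w x))"

lemma w_AE: "AE x in lebesgue_on \<Omega>. 0 \<le> w x"
  by (rule AE_I2) (simp add: w_nonneg)

lemma borel_measurable_\<mu>: "borel_measurable \<mu> = borel_measurable (lebesgue_on \<Omega>)"
  by (intro measurable_cong_sets) (simp_all add: \<mu>_def)

lemma integral_\<mu>:
  fixes h :: "_ \<Rightarrow> 'b::{banach, second_countable_topology}"
  assumes "h \<in> borel_measurable (lebesgue_on \<Omega>)"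
  shows "integral\<^sup>L \<mu> h = (LINT x|lebesgue_on \<Omega>. w x *\<^sub>R h x)"
    and "integrable \<mu> h \<longleftrightarrow> integrable (lebesgue_on \<Omega>) (\<lambda>x. w x *\<^sub>R h x)"
  unfolding \<mu>_def by (simp_all add: integral_density integrable_density assms w_AE)

lemma AE_\<mu>: "(AE x in \<mu>. P x) \<longleftrightarrow> (AE x in lebesgue_on \<Omega>. 0 < w x \<longrightarrow> P x)"
  unfolding \<mu>_def by (subst AE_density) auto

lemma eq_w_iff: "eq_w \<Omega> w \<phi> \<psi> \<longleftrightarrow> (AE x in \<mu>. \<phi> x = \<psi> x)"
  by (simp add: eq_w_def AE_\<mu>)

lemma w_integrable: "integrable (lebesgue_on \<Omega>) w"
  using w_integral not_integrable_integral_eq by fastforce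

lemma emeasure_\<mu>: "emeasure \<mu> (space \<mu>) = 1"
proof -
  have "emeasure \<mu> (space \<mu>) = (\<integral>\<^sup>+x. ennreal (w x) \<partial>lebesgue_on \<Omega>)"
    unfolding \<mu>_def by (subst emeasure_density) (auto intro!: nn_integral_cong)
  also have "\<dots> = ennreal (LINT x|lebesgue_on \<Omega>. w x)"
    by (rule nn_integral_eq_integral[OF w_integrable w_AE])
  finally show ?thesis by (simp add: w_integral)
qed

sublocale finite_measure \<mu>
  by (rule finite_measureI) (simp add: emeasure_\<mu>)

lemma measure_\<mu>: "measure \<mu> (space \<mu>) = 1"
  by (simp add: measure_def emeasure_\<mu>)

lemma L2w_iff: "\<phi> \<in> L2w \<Omega> w \<longleftrightarrow> sq_int \<mu> \<phi>"
proof -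
  have "integrable \<mu> (\<lambda>x. (cmod (\<phi> x))\<^sup>2) \<longleftrightarrow> integrable (lebesgue_on \<Omega>) (\<lambda>x. (cmod (\<phi> x))\<^sup>2 * w x)"
    if [measurable]: "\<phi> \<in> borel_measurable (lebesgue_on \<Omega>)"
    by (subst integral_\<mu>(2)) (auto simp: mult.commute)
  then show ?thesis by (auto simp: L2w_def sq_int_def borel_measurable_\<mu>)
qed

lemma inner_w_eq:
  assumes "\<phi> \<in> borel_measurable (lebesgue_on \<Omega>)" "\<psi> \<in> borel_measurable (lebesgue_on \<Omega>)"
  shows "inner_w \<Omega> w \<phi> \<psi> = ip \<mu> \<phi> \<psi>"
  unfolding inner_w_def ip_def using assms
  by (subst integral_\<mu>(1)) (auto simp: scaleR_conv_of_real mult_ac)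

lemma norm_w_eq:
  assumes [measurable]: "\<phi> \<in> borel_measurable (lebesgue_on \<Omega>)"
  shows "norm_w \<Omega> w \<phi> = sqrt (nsq \<mu> \<phi>)"
  unfolding norm_w_def nsq_def by (subst integral_\<mu>(1)) (auto simp: mult.commute)

lemma sq_int_measurable_\<mu>: "sq_int \<mu> \<phi> \<Longrightarrow> \<phi> \<in> borel_measurable (lebesgue_on \<Omega>)"
  by (simp add: sq_int_def borel_measurable_\<mu>)

text \<open>Lebesgue measure is complete, so an almost everywhere equal function is measurable as well; this
  gives meaning to the integral of \<open>f \<circ> g\<close> for a function \<open>f\<close> that need not be a Borel function.\<close>

lemma integral_AE_eq:
  assumes k: "integrable \<mu> k" and eq: "AE x in \<mu>. h x = k x"
  shows "(LINT x|lebesgue_on \<Omega>. h x * w x) = (LINT x|\<mu>. k x)"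
proof -
  have km [measurable]: "k \<in> borel_measurable (lebesgue_on \<Omega>)"
    using borel_measurable_integrable[OF k] by (simp add: borel_measurable_\<mu>)
  have ae: "AE x in lebesgue_on \<Omega>. k x * w x = h x * w x"
    using eq[unfolded AE_\<mu>] w_AE by eventually_elim (auto simp: less_le)
  have sp: "\<Omega> \<inter> space lebesgue \<in> sets lebesgue" using \<Omega>_lebesgue by simp
  have ae': "AE x in lebesgue. indicator \<Omega> x *\<^sub>R (k x * w x) = indicator \<Omega> x *\<^sub>R (h x * w x)"
    using ae unfolding AE_restrict_space_iff[OF sp] by eventually_elim (auto simp: indicator_def)
  have "(\<lambda>x. k x * w x) \<in> borel_measurable (lebesgue_on \<Omega>)" by measurable
  then have "(\<lambda>x. indicator \<Omega> x *\<^sub>R (k x * w x)) \<in> borel_measurable lebesgue"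
    by (rule iffD1[OF borel_measurable_restrict_space_iff[OF sp]])
  from borel_measurable_AE[OF this ae'] have "(\<lambda>x. h x * w x) \<in> borel_measurable (lebesgue_on \<Omega>)"
    by (rule iffD2[OF borel_measurable_restrict_space_iff[OF sp]])
  then have "(LINT x|lebesgue_on \<Omega>. h x * w x) = (LINT x|lebesgue_on \<Omega>. k x * w x)"
    using ae by (intro integral_cong_AE) auto
  also have "\<dots> = (LINT x|\<mu>. k x)" by (subst integral_\<mu>(1)) (auto simp: mult.commute)
  finally show ?thesis .
qed

text \<open>Every point outside the essential range has a neighbourhood that \<open>g\<close> almost surely avoids. By Lindeloef's
  theorem, countably many of these neighbourhoods cover the complement.\<close>

lemma AE_ess_range:
  assumes [measurable]: "g \<in> borel_measurable (lebesgue_on \<Omega>)"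
  shows "AE x in \<mu>. g x \<in> ess_range \<Omega> w g"
proof -
  define F where "F = {B :: real set. open B \<and> (AE x in \<mu>. g x \<notin> B)}"
  have sp: "\<Omega> \<inter> space lebesgue \<in> sets lebesgue" using \<Omega>_lebesgue by simp
  have cover: "y \<in> \<Union>F" if y: "y \<notin> ess_range \<Omega> w g" for y
  proof -
    obtain \<epsilon> where \<epsilon>: "0 < \<epsilon>" "\<not> 0 < (LINT x:{x\<in>\<Omega>. \<bar>g x - y\<bar> < \<epsilon>}|lebesgue. w x)"
      using y by (auto simp: ess_range_def)
    let ?h = "\<lambda>x. indicator {x. \<bar>g x - y\<bar> < \<epsilon>} x * w x"
    have "(LINT x:{x\<in>\<Omega>. \<bar>g x - y\<bar> < \<epsilon>}|lebesgue. w x) = (LINT x|lebesgue_on \<Omega>. ?h x)"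
      unfolding set_lebesgue_integral_def integral_restrict_space[OF sp]
      by (intro Bochner_Integration.integral_cong) (auto simp: indicator_def)
    moreover have hi: "integrable (lebesgue_on \<Omega>) ?h"
      by (rule Bochner_Integration.integrable_bound[OF w_integrable]) (auto simp: indicator_def, measurable)
    moreover have h0: "AE x in lebesgue_on \<Omega>. 0 \<le> ?h x"
      using w_AE by eventually_elim simp
    ultimately have "(LINT x|lebesgue_on \<Omega>. ?h x) = 0"
      using \<epsilon>(2) integral_nonneg_AE[OF h0] by linarith
    then have "AE x in lebesgue_on \<Omega>. ?h x = 0"
      using integral_nonneg_eq_0_iff_AE[OF hi h0] by simp
    then have "AE x in \<mu>. g x \<notin> ball y \<epsilon>"
      unfolding AE_\<mu> by eventually_elim (auto simp: indicator_def dist_real_def abs_minus_commute split: if_splits)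
    then have "ball y \<epsilon> \<in> F" by (simp add: F_def)
    then show ?thesis using \<epsilon>(1) by (meson UnionI centre_in_ball)
  qed
  obtain F' where F': "F' \<subseteq> F" "countable F'" "\<Union>F' = \<Union>F"
    using Lindelof[of F] by (auto simp: F_def)
  have "AE x in \<mu>. \<forall>B\<in>F'. g x \<notin> B"
    using F' by (subst AE_ball_countable) (auto simp: F_def)
  then show ?thesis
    by eventually_elim (use cover F'(3) in blast)
qed

lemma no_eigenvalue_if_no_atom:
  assumes "AE x in \<mu>. g x \<noteq> t"
  shows "\<not> mult_eigenvalue \<Omega> w g t"
proof
  assume "mult_eigenvalue \<Omega> w g t"
  then obtain \<phi> where \<phi>: "\<not> (AE x in \<mu>. \<phi> x = 0)"
    "AE x in \<mu>. mult_by g \<phi> x = complex_of_real t * \<phi> x"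
    unfolding mult_eigenvalue_def eq_w_iff by blast
  have "AE x in \<mu>. \<phi> x = 0"
    using assms \<phi>(2) by eventually_elim (auto simp: mult_by_def)
  then show False using \<phi>(1) by blast
qed

lemma sq_int_bounded:
  assumes "\<phi> \<in> borel_measurable (lebesgue_on \<Omega>)" "\<And>x. cmod (\<phi> x) \<le> 1"
  shows "sq_int \<mu> \<phi>"
proof -
  have [measurable]: "\<phi> \<in> borel_measurable \<mu>" using assms(1) by (simp add: borel_measurable_\<mu>)
  have "integrable \<mu> (\<lambda>x. (cmod (\<phi> x))\<^sup>2)"
    by (rule integrable_const_bound[where B = 1]) (auto simp: assms(2) power_le_one)
  then show ?thesis by (simp add: sq_int_def)
qed

text \<open>The indicator function of the level set is an eigenfunction.\<close>

lemma eigenvalue_if_atom: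
  assumes [measurable]: "g \<in> borel_measurable (lebesgue_on \<Omega>)" and atom: "\<not> (AE x in \<mu>. g x \<noteq> t)"
  shows "mult_eigenvalue \<Omega> w g t"
proof -
  define \<phi> :: "real^'d \<Rightarrow> complex" where "\<phi> x = of_bool (g x = t)" for x
  have \<phi>: "sq_int \<mu> \<phi>"
    unfolding \<phi>_def by (rule sq_int_bounded) (auto, measurable)
  have eq: "mult_by g \<phi> = (\<lambda>x. complex_of_real t * \<phi> x)"
    by (auto simp: mult_by_def \<phi>_def)
  have "\<phi> \<in> mult_dom \<Omega> w g"
    using \<phi> by (simp add: mult_dom_def L2w_iff eq sq_int_cmult)
  moreover have "\<not> eq_w \<Omega> w \<phi> (\<lambda>x. 0)"
    using atom by (simp add: eq_w_iff \<phi>_def)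
  moreover have "eq_w \<Omega> w (mult_by g \<phi>) (\<lambda>x. complex_of_real t * \<phi> x)"
    by (simp add: eq eq_w_iff)
  ultimately show ?thesis unfolding mult_eigenvalue_def by blast
qed

lemma spectral_family_cdf:
  assumes g: "g \<in> borel_measurable (lebesgue_on \<Omega>)"
  shows "(norm_w \<Omega> w (spectral_family g t (\<lambda>_. 1)))\<^sup>2 = measure \<mu> {x \<in> space \<mu>. g x \<le> t}"
proof -
  have g\<mu>: "g \<in> borel_measurable \<mu>" using g by (simp add: borel_measurable_\<mu>)
  have sf: "spectral_family g t (\<lambda>_. 1) = (\<lambda>x. complex_of_real (indicator {x. g x \<le> t} x))"
    by (simp add: spectral_family_def mult_by_def)
  have m: "(\<lambda>x. complex_of_real (indicator {x. g x \<le> t} x)) \<in> borel_measurable (lebesgue_on \<Omega>)"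
    using g by measurable
  have "(norm_w \<Omega> w (spectral_family g t (\<lambda>_. 1)))\<^sup>2 = nsq \<mu> (\<lambda>x. complex_of_real (indicator {x. g x \<le> t} x))"
    unfolding sf norm_w_eq[OF m] by simp
  also have "\<dots> = (LINT x|\<mu>. indicator {x \<in> space \<mu>. g x \<le> t} x)"
    unfolding nsq_def by (intro Bochner_Integration.integral_cong) (auto simp: indicator_def)
  also have "\<dots> = measure \<mu> {x \<in> space \<mu>. g x \<le> t}"
    using g\<mu> by (simp add: Int_absorb1)
  finally show ?thesis .
qed

lemma orthonormal_basis_\<mu>:
  assumes "orthonormal_w \<Omega> w \<phi>" "span_dense_w \<Omega> w \<phi>"
  shows "orthonormal_basis \<mu> \<phi>"
proof
  have \<phi>: "sq_int \<mu> (\<phi> i)" for i using assms(1) by (simp add: orthonormal_w_def L2w_iff)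
  show "sq_int \<mu> (\<phi> i)" for i by (rule \<phi>)
  show "ip \<mu> (\<phi> i) (\<phi> j) = (if i = j then 1 else 0)" for i j
    using assms(1) inner_w_eq[OF sq_int_measurable_\<mu>[OF \<phi>] sq_int_measurable_\<mu>[OF \<phi>], of i j]
    by (simp add: orthonormal_w_def)
  fix \<psi> and \<epsilon> :: real assume \<psi>: "sq_int \<mu> \<psi>" and e: "0 < \<epsilon>"
  have "\<psi> \<in> L2w \<Omega> w" "0 < sqrt \<epsilon>" using \<psi> e by (simp_all add: L2w_iff)
  then obtain n a where na: "norm_w \<Omega> w (\<lambda>x. \<psi> x - (\<Sum>i\<le>n. a i * \<phi> i x)) < sqrt \<epsilon>"
    using assms(2) unfolding span_dense_w_def by blast
  have "sq_int \<mu> (\<lambda>x. \<psi> x - (\<Sum>i\<le>n. a i * \<phi> i x))"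
    by (intro sq_int_diff \<psi> sq_int_sum sq_int_cmult \<phi>)
  from norm_w_eq[OF sq_int_measurable_\<mu>[OF this]] na
  show "\<exists>n a. nsq \<mu> (\<lambda>x. \<psi> x - (\<Sum>i\<le>n. a i * \<phi> i x)) < \<epsilon>" by auto
qed

text \<open>The \<open>i\<close>-th component of the infinite matrix applied to the coefficients of \<open>\<psi>\<close> is \<open>\<langle>g \<phi>\<^sub>i, \<psi>\<rangle>\<close>, by
  convergence of the Fourier series of \<open>\<psi>\<close>. So square summability means that the coefficients belong to the maximal
  domain of the matrix, which corresponds to the domain of the multiplication operator.\<close>

lemma maximal_domain:
  assumes basis: "orthonormal_basis \<mu> \<phi>"
    and g\<phi>: "\<And>i. sq_int \<mu> (\<lambda>x. complex_of_real (g x) * \<phi> i x)"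
    and rep: "mat_represents \<Omega> w \<phi> g" and \<psi>: "sq_int \<mu> \<psi>"
    and summable: "summable (\<lambda>i. (cmod (ip \<mu> (\<lambda>x. complex_of_real (g x) * \<phi> i x) \<psi>))\<^sup>2)"
  shows "sq_int \<mu> (\<lambda>x. complex_of_real (g x) * \<psi> x)"
proof -
  interpret orthonormal_basis \<mu> \<phi> by (rule basis)
  define v where "v j = ip \<mu> (\<phi> j) \<psi>" for j
  let ?s = "\<lambda>n x. \<Sum>j\<le>n. v j * \<phi> j x"
  have s: "sq_int \<mu> (\<lambda>x. ?s n x - \<psi> x)" for n by (intro sq_int_diff comb_sq_int \<psi>)
  have lim: "(\<lambda>n. nsq \<mu> (\<lambda>x. ?s n x - \<psi> x)) \<longlonglongrightarrow> 0"
    using fourier_tendsto[OF \<psi>] by (simp add: v_def)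
  have vl2: "v \<in> l2" using summable_coeff[OF \<psi>] by (simp add: l2_def v_def)
  have exp: "is_expansion \<Omega> w \<phi> v \<psi>"
    unfolding is_expansion_def
  proof (intro conjI)
    have "(\<lambda>n. sqrt (nsq \<mu> (\<lambda>x. ?s n x - \<psi> x))) \<longlonglongrightarrow> sqrt 0" by (rule tendsto_real_sqrt[OF lim])
    then show "(\<lambda>n. norm_w \<Omega> w (\<lambda>x. ?s n x - \<psi> x)) \<longlonglongrightarrow> 0"
      using norm_w_eq[OF sq_int_measurable_\<mu>[OF s]] by simp
  qed (use vl2 \<psi> in \<open>simp_all add: L2w_iff\<close>)
  have entry: "mat_entry \<Omega> w \<phi> g i j = ip \<mu> (\<lambda>x. complex_of_real (g x) * \<phi> i x) (\<phi> j)" for i j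
    unfolding mat_entry_def mult_by_def ip_mult_real_swap
    by (rule inner_w_eq) (intro sq_int_measurable_\<mu> basis_sq_int g\<phi>)+
  have row: "inf_mat_apply \<Omega> w \<phi> g v i = ip \<mu> (\<lambda>x. complex_of_real (g x) * \<phi> i x) \<psi>" for i
  proof -
    let ?\<theta> = "\<lambda>x. complex_of_real (g x) * \<phi> i x"
    have "(\<lambda>n. ip \<mu> ?\<theta> (\<lambda>x. ?s n x - \<psi> x)) \<longlonglongrightarrow> 0" by (rule tendsto_ip_zero[OF g\<phi> s lim])
    then have "(\<lambda>n. (\<Sum>j\<le>n. mat_entry \<Omega> w \<phi> g i j * v j) - ip \<mu> ?\<theta> \<psi>) \<longlonglongrightarrow> 0"
      by (simp add: ip_diff_right g\<phi> comb_sq_int \<psi> ip_sum_right basis_sq_int entry mult.commute)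
    then have "(\<lambda>n. \<Sum>j\<le>n. mat_entry \<Omega> w \<phi> g i j * v j) \<longlonglongrightarrow> ip \<mu> ?\<theta> \<psi>" by (rule LIM_zero_cancel)
    then have "(\<lambda>j. mat_entry \<Omega> w \<phi> g i j * v j) sums ip \<mu> ?\<theta> \<psi>" by (simp add: sums_def_le)
    then show ?thesis unfolding inf_mat_apply_def by (rule sums_unique[symmetric])
  qed
  have "v \<in> inf_mat_dom \<Omega> w \<phi> g"
    using vl2 summable by (simp add: inf_mat_dom_def l2_def row)
  then have "\<psi> \<in> mult_dom \<Omega> w g" using rep exp unfolding mat_represents_def by blast
  then show ?thesis by (simp add: mult_dom_def L2w_iff mult_by_def)
qed

end

section \<open>The limit theorem\<close>

lemma sing_bound_real:
  assumes "ennreal \<bar>y\<bar> \<le> sing_bound a b p c x" "x \<noteq> c" "0 \<le> a" "0 \<le> b"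
  shows "\<bar>y\<bar> \<le> a + b * (if p = 0 then 1 else \<bar>x - c\<bar> powr (- p))"
proof -
  let ?r = "if p = 0 then 1 else \<bar>x - c\<bar> powr p"
  have r: "0 < ?r" using assms(2) by simp
  have "sing_bound a b p c x = ennreal (a + b / ?r)"
    unfolding sing_bound_def using assms r by (simp only: divide_ennreal ennreal_plus divide_nonneg_pos)
  then have "\<bar>y\<bar> \<le> a + b / ?r"
    using assms r by (simp only: ennreal_le_iff divide_nonneg_pos add_nonneg_nonneg)
  then show ?thesis by (simp add: powr_minus divide_inverse split: if_splits)
qed

theorem theorem30:
  fixes \<Omega> :: "(real^'d) set" and w g :: "real^'d \<Rightarrow> real"
    and \<phi> :: "nat \<Rightarrow> real^'d \<Rightarrow> complex"
    and f :: "real \<Rightarrow> real" and a b p c :: real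
  assumes "\<Omega> \<in> sets lebesgue"
    and "w \<in> borel_measurable (lebesgue_on \<Omega>)"
    and "\<And>x. x \<in> \<Omega> \<Longrightarrow> w x \<ge> 0"
    and "(LINT x|lebesgue_on \<Omega>. w x) = 1"
    and "orthonormal_w \<Omega> w \<phi>"
    and "span_dense_w \<Omega> w \<phi>"
    and "eq_w \<Omega> w (\<phi> 0) (\<lambda>x. 1)"
    and "g \<in> borel_measurable (lebesgue_on \<Omega>)"
    and "\<And>i. integrable (lebesgue_on \<Omega>) (\<lambda>x. (cmod (g x * \<phi> i x))\<^sup>2 * w x)"
    and "mat_represents \<Omega> w \<phi> g"
    and "ereal c = ess_sup_w \<Omega> w g \<or> ereal c = ess_inf_w \<Omega> w g"
    and "\<And>n. \<not> eigenvalue (fin_mat \<Omega> w \<phi> g n) (complex_of_real c)"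
    and "\<And>\<alpha> \<beta>. \<alpha> < \<beta> \<Longrightarrow> c \<notin> {\<alpha>..\<beta>} \<Longrightarrow>
           \<not> mult_eigenvalue \<Omega> w g \<alpha> \<Longrightarrow> \<not> mult_eigenvalue \<Omega> w g \<beta> \<Longrightarrow>
           RS_integrable_spectral \<Omega> w g f \<alpha> \<beta>"
    and "mult_eigenvalue \<Omega> w g c \<Longrightarrow>
           continuous (at c within convex hull (ess_range \<Omega> w g)) f"
    and "a \<ge> 0" and "b \<ge> 0" and "0 \<le> p" and "p \<le> 1"
    and "\<And>x. x \<noteq> c \<Longrightarrow> ennreal \<bar>f x\<bar> \<le> sing_bound a b p c x"
    and "(\<integral>\<^sup>+x. sing_bound a b p c (g x) * ennreal (w x) \<partial>lebesgue_on \<Omega>) < \<infinity>"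
  shows "(\<lambda>n. hermitian_fun f (fin_mat \<Omega> w \<phi> g n) $$ (0, 0))
           \<longlonglongrightarrow> complex_of_real (LINT x|lebesgue_on \<Omega>. f (g x) * w x)"
proof -
  interpret weighted_domain \<Omega> w by unfold_locales (use assms(1-4) in auto)
  have gm [measurable]: "g \<in> borel_measurable (lebesgue_on \<Omega>)" by fact
  have gm\<mu> [measurable]: "g \<in> borel_measurable \<mu>" using gm by (simp add: borel_measurable_\<mu>)
  have basis: "orthonormal_basis \<mu> \<phi>" by (rule orthonormal_basis_\<mu>) fact+
  have \<phi>: "sq_int \<mu> (\<phi> i)" for i using assms(5) by (simp add: orthonormal_w_def L2w_iff)
  have g\<phi>: "sq_int \<mu> (\<lambda>x. complex_of_real (g x) * \<phi> i x)" for i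
  proof -
    have "(\<lambda>x. complex_of_real (g x) * \<phi> i x) \<in> borel_measurable (lebesgue_on \<Omega>)"
      using sq_int_measurable_\<mu>[OF \<phi>[of i]] by measurable
    then have "(\<lambda>x. complex_of_real (g x) * \<phi> i x) \<in> L2w \<Omega> w" using assms(9)[of i] by (simp add: L2w_def)
    then show ?thesis by (simp add: L2w_iff)
  qed
  have \<phi>0: "AE x in \<mu>. \<phi> 0 x = 1" using assms(7) by (simp add: eq_w_iff)
  note maximal = maximal_domain[OF basis g\<phi> assms(10)]

  define m where "m i j = ip \<mu> (\<phi> i) (\<lambda>x. complex_of_real (g x) * \<phi> j x)" for i j
  have entry: "mat_entry \<Omega> w \<phi> g i j = m i j" for i j
    unfolding mat_entry_def mult_by_def m_def
    by (rule inner_w_eq) (intro sq_int_measurable_\<mu> \<phi> g\<phi>)+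
  have fin_mat: "fin_mat \<Omega> w \<phi> g n = mat (Suc n) (Suc n) (\<lambda>(i, j). m i j)" for n
    by (simp add: fin_mat_def entry)
  have herm: "m j i = cnj (m i j)" for i j
    unfolding m_def using ip_commute[of \<mu> "\<phi> j" "\<lambda>x. complex_of_real (g x) * \<phi> i x"]
    by (simp add: ip_mult_real_swap)
  define spec where "spec n u d \<longleftrightarrow>
      (\<forall>i\<le>n. \<forall>j\<le>n. (\<Sum>k\<le>n. u i k * cnj (u j k)) = (if i = j then 1 else 0)) \<and>
      (\<forall>i\<le>n. \<forall>j\<le>n. (\<Sum>k\<le>n. cnj (u k i) * u k j) = (if i = j then 1 else 0)) \<and>
      (\<forall>i\<le>n. \<forall>j\<le>n. m i j = (\<Sum>k\<le>n. u i k * complex_of_real (d k) * cnj (u j k))) \<and>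
      (\<forall>f. hermitian_fun f (fin_mat \<Omega> w \<phi> g n) $$ (0, 0) =
        complex_of_real (\<Sum>k\<le>n. (cmod (u 0 k))\<^sup>2 * f (d k)))" for n u d
  have "\<exists>u d. spec n u d" for n
    unfolding spec_def
    by (rule hermitian_spectral_entries[where m = m and n = "Suc n", OF herm])
      (unfold fin_mat lessThan_Suc_atMost less_Suc_eq_le, blast)
  then obtain u d where spec: "\<And>n. spec n (u n) (d n)" by metis
  have u_rows: "(\<Sum>k\<le>n. u n i k * cnj (u n j k)) = (if i = j then 1 else 0)"
    and u_cols: "(\<Sum>k\<le>n. cnj (u n k i) * u n k j) = (if i = j then 1 else 0)"
    and spectral: "m i j = (\<Sum>k\<le>n. u n i k * complex_of_real (d n k) * cnj (u n j k))"
    if "i \<le> n" "j \<le> n" for n i j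
    using spec[of n] that unfolding spec_def by blast+
  have fun_entry: "hermitian_fun f (fin_mat \<Omega> w \<phi> g n) $$ (0, 0)
      = complex_of_real (\<Sum>k\<le>n. (cmod (u n 0 k))\<^sup>2 * f (d n k))" for n f
    using spec[of n] unfolding spec_def by blast
  interpret orthonormal_basis \<mu> \<phi> by (rule basis)
  interpret truncated_matrices \<mu> \<phi> g u d
    by unfold_locales (use measure_\<mu> \<phi>0 gm\<mu> g\<phi> u_rows u_cols spectral in \<open>auto simp: m_def\<close>)

  \<comment> \<open>The columns of \<open>u n\<close> are eigenvectors of the finite matrix.\<close>
  have not_eigen: "d n k \<noteq> c" if k: "k \<le> n" for n k
  proof
    assume dc: "d n k = c"
    define v where "v = vec (Suc n) (\<lambda>i. u n i k)"
    have "fin_mat \<Omega> w \<phi> g n *\<^sub>v v = complex_of_real c \<cdot>\<^sub>v v"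
    proof (rule eq_vecI)
      fix i assume "i < dim_vec (complex_of_real c \<cdot>\<^sub>v v)"
      then have i: "i \<le> n" by (simp add: v_def)
      have "(fin_mat \<Omega> w \<phi> g n *\<^sub>v v) $ i = (\<Sum>j\<le>n. m i j * u n j k)"
        using i unfolding fin_mat v_def lessThan_Suc_atMost[symmetric] lessThan_atLeast0
        by (auto simp: scalar_prod_def simp del: sum.op_ivl_Suc intro!: sum.cong)
      also have "\<dots> = c * u n i k" using eigenvector[OF i k] dc by (simp add: m_def)
      finally show "(fin_mat \<Omega> w \<phi> g n *\<^sub>v v) $ i = (complex_of_real c \<cdot>\<^sub>v v) $ i"
        using i by (simp add: v_def)
    qed (simp add: fin_mat v_def)
    moreover have "v \<noteq> 0\<^sub>v (Suc n)"
    proof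
      assume v0: "v = 0\<^sub>v (Suc n)"
      have "u n i k = 0" if "i \<le> n" for i
        using arg_cong[OF v0, of "\<lambda>v. v $ i"] that by (simp add: v_def)
      then show False using u_cols[OF k k] by simp
    qed
    ultimately have "eigenvalue (fin_mat \<Omega> w \<phi> g n) (complex_of_real c)"
      unfolding eigenvalue_def eigenvector_def by (intro exI[of _ v]) (simp add: fin_mat v_def)
    then show False using assms(12) by blast
  qed

  have range: "AE x in \<mu>. g x \<in> ess_range \<Omega> w g" by (rule AE_ess_range[OF gm])
  \<comment> \<open>The sign treats the two endpoints at once: \<open>\<sigma> (c - y) = \<bar>y - c\<bar>\<close> on the essential range.\<close>
  obtain \<sigma> :: real where sign: "\<sigma> = 1 \<or> \<sigma> = -1"
    and range_side: "\<And>y. y \<in> ess_range \<Omega> w g \<Longrightarrow> 0 \<le> \<sigma> * (c - y)"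
  proof (cases "ereal c = ess_sup_w \<Omega> w g")
    case True
    have "y \<le> c" if "y \<in> ess_range \<Omega> w g" for y
    proof -
      have "ereal y \<le> ess_sup_w \<Omega> w g" unfolding ess_sup_w_def by (rule SUP_upper) (rule hull_inc[OF that])
      then show ?thesis by (simp flip: True)
    qed
    then show ?thesis by (intro that[of 1]) auto
  next
    case False
    then have inf: "ereal c = ess_inf_w \<Omega> w g" using assms(11) by simp
    have "c \<le> y" if "y \<in> ess_range \<Omega> w g" for y
    proof -
      have "ess_inf_w \<Omega> w g \<le> ereal y" unfolding ess_inf_w_def by (rule INF_lower) (rule hull_inc[OF that])
      then show ?thesis by (simp flip: inf)
    qed
    then show ?thesis by (intro that[of "-1"]) auto
  qed
  have g_side: "AE x in \<mu>. 0 \<le> \<sigma> * (c - g x)" using range by eventually_elim (rule range_side)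
  interpret one_sided_quadrature \<mu> g wt d c \<sigma>
    by (rule one_sided_quadrature_truncated[OF sign g_side not_eigen maximal])

  have quad_fun: "hermitian_fun f (fin_mat \<Omega> w \<phi> g n) $$ (0, 0) = complex_of_real (quad n f)" for n
    by (simp add: fun_entry quad_def wt_def)
  have D_c: "D x = 0 \<longleftrightarrow> x = c" for x using sign by (auto simp: D_def)
  have bound: "\<bar>f x\<bar> \<le> a + b * (if p = 0 then 1 else D x powr (- p))" if "0 < D x" for x
  proof -
    have "x \<noteq> c" using that D_c by force
    moreover have abs: "\<bar>x - c\<bar> = D x" using that abs_diff_c[of x] by simp
    ultimately show ?thesis
      unfolding abs[symmetric] using assms(15,16,19) by (intro sing_bound_real) auto
  qed
  have inner: "squeezed_on_intervals f"
    unfolding squeezed_on_intervals_def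
  proof (intro allI impI)
    fix \<alpha> \<beta> \<epsilon> :: real
    assume e: "0 < \<epsilon>" and ab: "\<alpha> < \<beta>" "0 < D \<alpha>" "0 < D \<beta>" "AE x in \<mu>. g x \<noteq> \<alpha>" "AE x in \<mu>. g x \<noteq> \<beta>"
    define r where "r = min (D \<alpha>) (D \<beta>)"
    have r: "0 < r" "\<And>x. x \<in> {\<alpha>..\<beta>} \<Longrightarrow> r \<le> D x"
      using ab sign by (auto simp: r_def D_def)
    have "c \<notin> {\<alpha>..\<beta>}" using r(1) r(2)[of c] by (auto simp: D_def)
    then have "RS_integrable_spectral \<Omega> w g f \<alpha> \<beta>"
      using ab by (intro assms(13) no_eigenvalue_if_no_atom)
    moreover have "(\<lambda>_. 1) \<in> L2w \<Omega> w" unfolding L2w_iff by (rule sq_int_bounded) auto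
    ultimately have RS: "RS_integrable f cdf_g \<alpha> \<beta>"
      unfolding RS_integrable_spectral_def by (force simp: spectral_family_cdf[OF gm] cdf_g_def[abs_def])
    have bounded: "\<bar>f x\<bar> \<le> a + b * (if p = 0 then 1 else r powr (- p))" if x: "x \<in> {\<alpha>..\<beta>}" for x
    proof -
      have "D x powr (- p) \<le> r powr (- p)" using r(1) r(2)[OF x] assms(17) by (intro powr_mono2') auto
      then have "b * (if p = 0 then 1 else D x powr (- p)) \<le> b * (if p = 0 then 1 else r powr (- p))"
        using assms(16) by (intro mult_left_mono) auto
      then show ?thesis using bound[of x] r(1) r(2)[OF x] by linarith
    qed
    show "\<exists>L U. quad_conv L \<and> quad_conv U \<and> (\<forall>x\<in>{\<alpha><..\<beta>}. L x \<le> f x \<and> f x \<le> U x) \<and>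
        (\<forall>x. x \<notin> {\<alpha><..\<beta>} \<longrightarrow> L x = 0 \<and> U x = 0) \<and> (LINT x|\<mu>. U (g x) - L (g x)) \<le> \<epsilon>"
      by (rule RS_integrable_inner[OF RS ab bounded e])
  qed

  obtain k where k: "integrable \<mu> k" "AE x in \<mu>. f (g x) = k x" "(\<lambda>n. quad n f) \<longlonglongrightarrow> (LINT x|\<mu>. k x)"
  proof (cases "b = 0 \<or> p = 0")
    case True
    then have bounded: "\<bar>f x\<bar> \<le> a + b" if "0 < D x" for x using bound[OF that] by auto
    show ?thesis
    proof (cases "AE x in \<mu>. g x \<noteq> c")
      case no_atom: True
      show ?thesis
      proof (rule quad_tendsto_no_atom[OF no_atom inner])
        show "\<exists>C R. 0 \<le> C \<and> quad_conv R \<and> (\<forall>x. 0 < D x \<longrightarrow> 0 \<le> R x \<and> \<bar>f x\<bar> \<le> C + R x) \<and>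
            (LINT x|\<mu>. R (g x)) \<le> \<epsilon>" if "0 < \<epsilon>" for \<epsilon>
          by (rule exI[of _ "a + b"], rule exI[of _ "\<lambda>_. 0"]) (use bounded that assms(15,16) in auto)
      qed (assumption | rule that)+
    next
      case atom: False
      have cont: "continuous (at c within convex hull (ess_range \<Omega> w g)) f"
        by (intro assms(14) eigenvalue_if_atom gm atom)
      have c_range: "c \<in> ess_range \<Omega> w g"
        using atom range by (metis (mono_tags, lifting) eventually_mono)
      \<comment> \<open>If \<open>c\<close> were the only point of the essential range, it would be an eigenvalue of the matrices. So the
        hull contains all points near \<open>c\<close> on the side of the nodes, and continuity at \<open>c\<close> applies to the nodes.\<close>
      have "\<exists>y\<in>ess_range \<Omega> w g. y \<noteq> c"
      proof (rule ccontr)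
        assume "\<not> ?thesis"
        then have eq: "AE x in \<mu>. g x = c" using range by (auto elim!: eventually_mono)
        have "AE x in \<mu>. 0 \<le> - c + 1 * g x" "AE x in \<mu>. 0 \<le> c + (-1) * g x"
          using eq by (auto elim!: eventually_mono)
        from affine_rayleigh[OF le_refl this(1), of 0] affine_rayleigh[OF le_refl this(2), of 0]
        show False using not_eigen[of 0 0] by simp
      qed
      then obtain y where y: "y \<in> ess_range \<Omega> w g" "y \<noteq> c" by blast
      have Dy: "0 < D y" using range_side[OF y(1)] y(2) D_c[of y] by (simp add: D_def less_le)
      have hull: "x \<in> convex hull (ess_range \<Omega> w g)" if "0 \<le> D x" "D x \<le> D y" for x
      proof -
        have "x \<in> closed_segment c y"
          using that sign by (auto simp: D_def closed_segment_eq_real_ivl)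
        moreover have "closed_segment c y \<subseteq> convex hull (ess_range \<Omega> w g)"
          by (rule closed_segment_subset) (use c_range y in \<open>auto intro: hull_inc\<close>)
        ultimately show ?thesis by blast
      qed
      show ?thesis
      proof (rule quad_tendsto_atom[where S = "{x. 0 \<le> D x}" and C = "a + b", OF _ _ _ inner])
        show "d n k \<in> {x. 0 \<le> D x}" if "k \<le> n" for n k using D_nd[OF that] by simp
        show "AE x in \<mu>. g x \<in> {x. 0 \<le> D x}" using D_g by simp
        show "\<exists>\<delta>>0. \<forall>x\<in>{x. 0 \<le> D x}. D x < \<delta> \<longrightarrow> \<bar>f x - f c\<bar> \<le> \<epsilon>" if e: "0 < \<epsilon>" for \<epsilon>
        proof -
          obtain \<delta> where \<delta>: "0 < \<delta>" "\<And>x. x \<in> convex hull (ess_range \<Omega> w g) \<Longrightarrow> dist x c < \<delta> \<Longrightarrow> dist (f x) (f c) < \<epsilon>"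
            using cont e unfolding continuous_within_eps_delta by blast
          have "\<bar>f x - f c\<bar> \<le> \<epsilon>" if "0 \<le> D x" "D x < min \<delta> (D y)" for x
          proof -
            have "dist x c < \<delta>" using that abs_diff_c[of x] by (simp add: dist_real_def)
            from \<delta>(2)[OF hull this] show ?thesis using that by (simp add: dist_real_def)
          qed
          then show ?thesis using \<delta>(1) Dy by (intro exI[of _ "min \<delta> (D y)"]) auto
        qed
      qed (assumption | rule that bounded | simp add: assms(15,16))+
    qed
  next
    case False
    then have bp: "0 < b" "0 < p" using assms(16,17) by auto
    have meas [measurable]: "(\<lambda>x. sing_bound a b p c (g x)) \<in> borel_measurable (lebesgue_on \<Omega>)"
      unfolding sing_bound_def by measurable
    have fin: "(\<integral>\<^sup>+x. sing_bound a b p c (g x) \<partial>\<mu>) < \<infinity>"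
      unfolding \<mu>_def using assms(20) by (subst nn_integral_density) (auto simp: mult.commute)
    have "AE x in \<mu>. sing_bound a b p c (g x) \<noteq> \<infinity>"
      by (rule nn_integral_PInf_AE) (use fin meas in \<open>auto simp: \<mu>_def\<close>)
    then have no_atom: "AE x in \<mu>. g x \<noteq> c"
    proof eventually_elim
      case (elim x)
      then show ?case using bp by (auto simp: sing_bound_def ennreal_divide_eq_top_iff)
    qed
    then have D0: "AE x in \<mu>. D (g x) \<noteq> 0" using D_c by simp
    have int: "integrable \<mu> (\<lambda>x. D (g x) powr (- p))"
    proof (rule integrableI_bounded)
      have "(\<integral>\<^sup>+x. ennreal b * ennreal (norm (D (g x) powr (- p))) \<partial>\<mu>) \<le> (\<integral>\<^sup>+x. sing_bound a b p c (g x) \<partial>\<mu>)"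
      proof (rule nn_integral_mono_AE)
        show "AE x in \<mu>. ennreal b * ennreal (norm (D (g x) powr (- p))) \<le> sing_bound a b p c (g x)"
          using D0 D_g
        proof eventually_elim
          case (elim x)
          then have pos: "0 < D (g x)" by simp
          have "ennreal b * ennreal (norm (D (g x) powr (- p))) = ennreal (b / D (g x) powr p)"
            using bp by (simp add: powr_minus divide_inverse ennreal_mult)
          also have "\<dots> = ennreal b / ennreal (\<bar>g x - c\<bar> powr p)"
            using pos bp by (simp add: divide_ennreal abs_diff_c)
          also have "\<dots> \<le> sing_bound a b p c (g x)" using bp by (simp add: sing_bound_def)
          finally show ?case .
        qed
      qed
      then have "ennreal b * (\<integral>\<^sup>+x. ennreal (norm (D (g x) powr (- p))) \<partial>\<mu>) < \<infinity>"
        using fin by (subst (asm) nn_integral_cmult) (auto intro: le_less_trans)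
      then show "(\<integral>\<^sup>+x. ennreal (norm (D (g x) powr (- p))) \<partial>\<mu>) < \<infinity>"
        using bp by (auto simp: ennreal_mult_less_top)
    qed measurable
    show ?thesis
    proof (rule quad_tendsto_no_atom[OF no_atom inner])
      show "\<exists>C R. 0 \<le> C \<and> quad_conv R \<and> (\<forall>x. 0 < D x \<longrightarrow> 0 \<le> R x \<and> \<bar>f x\<bar> \<le> C + R x) \<and>
          (LINT x|\<mu>. R (g x)) \<le> \<epsilon>" if "0 < \<epsilon>" for \<epsilon>
      proof (rule tail_powr[OF bp(2) assms(18,15,16) D0 int _ that])
        show "\<bar>f x\<bar> \<le> a + b * D x powr (- p)" if "0 < D x" for x using bound[OF that] bp by simp
      qed
    qed (assumption | rule that)+
  qed

  have "(LINT x|lebesgue_on \<Omega>. f (g x) * w x) = (LINT x|\<mu>. k x)" by (rule integral_AE_eq[OF k(1,2)])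
  with tendsto_of_real[OF k(3)] show ?thesis unfolding quad_fun by simp
qed

end
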